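(* Let the optimal control problem associated with the tuple $\{c,g,f,U,T\}$ be of class $L$, with value function $V^*$. Let $J$ be an admissible candidate value function for this problem, with associated admissible controller $\pi_J$ and corresponding admissible input $u_{\pi_J,x_0}$. Then for any $x_0\in\mathbb{R}^n$, $$L(u_{\pi_J,x_0},x_0)\le C\,\|J-V^*\|_{W^{1,\infty}([0,T]\times B_R(0))},\qquad C:=2\max\{1,\,T,\,T\beta_f(1+R)\},$$ where $R:=(1+\|x_0\|_2)e^{\beta_f T}-1$, $\beta_f>0$ is the linear growth constant of $f$ from the definition of class $L$, and $L$ is the optimality gap $$L(u,x_0):=\int_0^T c(s,x_{u,x_0}(s),u(s))\,ds+g(x_{u,x_0}(T))-V^*(0,x_0).$$
   Context: **Optimal control problem (OCP).** Data: $c:\mathbb{R}\times\mathbb{R}^n\times\mathbb{R}^m\to\mathbb{R}$, $g:\mathbb{R}^n\to\mathbb{R}$, $f:\mathbb{R}\times\mathbb{R}^n\times\mathbb{R}^m\to\mathbb{R}^n$, $U\subset\mathbb{R}^m$, $T>0$. For $(t_0,x_0)\in[0,T]\times\mathbb{R}^n$ an admissible input is a measurable $u:[t_0,T]\to\mathbb{R}^m$ with $u(t)\in U$ for all $t\in[t_0,T]$. The value function is $$V^*(t_0,x_0):=\inf_u\int_{t_0}^T c(t,x(t),u(t))\,dt+g(x(T)),$$ the infimum being over admissible inputs, where $x$ is the solution of $\dot x(t)=f(t,x(t),u(t))$ on $[t_0,T]$, $x(t_0)=x_0$. **Class $L$.** The OCP is of class $L$ if: (1) $U$ is compact; (2)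 $f,c,g$ are uniformly Lipschitz continuous in the state variable and uniformly continuous in the time and input variables (where they depend on these); specifically there are $\alpha_f,\alpha_c,\alpha_g>0$ with $\|f(t,x,u)-f(t,y,u)\|_2\le\alpha_f\|x-y\|_2$, $|c(t,x,u)-c(t,y,u)|\le\alpha_c\|x-y\|_2$, $|g(x)-g(y)|\le\alpha_g\|x-y\|_2$ for all $x,y\in\mathbb{R}^n$, $t\in[0,T]$, $u\in U$; (3) there are $\beta_f,\beta_c,\beta_g>0$ with $\|f(t,x,u)\|_2\le\beta_f(1+\|x\|_2)$, $|c(t,x,u)|\le\beta_c(1+\|x\|_2)$, $|g(x)|\le\beta_g(1+\|x\|_2)$ for all $x\in\mathbb{R}^n$, $t\in[0,T]$, $u\in U$. For class $L$ problems and any admissible input $u:[0,T]\to U$ there is a unique absolutely continuous solution with $t_0=0$, denoted $x_{u,x_0}$. **Admissible controller.** A measurable function $\pi(t,x)$ such that for every $(t_0,x_0)\in[0,T]\times\mathbb{R}^n$ the problem $\dot x(t)=f(t,x(t),\pi(t,x(t)))$, $x(t_0)=x_0$, has a unique solution and $\pi(t,x(t))\in U$ for all $t\in[t_0,T]$. For $t_0=0$, the corresponding admissible input is $u_{\pi,x_0}(t):=\pi(t,x(t))$. **Differentials.** For continuous $u:\Omega\to\mathbb{R}$, $\Omega\subset\mathbb{R}^N$, $x\in\Omega$: $D^+u(x)$ is the set of $p\in\mathbb{R}^N$ with $\limsup_{y\to x,\,y\in\Omega}\frac{u(y)-u(x)-p^\top(y-x)}{|y-x|}\le0$; $D^-u(x)$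 is the set of $p\in\mathbb{R}^N$ with $\liminf_{y\to x,\,y\in\Omega}\frac{u(y)-u(x)-p^\top(y-x)}{|y-x|}\ge0$; $D^\pm u(x):=D^+u(x)\cup D^-u(x)$. For Lipschitz $u$, the Clarke generalized gradient $\partial_Cu(x)$ is the set of $p\in\mathbb{R}^N$ with $p^\top v\le\limsup_{y\to x,\,h\downarrow0}\frac{u(y+hv)-u(y)}{h}$ for all $v\in\mathbb{R}^N$. For a function $J(t,x)$ of time and state, elements are written $(p,q)$ with $p\in\mathbb{R}$ the time component and $q\in\mathbb{R}^n$ the spatial component. **Admissible candidate value function.** Let $H(t,x,u,q):=c(t,x,u)+q^\top f(t,x,u)$. For a class $L$ OCP, a uniformly Lipschitz function $J:[0,T]\times\mathbb{R}^n\to\mathbb{R}$ is an admissible candidate value function if (1) $D^\pm J(t,x)=\partial_CJ(t,x)$ for all $(t,x)\in[0,T]\times\mathbb{R}^n$; and (2) there exist an admissible controller $\pi_J:[0,T]\times\mathbb{R}^n\to U$ and measurable functions $(p_J(t,x),q_J(t,x))\in D^\pm J(t,x)$ such that, for all $(t,x)\in[0,T]\times\mathbb{R}^n$, $$(p_J(t,x),q_J(t,x),\pi_J(t,x))\in\arg\inf_{(p,q,u)\in D^\pm J(t,x)\times U}\{p+H(t,x,u,q)\}.$$ Any such $\pi_J$ is called an associated admissible controller. **Norms.** $\|\cdot\|_2$ is the Euclidean norm, $B_R(0)=\{y\in\mathbb{R}^n:\|y\|_2<R\}$, and $\|w\|_{W^{1,\infty}(\Omega)}:=\sum_{|\alpha|\le1}\operatorname{ess\,sup}_{\Omega}|D^\alpha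 w|$ (weak derivatives, in all time and space variables). *)

theory Defs
  imports "HOL-Analysis.Analysis" "HOL-Probability.Essential_Supremum"
begin

section \<open>Absolutely continuous solutions of differential equations\<close>

definition abs_cont_on :: "real \<Rightarrow> real \<Rightarrow> (real \<Rightarrow> 'a::real_normed_vector) \<Rightarrow> bool" where
  "abs_cont_on a b x \<longleftrightarrow>
    (\<forall>\<epsilon>>0. \<exists>\<delta>>0. \<forall>(N::nat) l r.
      (\<forall>i<N. a \<le> l i \<and> l i \<le> r i \<and> r i \<le> b) \<longrightarrow>
      (\<forall>i<N. \<forall>j<N. i \<noteq> j \<longrightarrow> {l i<..<r i} \<inter> {l j<..<r j} = {}) \<longrightarrow>
      (\<Sum>i<N. r i - l i) < \<delta> \<longrightarrow> (\<Sum>i<N. norm (x (r i) - x (l i))) < \<epsilon>)"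

definition ode_solution ::
  "(real \<Rightarrow> 'a::euclidean_space \<Rightarrow> 'a) \<Rightarrow> real \<Rightarrow> real \<Rightarrow> 'a \<Rightarrow> (real \<Rightarrow> 'a) \<Rightarrow> bool" where
  "ode_solution F t0 T x0 x \<longleftrightarrow>
    abs_cont_on t0 T x \<and> x t0 = x0 \<and>
    (AE t in lebesgue_on {t0..T}. (x has_vector_derivative F t (x t)) (at t within {t0..T}))"

text \<open>Solutions are functions on all of the reals of which only the restriction to the interval
  from \<^term>\<open>t0\<close> to \<^term>\<open>T\<close> matters; uniqueness and the choice below are to be read accordingly.\<close>

definition unique_ode_solution ::
  "(real \<Rightarrow> 'a::euclidean_space \<Rightarrow> 'a) \<Rightarrow> real \<Rightarrow> real \<Rightarrow> 'a \<Rightarrow> bool" where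
  "unique_ode_solution F t0 T x0 \<longleftrightarrow>
    (\<exists>x. ode_solution F t0 T x0 x) \<and>
    (\<forall>x y. ode_solution F t0 T x0 x \<longrightarrow> ode_solution F t0 T x0 y \<longrightarrow> (\<forall>t\<in>{t0..T}. x t = y t))"

definition the_ode_solution ::
  "(real \<Rightarrow> 'a::euclidean_space \<Rightarrow> 'a) \<Rightarrow> real \<Rightarrow> real \<Rightarrow> 'a \<Rightarrow> real \<Rightarrow> 'a" where
  "the_ode_solution F t0 T x0 = (SOME x. ode_solution F t0 T x0 x)"


section \<open>The optimal control problem\<close>

definition admissible_input :: "(real^'m) set \<Rightarrow> real \<Rightarrow> real \<Rightarrow> (real \<Rightarrow> real^'m) \<Rightarrow> bool" where
  "admissible_input U T t0 u \<longleftrightarrow>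
    u \<in> borel_measurable (lebesgue_on {t0..T}) \<and> (\<forall>t\<in>{t0..T}. u t \<in> U)"

definition cost ::
  "(real \<Rightarrow> real^'n \<Rightarrow> real^'m \<Rightarrow> real) \<Rightarrow> (real^'n \<Rightarrow> real) \<Rightarrow> real \<Rightarrow>
    real \<Rightarrow> (real \<Rightarrow> real^'m) \<Rightarrow> (real \<Rightarrow> real^'n) \<Rightarrow> real" where
  "cost c g T t0 u x = (LINT t|lebesgue_on {t0..T}. c t (x t) (u t)) + g (x T)"

text \<open>For class L data with nonempty \<^term>\<open>U\<close> the set below is nonempty and bounded below,
  so the real-valued infimum is the true one.\<close>

definition value_function ::
  "(real \<Rightarrow> real^'n \<Rightarrow> real^'m \<Rightarrow> real) \<Rightarrow> (real^'n \<Rightarrow> real) \<Rightarrow>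
    (real \<Rightarrow> real^'n \<Rightarrow> real^'m \<Rightarrow> real^'n) \<Rightarrow> (real^'m) set \<Rightarrow> real \<Rightarrow>
    real \<Rightarrow> real^'n \<Rightarrow> real" where
  "value_function c g f U T t0 x0 =
    Inf {cost c g T t0 u x | u x.
      admissible_input U T t0 u \<and> ode_solution (\<lambda>t y. f t y (u t)) t0 T x0 x}"

definition optimality_gap ::
  "(real \<Rightarrow> real^'n \<Rightarrow> real^'m \<Rightarrow> real) \<Rightarrow> (real^'n \<Rightarrow> real) \<Rightarrow>
    (real \<Rightarrow> real^'n \<Rightarrow> real^'m \<Rightarrow> real^'n) \<Rightarrow> (real^'m) set \<Rightarrow> real \<Rightarrow>
    (real \<Rightarrow> real^'m) \<Rightarrow> real^'n \<Rightarrow> real" where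
  "optimality_gap c g f U T u x0 =
    cost c g T 0 u (the_ode_solution (\<lambda>t y. f t y (u t)) 0 T x0) - value_function c g f U T 0 x0"

text \<open>The linear growth constant \<^term>\<open>\<beta>f\<close> of \<^term>\<open>f\<close> is a parameter because it occurs in the
  error bound. Uniform continuity in time and input is required for each fixed state, not
  uniformly over all states.\<close>

definition class_L ::
  "(real \<Rightarrow> real^'n \<Rightarrow> real^'m \<Rightarrow> real) \<Rightarrow> (real^'n \<Rightarrow> real) \<Rightarrow>
    (real \<Rightarrow> real^'n \<Rightarrow> real^'m \<Rightarrow> real^'n) \<Rightarrow> (real^'m) set \<Rightarrow> real \<Rightarrow> real \<Rightarrow> bool" where
  "class_L c g f U T \<beta>f \<longleftrightarrow>
    compact U \<and>
    (\<exists>\<alpha>f>0. \<forall>x y. \<forall>t\<in>{0..T}. \<forall>u\<in>U. norm (f t x u - f t y u) \<le> \<alpha>f * norm (x - y)) \<and>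
    (\<exists>\<alpha>c>0. \<forall>x y. \<forall>t\<in>{0..T}. \<forall>u\<in>U. \<bar>c t x u - c t y u\<bar> \<le> \<alpha>c * norm (x - y)) \<and>
    (\<exists>\<alpha>g>0. \<forall>x y. \<bar>g x - g y\<bar> \<le> \<alpha>g * norm (x - y)) \<and>
    (\<forall>x. uniformly_continuous_on ({0..T} \<times> U) (\<lambda>(t, u). f t x u)) \<and>
    (\<forall>x. uniformly_continuous_on ({0..T} \<times> U) (\<lambda>(t, u). c t x u)) \<and>
    \<beta>f > 0 \<and> (\<forall>x. \<forall>t\<in>{0..T}. \<forall>u\<in>U. norm (f t x u) \<le> \<beta>f * (1 + norm x)) \<and>
    (\<exists>\<beta>c>0. \<forall>x. \<forall>t\<in>{0..T}. \<forall>u\<in>U. \<bar>c t x u\<bar> \<le> \<beta>c * (1 + norm x)) \<and>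
    (\<exists>\<beta>g>0. \<forall>x. \<bar>g x\<bar> \<le> \<beta>g * (1 + norm x))"

text \<open>The closed-loop input generated by the controller has to be an admissible input, i.e. it takes
  values in \<^term>\<open>U\<close> and is measurable. Measurability is automatic for Borel measurable controllers,
  but not for Lebesgue measurable ones, which are allowed here.\<close>

definition admissible_controller ::
  "(real \<Rightarrow> real^'n \<Rightarrow> real^'m \<Rightarrow> real^'n) \<Rightarrow> (real^'m) set \<Rightarrow> real \<Rightarrow>
    (real \<Rightarrow> real^'n \<Rightarrow> real^'m) \<Rightarrow> bool" where
  "admissible_controller f U T \<pi> \<longleftrightarrow>
    (\<lambda>(t, x). \<pi> t x) \<in> borel_measurable (lebesgue_on ({0..T} \<times> UNIV)) \<and>
    (\<forall>t0\<in>{0..T}. \<forall>x0.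
      unique_ode_solution (\<lambda>t y. f t y (\<pi> t y)) t0 T x0 \<and>
      (\<forall>x. ode_solution (\<lambda>t y. f t y (\<pi> t y)) t0 T x0 x \<longrightarrow>
        admissible_input U T t0 (\<lambda>t. \<pi> t (x t))))"

definition controller_input ::
  "(real \<Rightarrow> real^'n \<Rightarrow> real^'m \<Rightarrow> real^'n) \<Rightarrow> real \<Rightarrow> (real \<Rightarrow> real^'n \<Rightarrow> real^'m) \<Rightarrow> real^'n \<Rightarrow>
    real \<Rightarrow> real^'m" where
  "controller_input f T \<pi> x0 t = \<pi> t (the_ode_solution (\<lambda>t y. f t y (\<pi> t y)) 0 T x0 t)"


section \<open>Generalized differentials\<close>

definition superdiff :: "'a::euclidean_space set \<Rightarrow> ('a \<Rightarrow> real) \<Rightarrow> 'a \<Rightarrow> 'a set" where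
  "superdiff \<Omega> u x =
    {p. Limsup (at x within \<Omega>) (\<lambda>y. ereal ((u y - u x - p \<bullet> (y - x)) / norm (y - x))) \<le> 0}"

definition subdiff :: "'a::euclidean_space set \<Rightarrow> ('a \<Rightarrow> real) \<Rightarrow> 'a \<Rightarrow> 'a set" where
  "subdiff \<Omega> u x =
    {p. Liminf (at x within \<Omega>) (\<lambda>y. ereal ((u y - u x - p \<bullet> (y - x)) / norm (y - x))) \<ge> 0}"

definition semidiff :: "'a::euclidean_space set \<Rightarrow> ('a \<Rightarrow> real) \<Rightarrow> 'a \<Rightarrow> 'a set" where
  "semidiff \<Omega> u x = superdiff \<Omega> u x \<union> subdiff \<Omega> u x"

text \<open>Only difference quotients with both points in the domain \<^term>\<open>\<Omega>\<close> of \<^term>\<open>u\<close> are taken;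
  at interior points of \<^term>\<open>\<Omega>\<close> this is no restriction.\<close>

definition clarke_gradient :: "'a::euclidean_space set \<Rightarrow> ('a \<Rightarrow> real) \<Rightarrow> 'a \<Rightarrow> 'a set" where
  "clarke_gradient \<Omega> u x =
    {p. \<forall>v. ereal (p \<bullet> v) \<le>
      Limsup (inf (nhds x \<times>\<^sub>F at_right 0) (principal {(y, h). y \<in> \<Omega> \<and> y + h *\<^sub>R v \<in> \<Omega>}))
        (\<lambda>(y, h). ereal ((u (y + h *\<^sub>R v) - u y) / h))}"


section \<open>Admissible candidate value functions\<close>

definition hamiltonian ::
  "(real \<Rightarrow> real^'n \<Rightarrow> real^'m \<Rightarrow> real) \<Rightarrow> (real \<Rightarrow> real^'n \<Rightarrow> real^'m \<Rightarrow> real^'n) \<Rightarrow>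
    real \<Rightarrow> real^'n \<Rightarrow> real^'m \<Rightarrow> real^'n \<Rightarrow> real" where
  "hamiltonian c f t x u q = c t x u + q \<bullet> f t x u"

text \<open>
  The conditions on differentials are imposed at times strictly between \<^term>\<open>0\<close> and \<^term>\<open>T\<close>.
  At \<^term>\<open>t = 0\<close> and \<^term>\<open>t = T\<close> the one-sided differentials on the slab are invariant under adding
  suitable multiples of the time direction, so they are empty or unbounded, whereas the Clarke
  gradient of a Lipschitz function is nonempty and bounded: there equality is never satisfied.
  Requiring the conditions in the interior only is weaker than requiring them on the closed slab
  under any reading of the differentials at its boundary.
\<close>

definition associated_controller ::
  "(real \<Rightarrow> real^'n \<Rightarrow> real^'m \<Rightarrow> real) \<Rightarrow> (real \<Rightarrow> real^'n \<Rightarrow> real^'m \<Rightarrow> real^'n) \<Rightarrow>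
    (real^'m) set \<Rightarrow> real \<Rightarrow> (real \<times> (real^'n) \<Rightarrow> real) \<Rightarrow> (real \<Rightarrow> real^'n \<Rightarrow> real^'m) \<Rightarrow> bool" where
  "associated_controller c f U T J \<pi> \<longleftrightarrow>
    admissible_controller f U T \<pi> \<and> (\<forall>t\<in>{0..T}. \<forall>x. \<pi> t x \<in> U) \<and>
    (\<exists>pJ qJ.
      pJ \<in> borel_measurable (lebesgue_on ({0..T} \<times> UNIV)) \<and>
      qJ \<in> borel_measurable (lebesgue_on ({0..T} \<times> UNIV)) \<and>
      (\<forall>t\<in>{0<..<T}. \<forall>x.
        is_arg_min (\<lambda>(p, q, u). p + hamiltonian c f t x u q)
          (\<lambda>(p, q, u). (p, q) \<in> semidiff ({0..T} \<times> UNIV) J (t, x) \<and> u \<in> U)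
          (pJ (t, x), qJ (t, x), \<pi> t x)))"

definition candidate_value_function ::
  "(real \<Rightarrow> real^'n \<Rightarrow> real^'m \<Rightarrow> real) \<Rightarrow> (real \<Rightarrow> real^'n \<Rightarrow> real^'m \<Rightarrow> real^'n) \<Rightarrow>
    (real^'m) set \<Rightarrow> real \<Rightarrow> (real \<times> (real^'n) \<Rightarrow> real) \<Rightarrow> bool" where
  "candidate_value_function c f U T J \<longleftrightarrow>
    (\<exists>K. K-lipschitz_on ({0..T} \<times> UNIV) J) \<and>
    (\<forall>t\<in>{0<..<T}. \<forall>x.
      semidiff ({0..T} \<times> UNIV) J (t, x) = clarke_gradient ({0..T} \<times> UNIV) J (t, x)) \<and>
    (\<exists>\<pi>. associated_controller c f U T J \<pi>)"


section \<open>The Sobolev norm\<close>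

definition partial_deriv :: "'a \<Rightarrow> ('a::euclidean_space \<Rightarrow> real) \<Rightarrow> 'a \<Rightarrow> real" where
  "partial_deriv b \<phi> x = deriv (\<lambda>s. \<phi> (x + s *\<^sub>R b)) 0"

primrec times_cont_diff :: "nat \<Rightarrow> ('a::euclidean_space \<Rightarrow> real) \<Rightarrow> bool" where
  "times_cont_diff 0 \<phi> \<longleftrightarrow> continuous_on UNIV \<phi>"
| "times_cont_diff (Suc k) \<phi> \<longleftrightarrow> continuous_on UNIV \<phi> \<and>
    (\<forall>b\<in>Basis. (\<forall>x. (\<lambda>s. \<phi> (x + s *\<^sub>R b)) differentiable at 0) \<and>
      times_cont_diff k (partial_deriv b \<phi>))"

definition test_function :: "'a::euclidean_space set \<Rightarrow> ('a \<Rightarrow> real) \<Rightarrow> bool" where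
  "test_function \<Omega> \<phi> \<longleftrightarrow>
    (\<forall>k. times_cont_diff k \<phi>) \<and> (\<exists>K. compact K \<and> K \<subseteq> \<Omega> \<and> (\<forall>x. x \<notin> K \<longrightarrow> \<phi> x = 0))"

definition locally_integrable :: "'a::euclidean_space set \<Rightarrow> ('a \<Rightarrow> real) \<Rightarrow> bool" where
  "locally_integrable \<Omega> w \<longleftrightarrow> (\<forall>K. compact K \<longrightarrow> K \<subseteq> \<Omega> \<longrightarrow> integrable (lebesgue_on K) w)"

definition weak_partial_deriv ::
  "'a::euclidean_space set \<Rightarrow> 'a \<Rightarrow> ('a \<Rightarrow> real) \<Rightarrow> ('a \<Rightarrow> real) \<Rightarrow> bool" where
  "weak_partial_deriv \<Omega> b w v \<longleftrightarrow>
    locally_integrable \<Omega> w \<and> locally_integrable \<Omega> v \<and>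
    (\<forall>\<phi>. test_function \<Omega> \<phi> \<longrightarrow>
      (LINT x|lebesgue_on \<Omega>. w x * partial_deriv b \<phi> x) = - (LINT x|lebesgue_on \<Omega>. v x * \<phi> x))"

text \<open>Weak derivatives live on open sets, so \<^term>\<open>\<Omega>\<close> is replaced by its interior; for a cylinder
  over a ball only a null set is lost. A weak derivative is unique up to null sets: the infimum is
  the essential supremum of its absolute value if it exists, and infinite if it does not, so that
  the norm is infinite outside the Sobolev space.\<close>

definition W1inf_norm :: "'a::euclidean_space set \<Rightarrow> ('a \<Rightarrow> real) \<Rightarrow> ereal" where
  "W1inf_norm \<Omega> w =
    esssup (lebesgue_on (interior \<Omega>)) (\<lambda>x. ereal \<bar>w x\<bar>) +
    (\<Sum>b\<in>Basis. INF v\<in>{v. weak_partial_deriv (interior \<Omega>) b w v}.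
      esssup (lebesgue_on (interior \<Omega>)) (\<lambda>x. ereal \<bar>v x\<bar>))"

end

theory Submission
  imports Defs
begin

text \<open>
  Write \<open>V\<close> for the value function, \<open>E = J - V\<close> for the error of the candidate, and \<open>x\<close> for the
  closed-loop trajectory with input \<open>u t = \<pi>J t (x t)\<close>. Since \<open>V T = g\<close>, the optimality gap is the
  running cost along \<open>x\<close> plus \<open>V T (x T) - V 0 x0\<close>. Gronwall's inequality keeps \<open>x t\<close> inside the ball
  of radius \<open>R\<close>, so replacing \<open>V\<close> by \<open>J\<close> at the two end points costs at most twice the supremum of
  \<open>\<bar>E\<bar>\<close> (\<open>error_at_endpoints\<close>). What remains is \<open>J (T, x T) - J (0, x0)\<close> plus the running cost, that is,
  the integrated rate of change of \<open>J\<close> along \<open>x\<close> plus the running cost rate.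

  At almost every time \<open>t\<close> this rate is controlled by any element \<open>(p, q)\<close> of the superdifferential
  or the subdifferential of \<open>J\<close>: \<open>J (t, x t)\<close> grows at most at rate \<open>p + q \<bullet> f\<close>, over short intervals to
  the right of \<open>t\<close> in the first case and to the left in the second. A Vitali covering by such intervals
  is enough to integrate the inequality (\<open>abs_cont_on_Dini_decreasing\<close>, \<open>cost_gap_bound\<close>). For the
  element and the input selected by the controller, the rate plus the running cost is the minimum
  \<open>\<mu>\<close> of \<open>p + H\<close> over the differential and \<open>U\<close>. It remains to see that \<open>\<mu>\<close> is at most
  \<open>m = max 1 (\<beta>f * (1 + R))\<close> times the sum of the suprema of the weak partial derivatives of \<open>E\<close>.

  The trajectory is a null set, on which a bound that holds almost everywhere for the derivatives of
  \<open>E\<close> says nothing directly. But \<open>E\<close> is continuous, so mollification turns the bound into a Lipschitz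
  estimate near every point of the open cylinder (\<open>weak_partial_deriv_le_imp_Lipschitz\<close>,
  \<open>local_Lipschitz\<close>). Now start an almost optimal trajectory \<open>y\<close> at \<open>(t, x t)\<close>. By
  dynamic programming \<open>V\<close> decreases along \<open>y\<close> at least by the running cost, up to a small error;
  hence \<open>J\<close> decreases at least by the running cost minus \<open>m * h\<close> during a time \<open>h\<close>. As \<open>h\<close>
  tends to zero, the mean velocity and the mean running cost along \<open>y\<close> accumulate at some \<open>w\<close> and \<open>C\<close>,
  and a support argument provides an element \<open>(p, q)\<close> of the Clarke gradient, up to an arbitrarily
  small error, with \<open>p + q \<bullet> w + C \<le> m\<close>. By hypothesis the Clarke gradient is the set over which the
  controller minimises, and \<open>p + q \<bullet> w + C\<close> is a limit of time averages of \<open>p + H\<close>, each at least \<open>\<mu>\<close>. So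
  \<open>\<mu> \<le> m\<close> (\<open>hamiltonian_le_of_error_growth\<close>).

  Continuity of \<open>V\<close> comes from comparing trajectories with the same input and different initial data
  (\<open>value_le_value\<close>); this rests on the existence of trajectories for every measurable input
  (\<open>solution_exists\<close>) and on their integral form (\<open>abs_cont_FTC\<close>).
\<close>

section \<open>Absolutely continuous functions\<close>

lemma abs_cont_onE:
  fixes x :: "real \<Rightarrow> 'a::real_normed_vector"
  assumes x: "abs_cont_on a b x" and e: "e > 0"
  obtains d where "d > 0" "\<And>(N::nat) l r. (\<And>i. i < N \<Longrightarrow> a \<le> l i \<and> l i \<le> r i \<and> r i \<le> b) \<Longrightarrow>
      (\<And>i j. i < N \<Longrightarrow> j < N \<Longrightarrow> i \<noteq> j \<Longrightarrow> {l i<..<r i} \<inter> {l j<..<r j} = {}) \<Longrightarrow>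
      (\<Sum>i<N. r i - l i) < d \<Longrightarrow> (\<Sum>i<N. norm (x (r i) - x (l i))) < e"
proof -
  from x[unfolded abs_cont_on_def, THEN spec, THEN mp, OF e]
  obtain d where d: "d > 0" and ac: "\<forall>(N::nat) l r.
      (\<forall>i<N. a \<le> l i \<and> l i \<le> r i \<and> r i \<le> b) \<longrightarrow>
      (\<forall>i<N. \<forall>j<N. i \<noteq> j \<longrightarrow> {l i<..<r i} \<inter> {l j<..<r j} = {}) \<longrightarrow>
      (\<Sum>i<N. r i - l i) < d \<longrightarrow> (\<Sum>i<N. norm (x (r i) - x (l i))) < e"
    by (elim exE conjE)
  show thesis
  proof (rule that[OF d])
    fix N :: nat and l r :: "nat \<Rightarrow> real"
    assume 1: "\<And>i. i < N \<Longrightarrow> a \<le> l i \<and> l i \<le> r i \<and> r i \<le> b"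
      and 2: "\<And>i j. i < N \<Longrightarrow> j < N \<Longrightarrow> i \<noteq> j \<Longrightarrow> {l i<..<r i} \<inter> {l j<..<r j} = {}"
      and 3: "(\<Sum>i<N. r i - l i) < d"
    from 1 have 1: "\<forall>i<N. a \<le> l i \<and> l i \<le> r i \<and> r i \<le> b" by simp
    from 2 have 2: "\<forall>i<N. \<forall>j<N. i \<noteq> j \<longrightarrow> {l i<..<r i} \<inter> {l j<..<r j} = {}" by simp
    show "(\<Sum>i<N. norm (x (r i) - x (l i))) < e"
      by (rule ac[THEN spec, THEN spec, THEN spec, THEN mp, THEN mp, THEN mp, OF 1 2 3])
  qed
qed

text \<open>Absolute continuity passes from \<open>x\<close> to any function whose increments are bounded by those of \<open>x\<close>
  and of time. It covers Lipschitz functions, components of \<open>x\<close>, and \<open>J (t, x t)\<close> for Lipschitz \<open>J\<close>.\<close>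

lemma abs_cont_on_dominated:
  fixes x :: "real \<Rightarrow> 'a::real_normed_vector" and y :: "real \<Rightarrow> 'b::real_normed_vector"
  assumes x: "abs_cont_on a b x"
    and le: "\<And>s t. a \<le> s \<Longrightarrow> s \<le> t \<Longrightarrow> t \<le> b \<Longrightarrow> norm (y t - y s) \<le> K * norm (x t - x s) + L * (t - s)"
  shows "abs_cont_on a b y"
  unfolding abs_cont_on_def
proof (intro allI impI)
  fix e :: real assume e: "e > 0"
  define K' where "K' = \<bar>K\<bar> + 1"
  define L' where "L' = \<bar>L\<bar> + 1"
  have K': "K' > 0" "K \<le> K'" and L': "L' > 0" "L \<le> L'" unfolding K'_def L'_def by auto
  have "e / (2 * K') > 0" using e K' by simp
  then obtain d where d: "d > 0" and ac: "\<And>N l r. (\<And>i. i < N \<Longrightarrow> a \<le> l i \<and> l i \<le> r i \<and> r i \<le> b) \<Longrightarrow>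
      (\<And>i j. i < N \<Longrightarrow> j < N \<Longrightarrow> i \<noteq> j \<Longrightarrow> {l i<..<r i} \<inter> {l j<..<r j} = {}) \<Longrightarrow>
      (\<Sum>i<(N::nat). r i - l i) < d \<Longrightarrow> (\<Sum>i<N. norm (x (r i) - x (l i))) < e / (2 * K')"
    by (rule abs_cont_onE[OF x, of "e / (2 * K')"]) blast
  show "\<exists>\<delta>>0. \<forall>(N::nat) l r.
      (\<forall>i<N. a \<le> l i \<and> l i \<le> r i \<and> r i \<le> b) \<longrightarrow>
      (\<forall>i<N. \<forall>j<N. i \<noteq> j \<longrightarrow> {l i<..<r i} \<inter> {l j<..<r j} = {}) \<longrightarrow>
      (\<Sum>i<N. r i - l i) < \<delta> \<longrightarrow> (\<Sum>i<N. norm (y (r i) - y (l i))) < e"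
  proof (intro exI[of _ "min d (e / (2 * L'))"] conjI allI impI)
    show "0 < min d (e / (2 * L'))" using d e L' by simp
    fix N :: nat and l r :: "nat \<Rightarrow> real"
    assume 1: "\<forall>i<N. a \<le> l i \<and> l i \<le> r i \<and> r i \<le> b"
      and 2: "\<forall>i<N. \<forall>j<N. i \<noteq> j \<longrightarrow> {l i<..<r i} \<inter> {l j<..<r j} = {}"
      and 3: "(\<Sum>i<N. r i - l i) < min d (e / (2 * L'))"
    have "(\<Sum>i<N. norm (y (r i) - y (l i))) \<le> (\<Sum>i<N. K' * norm (x (r i) - x (l i)) + L' * (r i - l i))"
    proof (rule sum_mono)
      fix i assume "i \<in> {..<N}"
      then have i: "a \<le> l i" "l i \<le> r i" "r i \<le> b" using 1 by auto
      show "norm (y (r i) - y (l i)) \<le> K' * norm (x (r i) - x (l i)) + L' * (r i - l i)"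
        using le[OF i] mult_right_mono[OF K'(2), of "norm (x (r i) - x (l i))"]
          mult_right_mono[OF L'(2), of "r i - l i"] i by simp
    qed
    also have "\<dots> = K' * (\<Sum>i<N. norm (x (r i) - x (l i))) + L' * (\<Sum>i<N. r i - l i)"
      by (simp add: sum.distrib sum_distrib_left)
    also have "\<dots> < K' * (e / (2 * K')) + L' * (e / (2 * L'))"
      using ac[of N l r] 1 2 3 K' L' by (intro add_strict_mono mult_strict_left_mono) auto
    also have "\<dots> = e" using K' L' by (simp add: field_simps)
    finally show "(\<Sum>i<N. norm (y (r i) - y (l i))) < e" .
  qed
qed

lemma abs_cont_on_const: "abs_cont_on a b (\<lambda>t. k)"
  unfolding abs_cont_on_def by (auto intro!: exI[of _ 1])

lemma abs_cont_on_lipschitz: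
  fixes y :: "real \<Rightarrow> 'b::real_normed_vector"
  assumes "\<And>s t. a \<le> s \<Longrightarrow> s \<le> t \<Longrightarrow> t \<le> b \<Longrightarrow> norm (y t - y s) \<le> L * (t - s)"
  shows "abs_cont_on a b y"
  by (rule abs_cont_on_dominated[OF abs_cont_on_const[of a b "0::real"], where K=0 and L=L])
     (use assms in auto)

lemma abs_cont_on_imp_continuous_on:
  assumes x: "abs_cont_on a b x"
  shows "continuous_on {a..b} x"
  unfolding continuous_on_iff
proof (intro ballI allI impI)
  fix t e :: real assume t: "t \<in> {a..b}" and e: "e > 0"
  obtain d where d: "d > 0" and ac: "\<And>N l r. (\<And>i. i < N \<Longrightarrow> a \<le> l i \<and> l i \<le> r i \<and> r i \<le> b) \<Longrightarrow>
      (\<And>i j. i < N \<Longrightarrow> j < N \<Longrightarrow> i \<noteq> j \<Longrightarrow> {l i<..<r i} \<inter> {l j<..<r j} = {}) \<Longrightarrow>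
      (\<Sum>i<(N::nat). r i - l i) < d \<Longrightarrow> (\<Sum>i<N. norm (x (r i) - x (l i))) < e"
    by (rule abs_cont_onE[OF x e]) blast
  show "\<exists>d>0. \<forall>s\<in>{a..b}. dist s t < d \<longrightarrow> dist (x s) (x t) < e"
  proof (intro exI[of _ d] conjI ballI impI)
    fix s assume s: "s \<in> {a..b}" "dist s t < d"
    have "norm (x (max s t) - x (min s t)) < e"
      using s t ac[of 1 "\<lambda>_. min s t" "\<lambda>_. max s t"] by (auto simp: dist_real_def)
    then show "dist (x s) (x t) < e"
      by (cases "s \<le> t") (auto simp: dist_norm norm_minus_commute max_def min_def)
  qed (fact d)
qed

lemma abs_cont_on_subinterval:
  assumes "abs_cont_on a b x" "a \<le> a'" "b' \<le> b"
  shows "abs_cont_on a' b' x"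
  unfolding abs_cont_on_def
proof (intro allI impI)
  fix e :: real assume e: "e > 0"
  obtain d where d: "d > 0" and ac: "\<And>N l r. (\<And>i. i < N \<Longrightarrow> a \<le> l i \<and> l i \<le> r i \<and> r i \<le> b) \<Longrightarrow>
      (\<And>i j. i < N \<Longrightarrow> j < N \<Longrightarrow> i \<noteq> j \<Longrightarrow> {l i<..<r i} \<inter> {l j<..<r j} = {}) \<Longrightarrow>
      (\<Sum>i<(N::nat). r i - l i) < d \<Longrightarrow> (\<Sum>i<N. norm (x (r i) - x (l i))) < e"
    by (rule abs_cont_onE[OF assms(1) e]) blast
  show "\<exists>\<delta>>0. \<forall>(N::nat) l r.
      (\<forall>i<N. a' \<le> l i \<and> l i \<le> r i \<and> r i \<le> b') \<longrightarrow>
      (\<forall>i<N. \<forall>j<N. i \<noteq> j \<longrightarrow> {l i<..<r i} \<inter> {l j<..<r j} = {}) \<longrightarrow>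
      (\<Sum>i<N. r i - l i) < \<delta> \<longrightarrow> (\<Sum>i<N. norm (x (r i) - x (l i))) < e"
    using assms(2,3) by (intro exI[of _ d] conjI allI impI d ac) (auto intro: order_trans)
qed

section \<open>Differentiation almost everywhere on an interval\<close>

text \<open>Every interval is a closed ball about its midpoint, so the Vitali covering theorem for balls applies;
  the intervals need not be centred at the covered points. This matters below, where they extend to
  one side only. Each interval is stored together with the point that it was chosen for.\<close>

lemma Vitali_covering_intervals:
  fixes S :: "real set"
  assumes fine: "\<And>t d. t \<in> S \<Longrightarrow> 0 < d \<Longrightarrow> \<exists>l r. l < r \<and> t \<in> {l..r} \<and> r - l < d \<and> P t l r"
  obtains C where "countable C" "\<And>t l r. (t, l, r) \<in> C \<Longrightarrow> l < r \<and> t \<in> {l..r} \<and> P t l r"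
    "pairwise (\<lambda>(t, l, r) (t', l', r'). disjnt {l..r} {l'..r'}) C"
    "negligible (S - (\<Union>(t, l, r)\<in>C. {l..r}))"
proof -
  define K where "K = {(t, l, r). l < r \<and> t \<in> {l..r} \<and> P t l r}"
  define mid where "mid = (\<lambda>(t::real, l::real, r::real). (l + r) / 2)"
  define rad where "rad = (\<lambda>(t::real, l::real, r::real). (r - l) / 2)"
  have cb: "cball (mid i) (rad i) = (case i of (t, l, r) \<Rightarrow> {l..r})" for i
    by (cases i) (auto simp: mid_def rad_def cball_eq_atLeastAtMost field_simps)
  have 1: "0 < rad i" if "i \<in> K" for i using that by (auto simp: K_def rad_def)
  have 2: "\<exists>i. i \<in> K \<and> t \<in> cball (mid i) (rad i) \<and> rad i < d" if td: "t \<in> S" "0 < d" for t d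
  proof -
    obtain l r where "l < r" "t \<in> {l..r}" "r - l < d" "P t l r" using fine[OF td] by blast
    then show ?thesis by (intro exI[of _ "(t, l, r)"]) (use cb[of "(t, l, r)"] in \<open>auto simp: K_def rad_def\<close>)
  qed
  obtain C where C: "countable C" "C \<subseteq> K"
    "pairwise (\<lambda>i j. disjnt (cball (mid i) (rad i)) (cball (mid j) (rad j))) C"
    "negligible (S - (\<Union>i\<in>C. cball (mid i) (rad i)))"
    by (rule Vitali_covering_theorem_cballs[of K rad S mid, OF 1 2]) blast+
  show thesis
  proof (rule that[of C])
    show "l < r \<and> t \<in> {l..r} \<and> P t l r" if "(t, l, r) \<in> C" for t l r
      using that C(2) by (auto simp: K_def)
    show "pairwise (\<lambda>(t, l, r) (t', l', r'). disjnt {l..r} {l'..r'}) C"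
      using C(3) unfolding cb by (auto simp: pairwise_def)
    show "negligible (S - (\<Union>(t, l, r)\<in>C. {l..r}))"
      using C(4) unfolding cb .
  qed (fact C(1))
qed

lemma sum_over_division:
  fixes f :: "real \<Rightarrow> real"
  assumes "a \<le> b" and q: "q division_of {a..b}"
  shows "(\<Sum>K\<in>q. f (Sup K) - f (Inf K)) = f b - f a"
proof -
  have K: "\<exists>c d. K = {c..d} \<and> c \<le> d \<and> {c..d} \<subseteq> {a..b}" if "K \<in> q" for K
    using division_ofD(2,3,4)[OF q that] by fastforce
  let ?p = "(\<lambda>K. (Inf K, K)) ` q"
  have "?p tagged_division_of {a..b}"
    unfolding tagged_division_of_def tagged_partial_division_of_def
  proof (intro conjI allI impI)
    show "finite ?p" using q by auto
    fix x K assume xK: "(x, K) \<in> ?p"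
    then obtain c d where "K = {c..d}" "c \<le> d" "{c..d} \<subseteq> {a..b}" using K by blast
    then show "x \<in> K" "K \<subseteq> {a..b}" "\<exists>a b. K = cbox a b" using xK by auto
  next
    fix x1 K1 x2 K2 assume "(x1, K1) \<in> ?p \<and> (x2, K2) \<in> ?p \<and> (x1, K1) \<noteq> (x2, K2)"
    then show "interior K1 \<inter> interior K2 = {}" using division_ofD(5)[OF q] by auto
  next
    have "{K. \<exists>x. (x, K) \<in> ?p} = q" by auto
    then show "\<Union> {K. \<exists>x. (x, K) \<in> ?p} = {a..b}" using division_ofD(6)[OF q] by simp
  qed
  from additive_tagged_division_1[OF assms(1) this, of f]
  show ?thesis by (subst (asm) sum.reindex) (auto simp: inj_on_def)
qed

text \<open>A function decreases if, near almost every point, it increases arbitrarily slowly on some arbitrarily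
  short interval around that point; the side may vary with the point. Vitali's theorem yields finitely
  many such intervals that are disjoint and cover all but a small part of \<open>{a..b}\<close>. The total increase
  on them is small because the slopes are, and the increase on the gaps is small by absolute
  continuity.\<close>

lemma abs_cont_on_Dini_decreasing:
  fixes \<Psi> :: "real \<Rightarrow> real"
  assumes "a \<le> b" and ac: "abs_cont_on a b \<Psi>"
    and ae: "negligible ({a..b} - S)"
    and slope: "\<And>t e d. t \<in> S \<Longrightarrow> 0 < e \<Longrightarrow> 0 < d \<Longrightarrow>
      \<exists>l r. l < r \<and> t \<in> {l..r} \<and> {l..r} \<subseteq> {a..b} \<and> r - l < d \<and> \<Psi> r - \<Psi> l \<le> e * (r - l)"
  shows "\<Psi> b \<le> \<Psi> a"
proof (cases "a = b")
  case False
  with \<open>a \<le> b\<close> have ab: "a < b" by simp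
  show ?thesis
  proof (rule field_le_epsilon)
    fix \<epsilon> :: real assume "0 < \<epsilon>"
    define e where "e = \<epsilon> / (1 + (b - a))"
    have e: "e > 0" using \<open>0 < \<epsilon>\<close> ab by (simp add: e_def)
    obtain d where d: "d > 0" and acd: "\<And>N l r. (\<And>i. i < N \<Longrightarrow> a \<le> l i \<and> l i \<le> r i \<and> r i \<le> b) \<Longrightarrow>
      (\<And>i j. i < N \<Longrightarrow> j < N \<Longrightarrow> i \<noteq> j \<Longrightarrow> {l i<..<r i} \<inter> {l j<..<r j} = {}) \<Longrightarrow>
      (\<Sum>i<(N::nat). r i - l i) < d \<Longrightarrow> (\<Sum>i<N. norm (\<Psi> (r i) - \<Psi> (l i))) < e"
      proof (rule abs_cont_onE[OF ac e])
      fix d :: real assume 1: "0 < d" and 2: "\<And>N l r. (\<And>i. i < N \<Longrightarrow> a \<le> l i \<and> l i \<le> r i \<and> r i \<le> b) \<Longrightarrow>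
      (\<And>i j. i < N \<Longrightarrow> j < N \<Longrightarrow> i \<noteq> j \<Longrightarrow> {l i<..<r i} \<inter> {l j<..<r j} = {}) \<Longrightarrow>
      (\<Sum>i<(N::nat). r i - l i) < d \<Longrightarrow> (\<Sum>i<N. norm (\<Psi> (r i) - \<Psi> (l i))) < e"
      show thesis by (rule that[OF 1 2])
    qed
    obtain C where C: "countable C"
      and CP: "\<And>t l r. (t, l, r) \<in> C \<Longrightarrow> l < r \<and> t \<in> {l..r} \<and> {l..r} \<subseteq> {a..b} \<and> \<Psi> r - \<Psi> l \<le> e * (r - l)"
      and disj: "pairwise (\<lambda>(t, l, r) (t', l', r'). disjnt {l..r} {l'..r'}) C"
      and neg: "negligible (S - (\<Union>(t, l, r)\<in>C. {l..r}))"
    proof (rule Vitali_covering_intervals[of S "\<lambda>t l r. {l..r} \<subseteq> {a..b} \<and> \<Psi> r - \<Psi> l \<le> e * (r - l)"])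
      fix t d :: real assume t: "t \<in> S" and d: "0 < d"
      obtain l r where "l < r" "t \<in> {l..r}" "{l..r} \<subseteq> {a..b}" "r - l < d" "\<Psi> r - \<Psi> l \<le> e * (r - l)"
        using slope[OF t e d] by (elim exE conjE)
      then show "\<exists>l r. l < r \<and> t \<in> {l..r} \<and> r - l < d \<and> {l..r} \<subseteq> {a..b} \<and> \<Psi> r - \<Psi> l \<le> e * (r - l)"
        by (intro exI conjI)
    qed (rule that)
    define I where "I = (\<lambda>(t::real, l::real, r::real). {l..r})"
    have Im: "I i \<in> lmeasurable" for i by (cases i) (simp add: I_def)
    \<comment> \<open>Otherwise the whole countable family would have measure at most \<open>b - a - d\<close>, although it covers almost all of \<open>{a..b}\<close>.\<close>
    have "\<exists>F\<subseteq>C. finite F \<and> b - a - d < measure lebesgue (\<Union>i\<in>F. I i)"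
    proof (rule ccontr)
      assume "\<not> ?thesis"
      then have le: "measure lebesgue (\<Union>i\<in>F. I i) \<le> b - a - d" if "F \<subseteq> C" "finite F" for F
        using that by (meson not_less)
      have m: "(\<Union>i\<in>C. I i) \<in> lmeasurable" "measure lebesgue (\<Union>i\<in>C. I i) \<le> b - a - d"
        using fmeasurable_UN_bound[OF C Im le] measure_UN_bound[OF C Im le] by blast+
      have "negligible ({a..b} - (\<Union>i\<in>C. I i))"
        by (rule negligible_subset[OF negligible_Un[OF ae neg]]) (auto simp: I_def)
      then have "measure lebesgue ((\<Union>i\<in>C. I i) \<union> ({a..b} - (\<Union>i\<in>C. I i))) = measure lebesgue (\<Union>i\<in>C. I i)"
        by (intro measure_Un_null_set) (use m(1) in \<open>auto simp: negligible_iff_null_sets\<close>)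
      moreover have "(\<Union>i\<in>C. I i) \<union> ({a..b} - (\<Union>i\<in>C. I i)) = {a..b}"
        using CP by (fastforce simp: I_def)
      ultimately show False using m(2) ab d by simp
    qed
    then obtain F where F: "F \<subseteq> C" "finite F" and Fm: "b - a - d < measure lebesgue (\<Union>i\<in>F. I i)" by blast
    define p where "p = I ` F"
    have fp: "finite p" using F by (simp add: p_def)
    have pK: "\<exists>l r. K = {l..r} \<and> l < r \<and> {l..r} \<subseteq> {a..b} \<and> \<Psi> r - \<Psi> l \<le> e * (r - l)" if "K \<in> p" for K
      using that F CP by (force simp: p_def I_def)
    have pd: "K \<inter> L = {}" if KL: "K \<in> p" "L \<in> p" "K \<noteq> L" for K L
    proof -
      obtain i where i: "i \<in> F" "K = I i" using KL(1) unfolding p_def by blast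
      obtain j where j: "j \<in> F" "L = I j" using KL(2) unfolding p_def by blast
      have ij: "i \<in> C" "j \<in> C" "K = I i" "L = I j" using i j F by blast+
      then have "i \<noteq> j" using KL by auto
      from pairwiseD[OF disj ij(1,2) this] show ?thesis
        by (cases i; cases j) (auto simp: ij I_def disjnt_def)
    qed
    have pdiv: "p division_of \<Union>p"
      unfolding division_of_def
    proof (intro conjI ballI impI)
      fix K assume K: "K \<in> p"
      obtain l r where lr: "K = {l..r}" "l < r" using pK[OF K] by blast
      show "K \<subseteq> \<Union>p" using K by blast
      show "K \<noteq> {}" using lr by simp
      show "\<exists>a b. K = cbox a b" using lr by (metis box_real(2))
      fix L assume L: "L \<in> p" "K \<noteq> L"
      show "interior K \<inter> interior L = {}"
        using pd[OF K L] interior_subset[of K] interior_subset[of L] by blast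
    qed (use fp in simp_all)
    have "\<Union>p \<subseteq> cbox a b"
    proof (rule Union_least)
      fix K assume "K \<in> p"
      from pK[OF this] show "K \<subseteq> cbox a b" by auto
    qed
    then obtain q where q: "p \<subseteq> q" "q division_of cbox a b"
      by (rule partial_division_extend_interval[OF pdiv])
    then have q': "q division_of {a..b}" by simp
    have fq: "finite q" using q' by (rule division_ofD(1))
    have qK: "\<exists>l r. K = {l..r} \<and> l \<le> r \<and> {l..r} \<subseteq> {a..b}" if Kq: "K \<in> q" for K
    proof -
      obtain l r where "K = cbox l r" using division_ofD(4)[OF q' Kq] by blast
      then show ?thesis using division_ofD(2,3)[OF q' Kq] by (intro exI[of _ l] exI[of _ r]) auto
    qed
    let ?len = "\<lambda>K. Sup K - Inf K :: real"
    let ?inc = "\<lambda>K. \<Psi> (Sup K) - \<Psi> (Inf K)"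
    have len: "(\<Sum>K\<in>p. ?len K) + (\<Sum>K\<in>q - p. ?len K) = b - a"
      using sum_over_division[OF \<open>a \<le> b\<close> q', of "\<lambda>t. t"] sum.subset_diff[OF q(1) fq, of ?len] by simp
    have inc: "(\<Sum>K\<in>p. ?inc K) + (\<Sum>K\<in>q - p. ?inc K) = \<Psi> b - \<Psi> a"
      using sum_over_division[OF \<open>a \<le> b\<close> q', of \<Psi>] sum.subset_diff[OF q(1) fq, of ?inc] by simp
    have "measure lebesgue (\<Union>i\<in>F. I i) = measure lebesgue (\<Union>p)" by (simp add: p_def)
    also have "\<dots> \<le> (\<Sum>K\<in>p. measure lebesgue K)"
      proof -
      have "K \<in> sets lebesgue" if "K \<in> p" for K using pK[OF that] by auto
      then show ?thesis using measure_UNION_le[of p "\<lambda>K. K" lebesgue] fp by simp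
    qed
    also have "\<dots> = (\<Sum>K\<in>p. ?len K)"
    proof (rule sum.cong)
      fix K assume "K \<in> p"
      from pK[OF this] show "measure lebesgue K = ?len K" by auto
    qed simp
    finally have plen: "(\<Sum>K\<in>q - p. ?len K) < d" using Fm len by linarith
    have "(\<Sum>K\<in>p. ?inc K) \<le> (\<Sum>K\<in>p. e * ?len K)"
    proof (rule sum_mono)
      fix K assume "K \<in> p"
      from pK[OF this] show "?inc K \<le> e * ?len K" by auto
    qed
    also have "\<dots> = e * (\<Sum>K\<in>p. ?len K)" by (simp add: sum_distrib_left)
    also have "\<dots> \<le> e * (b - a)"
    proof -
      have "0 \<le> (\<Sum>K\<in>q - p. ?len K)"
      proof (rule sum_nonneg)
        fix K assume "K \<in> q - p"
        then have "K \<in> q" by simp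
        from qK[OF this] show "0 \<le> ?len K" by auto
      qed
      then show ?thesis using len e by (intro mult_left_mono) auto
    qed
    finally have 1: "(\<Sum>K\<in>p. ?inc K) \<le> e * (b - a)" .
    obtain h where h: "bij_betw h {..<card (q - p)} (q - p)"
      using ex_bij_betw_nat_finite[of "q - p"] fq by (auto simp: atLeast0LessThan)
    have hq: "h i \<in> q" if "i < card (q - p)" for i
      using bij_betw_apply[OF h, of i] that by auto
    have "(\<Sum>i<card (q - p). norm (\<Psi> (Sup (h i)) - \<Psi> (Inf (h i)))) < e"
    proof (rule acd)
      fix i assume i: "i < card (q - p)"
      from qK[OF hq[OF i]] show "a \<le> Inf (h i) \<and> Inf (h i) \<le> Sup (h i) \<and> Sup (h i) \<le> b"
        by auto
      fix j assume j: "j < card (q - p)" and "i \<noteq> j"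
      then have "h i \<noteq> h j" using h i by (auto simp: bij_betw_def inj_on_def)
      then have "interior (h i) \<inter> interior (h j) = {}"
        using division_ofD(5)[OF q' hq[OF i] hq[OF j]] by blast
      then show "{Inf (h i)<..<Sup (h i)} \<inter> {Inf (h j)<..<Sup (h j)} = {}"
        using qK[OF hq[OF i]] qK[OF hq[OF j]] by auto
    next
      show "(\<Sum>i<card (q - p). Sup (h i) - Inf (h i)) < d"
        using sum.reindex_bij_betw[OF h, of ?len] plen by simp
    qed
    then have "(\<Sum>K\<in>q - p. norm (?inc K)) < e"
      using sum.reindex_bij_betw[OF h, of "\<lambda>K. norm (?inc K)"] by simp
    moreover have "(\<Sum>K\<in>q - p. ?inc K) \<le> (\<Sum>K\<in>q - p. norm (?inc K))"
      by (intro sum_mono) simp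
    ultimately have "(\<Sum>K\<in>q - p. ?inc K) \<le> e" by linarith
    with 1 inc have "\<Psi> b - \<Psi> a \<le> e * (b - a) + e" by linarith
    also have "\<dots> = e * (1 + (b - a))" by (simp add: algebra_simps)
    also have "\<dots> = \<epsilon>" using ab by (simp add: e_def)
    finally show "\<Psi> b \<le> \<Psi> a + \<epsilon>" by simp
  qed
qed simp

text \<open>Let the bad points be those around which the means of \<open>f\<close> over short intervals differ from
  the value of \<open>f\<close> by more than \<open>e\<close>. Vitali's theorem covers almost all of them by disjoint bad
  intervals that are fine for a given gauge. By the Henstock lemma the Riemann sum of \<open>f\<close> over these
  deviates little from the integral; each interval contributes at least \<open>e\<close> times its length to that
  deviation, so their total length is small.\<close>

lemma Lebesgue_differentiation_interval:
  fixes f :: "real \<Rightarrow> 'a::euclidean_space"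
  assumes f: "f integrable_on {a..b}"
  obtains N where "negligible N"
    "\<And>t. t \<in> {a..b} - N \<Longrightarrow> ((\<lambda>t. integral {a..t} f) has_vector_derivative f t) (at t within {a..b})"
proof -
  define bad where "bad e t l r \<longleftrightarrow> {l..r} \<subseteq> {a..b} \<and> e * (r - l) < norm ((r - l) *\<^sub>R f t - integral {l..r} f)"
    for e t l r
  define B where "B e = {t\<in>{a..b}. \<forall>d>0. \<exists>l r. l < r \<and> t \<in> {l..r} \<and> r - l < d \<and> bad e t l r}" for e
  have B: "negligible (B e)" if e: "e > 0" for e
    unfolding negligible_outer_le
  proof (intro allI impI)
    fix \<eta> :: real assume \<eta>: "\<eta> > 0"
    have "e * \<eta> > 0" using e \<eta> by simp
    then obtain \<gamma> where \<gamma>: "gauge \<gamma>" and H: "\<And>p. \<lbrakk>p tagged_partial_division_of (cbox a b); \<gamma> fine p\<rbrakk> \<Longrightarrow>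
             (\<Sum>(x,k)\<in>p. norm(measure lborel k *\<^sub>R f x - integral k f)) < e * \<eta>"
      using Henstock_lemma[of f a b "e * \<eta>"] f by auto
    obtain C where C: "countable C"
      and CP: "\<And>t l r. (t, l, r) \<in> C \<Longrightarrow> l < r \<and> t \<in> {l..r} \<and> {l..r} \<subseteq> \<gamma> t \<and> bad e t l r"
      and disj: "pairwise (\<lambda>(t, l, r) (t', l', r'). disjnt {l..r} {l'..r'}) C"
      and neg: "negligible (B e - (\<Union>(t, l, r)\<in>C. {l..r}))"
    proof (rule Vitali_covering_intervals[of "B e" "\<lambda>t l r. {l..r} \<subseteq> \<gamma> t \<and> bad e t l r"])
      fix t d :: real assume t: "t \<in> B e" and d: "0 < d"
      have "open (\<gamma> t)" "t \<in> \<gamma> t" using \<gamma> by (auto simp: gauge_def)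
      then obtain d' where d': "d' > 0" "ball t d' \<subseteq> \<gamma> t" by (meson open_contains_ball)
      obtain l r where lr: "l < r" "t \<in> {l..r}" "r - l < min d d'" "bad e t l r"
        proof -
        have "0 < min d d'" using d d' by simp
        then show thesis using t that unfolding B_def by blast
      qed
      then have "{l..r} \<subseteq> ball t d'" by (auto simp: dist_real_def)
      with lr d' show "\<exists>l r. l < r \<and> t \<in> {l..r} \<and> r - l < d \<and> {l..r} \<subseteq> \<gamma> t \<and> bad e t l r"
        by (intro exI[of _ l] exI[of _ r]) auto
    qed blast
    define I where "I = (\<lambda>(t::real, l::real, r::real). {l..r})"
    have Im: "I i \<in> lmeasurable" for i by (cases i) (simp add: I_def)
    have le: "measure lebesgue (\<Union>i\<in>F. I i) \<le> \<eta>" if F: "F \<subseteq> C" "finite F" for F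
    proof -
      define p where "p = (\<lambda>(t, l, r). (t, {l..r})) ` F"
      have inj: "inj_on (\<lambda>(t, l, r). (t, {l..r})) F"
        proof (rule inj_onI)
        fix i j assume "i \<in> F" "j \<in> F" and eq: "(case i of (t, l, r) \<Rightarrow> (t, {l..r})) = (case j of (t, l, r) \<Rightarrow> (t, {l..r}))"
        moreover obtain t l r where i: "i = (t, l, r)" by (cases i)
        moreover obtain t' l' r' where j: "j = (t', l', r')" by (cases j)
        ultimately show "i = j" using CP[of t l r] F(1) by (auto simp: Icc_eq_Icc)
      qed
      have "p tagged_partial_division_of cbox a b"
        unfolding tagged_partial_division_of_def
      proof (intro conjI allI impI)
        show "finite p" using F by (simp add: p_def)
        fix x K assume "(x, K) \<in> p"
        then obtain l r where "(x, l, r) \<in> C" "K = {l..r}" using F by (auto simp: p_def)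
        with CP[of x l r] show "x \<in> K" "K \<subseteq> cbox a b" "\<exists>a b. K = cbox a b"
          by (auto simp: bad_def)
      next
        fix x1 K1 x2 K2 assume *: "(x1, K1) \<in> p \<and> (x2, K2) \<in> p \<and> (x1, K1) \<noteq> (x2, K2)"
        obtain l1 r1 where **: "(x1, l1, r1) \<in> C" "K1 = {l1..r1}" using * F by (auto simp: p_def)
        obtain l2 r2 where ***: "(x2, l2, r2) \<in> C" "K2 = {l2..r2}" using * F by (auto simp: p_def)
        have "(x1, l1, r1) \<noteq> (x2, l2, r2)" using * ** *** by auto
        from pairwiseD[OF disj **(1) ***(1) this] have "K1 \<inter> K2 = {}" using ** *** by (simp add: disjnt_def)
        then show "interior K1 \<inter> interior K2 = {}" using interior_subset by fastforce
      qed
      moreover have "\<gamma> fine p"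
        unfolding fine_def
      proof safe
        fix x K y assume "(x, K) \<in> p" "y \<in> K"
        then obtain l r where "(x, l, r) \<in> C" "K = {l..r}" using F by (auto simp: p_def)
        with CP[of x l r] \<open>y \<in> K\<close> show "y \<in> \<gamma> x" by blast
      qed
      ultimately have "(\<Sum>(x,k)\<in>p. norm(measure lborel k *\<^sub>R f x - integral k f)) < e * \<eta>" by (rule H)
      note * = this
      have S: "(\<Sum>(t,l,r)\<in>F. norm((r - l) *\<^sub>R f t - integral {l..r} f)) < e * \<eta>"
        proof -
        have "(\<Sum>(x,k)\<in>p. norm(measure lborel k *\<^sub>R f x - integral k f)) = (\<Sum>(t,l,r)\<in>F. norm((r - l) *\<^sub>R f t - integral {l..r} f))"
          unfolding p_def
        proof (subst sum.reindex[OF inj], rule sum.cong)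
          fix i assume i: "i \<in> F"
          obtain t l r where [simp]: "i = (t, l, r)" by (cases i)
          show "((\<lambda>(x,k). norm(measure lborel k *\<^sub>R f x - integral k f)) \<circ> (\<lambda>(t, l, r). (t, {l..r}))) i =
            (case i of (t, l, r) \<Rightarrow> norm((r - l) *\<^sub>R f t - integral {l..r} f))"
            using CP[of t l r] F(1) i by auto
        qed simp
        then show ?thesis using * by simp
      qed
      have "e * measure lebesgue (\<Union>i\<in>F. I i) \<le> e * (\<Sum>i\<in>F. measure lebesgue (I i))"
        using measure_UNION_le[OF F(2), of I lebesgue] Im e by (intro mult_left_mono) auto
      also have "\<dots> = (\<Sum>i\<in>F. e * measure lebesgue (I i))" by (simp add: sum_distrib_left)
      also have "\<dots> \<le> (\<Sum>(t,l,r)\<in>F. norm((r - l) *\<^sub>R f t - integral {l..r} f))"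
      proof (rule sum_mono)
        fix i assume "i \<in> F"
        moreover obtain t l r where "i = (t, l, r)" by (cases i)
        ultimately show "e * measure lebesgue (I i) \<le>
            (case i of (t, l, r) \<Rightarrow> norm((r - l) *\<^sub>R f t - integral {l..r} f))"
          using F CP[of t l r] by (auto simp: I_def bad_def)
      qed
      finally have "e * measure lebesgue (\<Union>i\<in>F. I i) < e * \<eta>" using S by linarith
      then show ?thesis using e by simp
    qed
    have m: "(\<Union>i\<in>C. I i) \<in> lmeasurable" "measure lebesgue (\<Union>i\<in>C. I i) \<le> \<eta>"
      using fmeasurable_UN_bound[OF C Im le] measure_UN_bound[OF C Im le] by blast+
    let ?R = "B e - (\<Union>i\<in>C. I i)"
    have "?R = B e - (\<Union>(t, l, r)\<in>C. {l..r})" by (simp add: I_def)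
    then have neg: "negligible ?R" using neg by simp
    show "\<exists>T. B e \<subseteq> T \<and> T \<in> lmeasurable \<and> measure lebesgue T \<le> \<eta>"
    proof (intro exI[of _ "(\<Union>i\<in>C. I i) \<union> ?R"] conjI)
      show "(\<Union>i\<in>C. I i) \<union> ?R \<in> lmeasurable"
        using m neg negligible_imp_measurable by blast
      have "measure lebesgue ((\<Union>i\<in>C. I i) \<union> ?R) = measure lebesgue (\<Union>i\<in>C. I i)"
        using m neg by (intro measure_Un_null_set) (auto simp: negligible_iff_null_sets)
      then show "measure lebesgue ((\<Union>i\<in>C. I i) \<union> ?R) \<le> \<eta>" using m by simp
    qed auto
  qed
  define N where "N = (\<Union>n. B (1 / real (Suc n)))"
  have "negligible N" unfolding N_def by (intro negligible_countable_Union) (auto intro!: B)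
  moreover have "((\<lambda>t. integral {a..t} f) has_vector_derivative f t) (at t within {a..b})"
    if t: "t \<in> {a..b} - N" for t
    unfolding has_vector_derivative_def has_derivative_within_alt
  proof (intro conjI allI impI)
    show "bounded_linear (\<lambda>h. h *\<^sub>R f t)" by (rule bounded_linear_scaleR_left)
    fix e :: real assume "0 < e"
    then obtain n where n: "1 / real (Suc n) < e" using nat_approx_posE by blast
    have "t \<notin> B (1 / real (Suc n))" using t by (auto simp: N_def)
    then obtain d where d: "d > 0"
      and good: "\<And>l r. l < r \<Longrightarrow> t \<in> {l..r} \<Longrightarrow> r - l < d \<Longrightarrow> \<not> bad (1 / real (Suc n)) t l r"
      using t unfolding B_def by blast
    have est: "norm ((r - l) *\<^sub>R f t - integral {l..r} f) \<le> e * (r - l)"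
      if "l \<le> r" "t \<in> {l..r}" "r - l < d" "{l..r} \<subseteq> {a..b}" for l r
    proof (cases "l = r")
      case False
      then have "norm ((r - l) *\<^sub>R f t - integral {l..r} f) \<le> 1 / real (Suc n) * (r - l)"
        using good[of l r] that by (auto simp: bad_def)
      also have "\<dots> \<le> e * (r - l)" using n that by (intro mult_right_mono) auto
      finally show ?thesis .
    qed (use that in auto)
    have comb: "integral {a..l} f + integral {l..r} f = integral {a..r} f" if "a \<le> l" "l \<le> r" "r \<le> b" for l r
      using that integrable_subinterval_real[OF f] by (intro Henstock_Kurzweil_Integration.integral_combine) auto
    show "\<exists>d>0. \<forall>y\<in>{a..b}. norm (y - t) < d \<longrightarrow>
          norm (integral {a..y} f - integral {a..t} f - (y - t) *\<^sub>R f t) \<le> e * norm (y - t)"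
    proof (intro exI[of _ d] conjI ballI impI d)
      fix y assume y: "y \<in> {a..b}" "norm (y - t) < d"
      show "norm (integral {a..y} f - integral {a..t} f - (y - t) *\<^sub>R f t) \<le> e * norm (y - t)"
      proof (cases "t \<le> y")
        case True
        then show ?thesis using est[of t y] comb[of t y] t y
          by (simp add: algebra_simps norm_minus_commute flip: comb[of t y])
      next
        case False
        have "integral {a..y} f - integral {a..t} f - (y - t) *\<^sub>R f t = (t - y) *\<^sub>R f t - integral {y..t} f"
          using comb[of y t] t y False by (simp add: algebra_simps flip: comb[of y t])
        then show ?thesis using est[of y t] t y False by simp
      qed
    qed
  qed
  ultimately show thesis by (rule that)
qed

lemma AE_lebesgue_on_interval_iff:
  "(AE t in lebesgue_on {a..b::real}. P t) \<longleftrightarrow> (\<exists>N. negligible N \<and> (\<forall>t\<in>{a..b} - N. P t))"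
proof
  assume "AE t in lebesgue_on {a..b}. P t"
  then have "AE t in lebesgue. t \<in> {a..b} \<longrightarrow> P t"
    by (subst (asm) AE_restrict_space_iff) auto
  then obtain N where "N \<in> null_sets lebesgue" "{t. \<not> (t \<in> {a..b} \<longrightarrow> P t)} \<subseteq> N"
    by (auto elim!: AE_E3 simp: eventually_ae_filter)
  then show "\<exists>N. negligible N \<and> (\<forall>t\<in>{a..b} - N. P t)"
    by (intro exI[of _ N]) (auto simp: negligible_iff_null_sets)
next
  assume "\<exists>N. negligible N \<and> (\<forall>t\<in>{a..b} - N. P t)"
  then obtain N where N: "N \<in> null_sets lebesgue" "\<forall>t\<in>{a..b} - N. P t"
    by (auto simp: negligible_iff_null_sets)
  have "AE t in lebesgue. t \<in> {a..b} \<longrightarrow> P t"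
    by (rule AE_I'[OF N(1)]) (use N(2) in auto)
  then show "AE t in lebesgue_on {a..b}. P t"
    by (subst AE_restrict_space_iff) auto
qed

lemma slope_of_nonpos_derivative:
  fixes \<Psi> :: "real \<Rightarrow> real"
  assumes D: "(\<Psi> has_vector_derivative D) (at t within {a..b})" "D \<le> 0"
    and t: "a \<le> t" "t < b" and e: "0 < e" and d: "0 < d"
  shows "\<exists>l r. l < r \<and> t \<in> {l..r} \<and> {l..r} \<subseteq> {a..b} \<and> r - l < d \<and> \<Psi> r - \<Psi> l \<le> e * (r - l)"
proof -
  obtain d' where d': "d' > 0" and der: "\<And>y. y \<in> {a..b} \<Longrightarrow> norm (y - t) < d' \<Longrightarrow>
      norm (\<Psi> y - \<Psi> t - (y - t) *\<^sub>R D) \<le> e * norm (y - t)"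
    using D(1) e unfolding has_vector_derivative_def has_derivative_within_alt by metis
  define y where "y = t + min (d / 2) (min (d' / 2) (b - t))"
  have y: "t < y" "y \<le> b" "y - t < d" "y - t < d'" using t d d' by (auto simp: y_def)
  have "norm (\<Psi> y - \<Psi> t - (y - t) *\<^sub>R D) \<le> e * norm (y - t)" using y t by (intro der) auto
  moreover have "(y - t) * D \<le> 0" using y D(2) by (simp add: mult_nonneg_nonpos)
  ultimately have "\<Psi> y - \<Psi> t \<le> e * (y - t)" using y by simp
  then show ?thesis using y t by (intro exI[of _ t] exI[of _ y]) auto
qed

lemma norm_integral_diff_le:
  fixes f :: "real \<Rightarrow> 'a::euclidean_space"
  assumes f: "f integrable_on {a..b}" and M: "\<And>t. t \<in> {a..b} \<Longrightarrow> norm (f t) \<le> M"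
    and st: "a \<le> s" "s \<le> t" "t \<le> b"
  shows "norm (integral {a..t} f - integral {a..s} f) \<le> M * (t - s)"
proof -
  have "integral {a..s} f + integral {s..t} f = integral {a..t} f"
    using st integrable_subinterval_real[OF f] by (intro Henstock_Kurzweil_Integration.integral_combine) auto
  then have "integral {a..t} f - integral {a..s} f = integral {s..t} f" by (simp add: algebra_simps)
  moreover have "norm (integral {s..t} f) \<le> M * (t - s)"
  proof -
    have "0 \<le> M" using order_trans[OF norm_ge_zero M[of s]] st by auto
    moreover have "f integrable_on cbox s t" using integrable_subinterval_real[OF f] st by auto
    ultimately show ?thesis
      using integrable_bound[of M f s t] M st by auto
  qed
  ultimately show ?thesis by simp
qed

text \<open>The difference of \<open>x\<close> and the indefinite integral of \<open>\<phi>\<close> is absolutely continuous with derivative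
  zero almost everywhere. Applying the monotonicity criterion to its inner product with \<open>v\<close> and
  \<open>- v\<close> shows that it is constant.\<close>

lemma abs_cont_FTC:
  fixes x \<phi> :: "real \<Rightarrow> 'a::euclidean_space"
  assumes ab: "a \<le> b" and ac: "abs_cont_on a b x" and int: "\<phi> integrable_on {a..b}"
    and M: "\<And>t. t \<in> {a..b} \<Longrightarrow> norm (\<phi> t) \<le> M"
    and der: "AE t in lebesgue_on {a..b}. (x has_vector_derivative \<phi> t) (at t within {a..b})"
  shows "x b - x a = integral {a..b} \<phi>"
proof -
  obtain N1 where N1: "negligible N1"
    "\<And>t. t \<in> {a..b} - N1 \<Longrightarrow> (x has_vector_derivative \<phi> t) (at t within {a..b})"
    using der unfolding AE_lebesgue_on_interval_iff by blast
  obtain N2 where N2: "negligible N2"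
    "\<And>t. t \<in> {a..b} - N2 \<Longrightarrow> ((\<lambda>t. integral {a..t} \<phi>) has_vector_derivative \<phi> t) (at t within {a..b})"
    using Lebesgue_differentiation_interval[OF int] by metis
  define y where "y t = x t - integral {a..t} \<phi>" for t
  define S where "S = {a..<b} - (N1 \<union> N2)"
  have acy: "abs_cont_on a b (\<lambda>t. y t \<bullet> v)" for v
  proof (rule abs_cont_on_dominated[OF ac])
    fix s t assume st: "a \<le> s" "s \<le> t" "t \<le> b"
    have 1: "norm (y t \<bullet> v - y s \<bullet> v) \<le> norm (y t - y s) * norm v"
      using Cauchy_Schwarz_ineq2[of "y t - y s" v] by (simp add: inner_diff_left)
    have "norm (y t - y s) \<le> norm (x t - x s) + norm (integral {a..t} \<phi> - integral {a..s} \<phi>)"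
    proof -
      have "y t - y s = (x t - x s) - (integral {a..t} \<phi> - integral {a..s} \<phi>)"
        by (simp add: y_def)
      then show ?thesis using norm_triangle_ineq4 by metis
    qed
    also have "\<dots> \<le> norm (x t - x s) + M * (t - s)"
      using norm_integral_diff_le[OF int M st] by simp
    finally have "norm (y t - y s) * norm v \<le> (norm (x t - x s) + M * (t - s)) * norm v"
      by (rule mult_right_mono) simp
    with 1 show "norm (y t \<bullet> v - y s \<bullet> v) \<le> norm v * norm (x t - x s) + norm v * M * (t - s)"
      by (simp add: algebra_simps)
  qed
  have neg: "negligible ({a..b} - S)"
    by (rule negligible_subset[of "insert b (N1 \<union> N2)"]) (auto simp: S_def N1 N2)
  have le: "y b \<bullet> v \<le> y a \<bullet> v" for v
  proof (rule abs_cont_on_Dini_decreasing[OF ab acy neg])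
    fix t e d :: real assume t: "t \<in> S" and e: "0 < e" and d: "0 < d"
    have "((\<lambda>t. x t - integral {a..t} \<phi>) has_vector_derivative \<phi> t - \<phi> t) (at t within {a..b})"
      using t by (intro has_vector_derivative_diff N1(2) N2(2)) (auto simp: S_def)
    then have "(y has_vector_derivative 0) (at t within {a..b})" by (simp add: y_def[abs_def])
    from bounded_linear.has_vector_derivative[OF bounded_linear_inner_left this, of v]
    have "((\<lambda>t. y t \<bullet> v) has_vector_derivative 0) (at t within {a..b})" by simp
    then show "\<exists>l r. l < r \<and> t \<in> {l..r} \<and> {l..r} \<subseteq> {a..b} \<and> r - l < d \<and> y r \<bullet> v - y l \<bullet> v \<le> e * (r - l)"
      by (rule slope_of_nonpos_derivative) (use t e d in \<open>auto simp: S_def\<close>)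
  qed
  have "y b = y a"
  proof (rule euclidean_eqI)
    fix v :: 'a
    show "y b \<bullet> v = y a \<bullet> v" using le[of v] le[of "- v"] by simp
  qed
  then show ?thesis by (simp add: y_def algebra_simps)
qed

section \<open>Smooth bump functions\<close>

lemma times_cont_diff_Suc_imp: "times_cont_diff (Suc k) \<phi> \<Longrightarrow> times_cont_diff k \<phi>"
  by (induction k arbitrary: \<phi>) auto

lemma has_partial_deriv:
  assumes "(\<lambda>s. \<phi> (x + s *\<^sub>R b)) differentiable at 0"
  shows "((\<lambda>s. \<phi> (x + s *\<^sub>R b)) has_real_derivative partial_deriv b \<phi> x) (at 0)"
  using assms unfolding partial_deriv_def by (metis DERIV_deriv_iff_real_differentiable)

lemma partial_deriv_eqI:
  assumes "((\<lambda>s. \<phi> (x + s *\<^sub>R b)) has_real_derivative D) (at 0)"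
  shows "(\<lambda>s. \<phi> (x + s *\<^sub>R b)) differentiable at 0" "partial_deriv b \<phi> x = D"
  using assms unfolding partial_deriv_def by (auto intro: DERIV_imp_deriv simp: real_differentiable_def)

lemma times_cont_diff_continuous: "times_cont_diff k \<phi> \<Longrightarrow> continuous_on UNIV \<phi>"
  by (cases k) auto

lemma times_cont_diff_const: "times_cont_diff k (\<lambda>x::'a::euclidean_space. c)"
proof (induction k arbitrary: c)
  case (Suc k)
  have "partial_deriv b (\<lambda>x::'a. c) = (\<lambda>x. 0)" for b
    by (auto simp: partial_deriv_def)
  then show ?case using Suc.IH[of 0] by simp
qed simp

lemma times_cont_diff_add:
  "times_cont_diff k \<phi> \<Longrightarrow> times_cont_diff k \<psi> \<Longrightarrow> times_cont_diff k (\<lambda>x. \<phi> x + \<psi> x)"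
proof (induction k arbitrary: \<phi> \<psi>)
  case (Suc k)
  show ?case
    unfolding times_cont_diff.simps
  proof (intro conjI ballI allI)
    show "continuous_on UNIV (\<lambda>x. \<phi> x + \<psi> x)"
      using Suc.prems by (intro continuous_on_add) auto
    fix b :: 'a assume b: "b \<in> Basis"
    have D: "((\<lambda>s. \<phi> (x + s *\<^sub>R b) + \<psi> (x + s *\<^sub>R b)) has_real_derivative
      partial_deriv b \<phi> x + partial_deriv b \<psi> x) (at 0)" for x
      using Suc.prems b by (intro DERIV_add has_partial_deriv) auto
    show "(\<lambda>s. \<phi> (x + s *\<^sub>R b) + \<psi> (x + s *\<^sub>R b)) differentiable at 0" for x
      using partial_deriv_eqI(1)[of "\<lambda>x. \<phi> x + \<psi> x", OF D] .
    have "partial_deriv b (\<lambda>x. \<phi> x + \<psi> x) = (\<lambda>x. partial_deriv b \<phi> x + partial_deriv b \<psi> x)"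
      using partial_deriv_eqI(2)[of "\<lambda>x. \<phi> x + \<psi> x", OF D] by auto
    then show "times_cont_diff k (partial_deriv b (\<lambda>x. \<phi> x + \<psi> x))"
      using Suc b by auto
  qed
qed (auto intro: continuous_intros)

lemma times_cont_diff_mult:
  "times_cont_diff k \<phi> \<Longrightarrow> times_cont_diff k \<psi> \<Longrightarrow> times_cont_diff k (\<lambda>x. \<phi> x * \<psi> x)"
proof (induction k arbitrary: \<phi> \<psi>)
  case (Suc k)
  show ?case
    unfolding times_cont_diff.simps
  proof (intro conjI ballI allI)
    show "continuous_on UNIV (\<lambda>x. \<phi> x * \<psi> x)"
      using Suc.prems by (intro continuous_on_mult) auto
    fix b :: 'a assume b: "b \<in> Basis"
    have D: "((\<lambda>s. \<phi> (x + s *\<^sub>R b) * \<psi> (x + s *\<^sub>R b)) has_real_derivative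
      partial_deriv b \<phi> x * \<psi> x + partial_deriv b \<psi> x * \<phi> x) (at 0)" for x
    proof -
      have "((\<lambda>s. \<phi> (x + s *\<^sub>R b) * \<psi> (x + s *\<^sub>R b)) has_real_derivative
        partial_deriv b \<phi> x * \<psi> (x + 0 *\<^sub>R b) + partial_deriv b \<psi> x * \<phi> (x + 0 *\<^sub>R b)) (at 0)"
        using Suc.prems b by (intro DERIV_mult has_partial_deriv) auto
      then show ?thesis by simp
    qed
    show "(\<lambda>s. \<phi> (x + s *\<^sub>R b) * \<psi> (x + s *\<^sub>R b)) differentiable at 0" for x
      using partial_deriv_eqI(1)[of "\<lambda>x. \<phi> x * \<psi> x", OF D] .
    have "partial_deriv b (\<lambda>x. \<phi> x * \<psi> x) = (\<lambda>x. partial_deriv b \<phi> x * \<psi> x + partial_deriv b \<psi> x * \<phi> x)"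
      using partial_deriv_eqI(2)[of "\<lambda>x. \<phi> x * \<psi> x", OF D] by auto
    then show "times_cont_diff k (partial_deriv b (\<lambda>x. \<phi> x * \<psi> x))"
      using Suc.prems b times_cont_diff_Suc_imp[OF Suc.prems(1)] times_cont_diff_Suc_imp[OF Suc.prems(2)]
      by (auto intro!: times_cont_diff_add Suc.IH)
  qed
qed (auto intro: continuous_intros)

lemma times_cont_diff_prod:
  assumes "finite I" "\<And>i. i \<in> I \<Longrightarrow> times_cont_diff k (\<phi> i)"
  shows "times_cont_diff k (\<lambda>x. \<Prod>i\<in>I. \<phi> i x)"
  using assms by (induction I rule: finite_induct) (auto intro: times_cont_diff_const times_cont_diff_mult)

text \<open>For \<open>P = 1\<close> this is the standard flat function \<open>exp (- 1 / x)\<close>, extended by zero. Admitting a polynomial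
  factor in \<open>1 / x\<close> makes the family closed under differentiation.\<close>

definition flat_exp :: "real poly \<Rightarrow> real \<Rightarrow> real" where
  "flat_exp P x = (if 0 < x then poly P (1 / x) * exp (- (1 / x)) else 0)"

lemma poly_times_exp_neg_tendsto_0: "((\<lambda>y::real. poly P y * exp (- y)) \<longlongrightarrow> 0) at_top"
proof -
  have "((\<lambda>y. \<Sum>i\<le>degree P. coeff P i * (y ^ i / exp y)) \<longlongrightarrow> (\<Sum>i\<le>degree P. coeff P i * 0)) at_top"
    by (intro tendsto_sum tendsto_mult_left tendsto_power_div_exp_0)
  moreover have "(\<Sum>i\<le>degree P. coeff P i * (y ^ i / exp y)) = poly P y * exp (- y)" for y
    by (simp add: poly_altdef sum_distrib_right exp_minus divide_inverse mult.assoc)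
  ultimately show ?thesis by simp
qed

lemma flat_exp_tendsto_0: "(flat_exp P \<longlongrightarrow> 0) (at_right 0)"
proof -
  have "((\<lambda>x. poly P (inverse x) * exp (- inverse x)) \<longlongrightarrow> 0) (at_right 0)"
    by (rule filterlim_compose[OF poly_times_exp_neg_tendsto_0 filterlim_inverse_at_top_right])
  moreover have "eventually (\<lambda>x. poly P (inverse x) * exp (- inverse x) = flat_exp P x) (at_right 0)"
    unfolding eventually_at_filter by (simp add: flat_exp_def inverse_eq_divide)
  ultimately show ?thesis by (rule Lim_transform_eventually)
qed

lemma flat_exp_deriv:
  "(flat_exp P has_real_derivative flat_exp ([:0, 0, 1:] * (P - pderiv P)) x) (at x)"
proof -
  consider "0 < x" | "x < 0" | "x = 0" by linarith
  then show ?thesis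
  proof cases
    case 1
    have "((\<lambda>x. poly P (1 / x) * exp (- (1 / x))) has_real_derivative
      flat_exp ([:0, 0, 1:] * (P - pderiv P)) x) (at x)"
      using 1 by (auto intro!: derivative_eq_intros simp: flat_exp_def power2_eq_square field_simps)
    then show ?thesis
      by (rule has_field_derivative_transform_within_open[where S = "{0<..}"])
        (use 1 in \<open>auto simp: flat_exp_def\<close>)
  next
    case 2
    have "((\<lambda>x. 0) has_real_derivative flat_exp ([:0, 0, 1:] * (P - pderiv P)) x) (at x)"
      using 2 by (auto simp: flat_exp_def)
    then show ?thesis
      by (rule has_field_derivative_transform_within_open[where S = "{..<0}"])
        (use 2 in \<open>auto simp: flat_exp_def\<close>)
  next
    case 3
    have "((\<lambda>h. (flat_exp P (0 + h) - flat_exp P 0) / h) \<longlongrightarrow> 0) (at 0)"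
      unfolding filterlim_at_split
    proof
      show "((\<lambda>h. (flat_exp P (0 + h) - flat_exp P 0) / h) \<longlongrightarrow> 0) (at_left 0)"
        by (rule Lim_transform_eventually[OF tendsto_const])
          (simp add: eventually_at_filter flat_exp_def)
      show "((\<lambda>h. (flat_exp P (0 + h) - flat_exp P 0) / h) \<longlongrightarrow> 0) (at_right 0)"
        by (rule Lim_transform_eventually[OF flat_exp_tendsto_0[of "[:0, 1:] * P"]])
          (simp add: eventually_at_filter flat_exp_def)
    qed
    then show ?thesis using 3 by (simp add: DERIV_def flat_exp_def)
  qed
qed

lemma times_cont_diff_flat_exp: "times_cont_diff k (\<lambda>x. flat_exp P (a \<bullet> x + c))"
proof (induction k arbitrary: P)
  case 0
  have "continuous_on UNIV (flat_exp P)"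
    by (meson DERIV_isCont continuous_at_imp_continuous_on flat_exp_deriv)
  then show ?case
    by (auto intro!: continuous_intros continuous_on_compose2[of UNIV "flat_exp P"])
next
  case (Suc k)
  let ?P = "[:0, 0, 1:] * (P - pderiv P)"
  show ?case
    unfolding times_cont_diff.simps
  proof (intro conjI ballI allI)
    show "continuous_on UNIV (\<lambda>x. flat_exp P (a \<bullet> x + c))"
      using times_cont_diff_continuous[OF Suc.IH] .
    fix b :: 'a assume b: "b \<in> Basis"
    have D: "((\<lambda>s. flat_exp P (a \<bullet> (x + s *\<^sub>R b) + c)) has_real_derivative
      flat_exp ?P (a \<bullet> x + c) * (a \<bullet> b)) (at 0)" for x
    proof (rule DERIV_chain'[where g = "flat_exp P"])
      show "((\<lambda>s. a \<bullet> (x + s *\<^sub>R b) + c) has_real_derivative a \<bullet> b) (at 0)"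
        unfolding inner_add_right inner_scaleR_right by (auto intro!: derivative_eq_intros)
      show "(flat_exp P has_real_derivative flat_exp ?P (a \<bullet> x + c)) (at (a \<bullet> (x + 0 *\<^sub>R b) + c))"
        using flat_exp_deriv[of P "a \<bullet> x + c"] by simp
    qed
    show "(\<lambda>s. flat_exp P (a \<bullet> (x + s *\<^sub>R b) + c)) differentiable at 0" for x
      using partial_deriv_eqI(1)[of "\<lambda>x. flat_exp P (a \<bullet> x + c)", OF D] .
    have "partial_deriv b (\<lambda>x. flat_exp P (a \<bullet> x + c)) = (\<lambda>x. flat_exp ?P (a \<bullet> x + c) * (a \<bullet> b))"
      using partial_deriv_eqI(2)[of "\<lambda>x. flat_exp P (a \<bullet> x + c)", OF D] by blast
    then show "times_cont_diff k (partial_deriv b (\<lambda>x. flat_exp P (a \<bullet> x + c)))"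
      using times_cont_diff_mult[OF Suc.IH times_cont_diff_const] by simp
  qed
qed

text \<open>A product over the coordinates of functions that are positive exactly on an interval of radius
  \<open>\<epsilon>\<close>: a smooth bump that is positive exactly on the open cube about \<open>z\<close>.\<close>

definition cube_bump :: "real \<Rightarrow> 'a::euclidean_space \<Rightarrow> 'a \<Rightarrow> real" where
  "cube_bump \<epsilon> z x =
    (\<Prod>b\<in>Basis. flat_exp [:1:] (b \<bullet> x + (\<epsilon> - b \<bullet> z)) * flat_exp [:1:] (- b \<bullet> x + (\<epsilon> + b \<bullet> z)))"

lemma times_cont_diff_cube_bump: "times_cont_diff k (cube_bump \<epsilon> z)"
  unfolding cube_bump_def[abs_def]
  by (intro times_cont_diff_prod times_cont_diff_mult times_cont_diff_flat_exp) auto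

lemma cube_bump_nonneg: "0 \<le> cube_bump \<epsilon> z x"
  by (auto simp: cube_bump_def flat_exp_def intro!: prod_nonneg)

lemma cube_bump_pos: "0 < \<epsilon> \<Longrightarrow> 0 < cube_bump \<epsilon> z z"
  by (auto simp: cube_bump_def flat_exp_def intro!: prod_pos)

lemma cube_bump_eq_0:
  assumes "b \<in> Basis" "\<epsilon> \<le> \<bar>(x - z) \<bullet> b\<bar>"
  shows "cube_bump \<epsilon> z x = 0"
proof -
  have "flat_exp [:1:] (b \<bullet> x + (\<epsilon> - b \<bullet> z)) * flat_exp [:1:] (- b \<bullet> x + (\<epsilon> + b \<bullet> z)) = 0"
    using assms(2) by (auto simp: flat_exp_def inner_diff_right inner_commute[of _ b] abs_if split: if_splits)
  then show ?thesis using assms(1) unfolding cube_bump_def by (intro prod_zero) auto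
qed

lemma cube_bump_translate: "cube_bump \<epsilon> (z + w) x = cube_bump \<epsilon> z (x - w)"
  by (simp add: cube_bump_def inner_simps algebra_simps)

section \<open>Continuous functions with bounded weak derivatives\<close>

text \<open>This turns integrals against test functions into gauge integrals over a box, to which the Leibniz rule
  for differentiation under the integral sign applies.\<close>

lemma lebesgue_on_integral_of_support:
  fixes h :: "'a::euclidean_space \<Rightarrow> real"
  assumes "continuous_on (cbox p q) h" "cbox p q \<subseteq> \<Omega>" "\<Omega> \<in> sets lebesgue" "\<And>x. x \<notin> cbox p q \<Longrightarrow> h x = 0"
  shows "integrable (lebesgue_on \<Omega>) h" "(LINT x|lebesgue_on \<Omega>. h x) = integral (cbox p q) h"
proof -
  have eq: "(\<lambda>x. indicat_real \<Omega> x *\<^sub>R h x) = (\<lambda>x. indicat_real (cbox p q) x *\<^sub>R h x)"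
    using assms(2,4) by (auto simp: indicator_def fun_eq_iff)
  have i: "integrable (lebesgue_on (cbox p q)) h" by (rule continuous_imp_integrable[OF assms(1)])
  show "integrable (lebesgue_on \<Omega>) h"
    using i assms(3) by (simp add: integrable_restrict_space eq del: real_scaleR_def)
  have "(LINT x|lebesgue_on \<Omega>. h x) = (LINT x|lebesgue_on (cbox p q). h x)"
    using assms(3) by (simp add: integral_restrict_space eq del: real_scaleR_def)
  also have "\<dots> = integral (cbox p q) h" by (rule lebesgue_integral_eq_integral[OF i]) simp
  finally show "(LINT x|lebesgue_on \<Omega>. h x) = integral (cbox p q) h" .
qed

text \<open>Let \<open>G \<tau>\<close> be the integral of \<open>E\<close> against a bump function of total mass \<open>c\<close> centred at
  \<open>z + \<tau> *\<^sub>R b\<close>. Its derivative is the integral of \<open>v\<close> against the same bump, by the definition of the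
  weak derivative, so it is at most \<open>m * c\<close> in absolute value; hence \<open>G\<close> changes by at most \<open>m * c * s\<close>.
  When the bump is concentrated near its centre, continuity of \<open>E\<close> makes \<open>G \<tau>\<close> close to
  \<open>c * E (z + \<tau> *\<^sub>R b)\<close>. The margin \<open>r\<close> leaves room for the supports of the bumps.\<close>

lemma weak_partial_deriv_le_imp_Lipschitz:
  fixes E :: "'a::euclidean_space \<Rightarrow> real"
  assumes b: "b \<in> Basis" and s: "0 \<le> s" and r: "0 < r"
    and sub: "cbox (z - r *\<^sub>R One) (z + s *\<^sub>R b + r *\<^sub>R One) \<subseteq> \<Omega>" and \<Omega>: "open \<Omega>"
    and E: "continuous_on \<Omega> E" and weak: "weak_partial_deriv \<Omega> b E v"
    and v: "AE x in lebesgue_on \<Omega>. \<bar>v x\<bar> \<le> m"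
  shows "\<bar>E (z + s *\<^sub>R b) - E z\<bar> \<le> m * s"
proof (rule field_le_epsilon)
  fix e' :: real assume "0 < e'"
  define e where "e = e' / 2"
  have e: "e > 0" using \<open>0 < e'\<close> by (simp add: e_def)
  let ?Q = "cbox (z - r *\<^sub>R One) (z + s *\<^sub>R b + r *\<^sub>R One)"
  have \<Omega>m: "\<Omega> \<in> sets lebesgue" using \<Omega> by auto
  have inQ: "z \<in> ?Q" "z + s *\<^sub>R b \<in> ?Q" using r s b by (auto simp: mem_box inner_simps inner_Basis)
  have cE: "continuous_on ?Q E" using E sub continuous_on_subset by blast
  have near: "\<exists>d>0. \<forall>x. (\<forall>i\<in>Basis. \<bar>(x - y) \<bullet> i\<bar> \<le> d) \<longrightarrow> \<bar>E x - E y\<bar> \<le> e" if y: "y \<in> ?Q" for y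
  proof -
    have "isCont E y" using E \<Omega> y sub by (meson continuous_on_eq_continuous_at subsetD)
    then obtain d where d: "d > 0" "\<And>x. dist x y < d \<Longrightarrow> dist (E x) (E y) < e"
      using e unfolding continuous_at_eps_delta by blast
    show ?thesis
    proof (intro exI[of _ "d / (2 * real DIM('a))"] conjI allI impI)
      show "0 < d / (2 * real DIM('a))" using d by simp
      fix x assume "\<forall>i\<in>Basis. \<bar>(x - y) \<bullet> i\<bar> \<le> d / (2 * real DIM('a))"
      then have "(\<Sum>i\<in>Basis. \<bar>(x - y) \<bullet> i\<bar>) \<le> (\<Sum>i\<in>(Basis::'a set). d / (2 * real DIM('a)))"
        by (intro sum_mono) auto
      also have "\<dots> = d / 2" by simp
      finally have "norm (x - y) \<le> d / 2" using norm_le_l1[of "x - y"] by linarith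
      then have "dist x y < d" using d by (simp add: dist_norm)
      then show "\<bar>E x - E y\<bar> \<le> e" using d(2)[of x] by (simp add: dist_real_def)
    qed
  qed
  obtain d1 where d1: "d1 > 0" "\<And>x. (\<forall>i\<in>Basis. \<bar>(x - z) \<bullet> i\<bar> \<le> d1) \<Longrightarrow> \<bar>E x - E z\<bar> \<le> e"
    using near[OF inQ(1)] by blast
  obtain d2 where d2: "d2 > 0" "\<And>x. (\<forall>i\<in>Basis. \<bar>(x - (z + s *\<^sub>R b)) \<bullet> i\<bar> \<le> d2) \<Longrightarrow> \<bar>E x - E (z + s *\<^sub>R b)\<bar> \<le> e"
    using near[OF inQ(2)] by blast
  define \<epsilon> where "\<epsilon> = min r (min d1 d2)"
  have \<epsilon>: "0 < \<epsilon>" "\<epsilon> \<le> r" "\<epsilon> \<le> d1" "\<epsilon> \<le> d2" using r d1 d2 by (auto simp: \<epsilon>_def)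
  define \<eta> where "\<eta> = cube_bump \<epsilon> z"
  define \<psi> where "\<psi> = partial_deriv b \<eta>"
  define \<phi> where "\<phi> = (\<lambda>\<tau>. cube_bump \<epsilon> (z + \<tau> *\<^sub>R b))"
  define K where "K = (\<lambda>\<tau>. cbox (z + \<tau> *\<^sub>R b - \<epsilon> *\<^sub>R One) (z + \<tau> *\<^sub>R b + \<epsilon> *\<^sub>R One))"
  have tc: "times_cont_diff k \<eta>" for k unfolding \<eta>_def by (rule times_cont_diff_cube_bump)
  have \<eta>d: "((\<lambda>s. \<eta> (x + s *\<^sub>R b)) has_real_derivative \<psi> x) (at 0)" for x
    unfolding \<psi>_def using tc[of 1] b by (intro has_partial_deriv) auto
  have \<psi>c: "continuous_on UNIV \<psi>"
    unfolding \<psi>_def using tc[of 1] b by (simp add: numeral_eq_Suc)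
  have \<phi>\<eta>: "\<phi> \<tau> x = \<eta> (x - \<tau> *\<^sub>R b)" for \<tau> x
    unfolding \<phi>_def \<eta>_def by (rule cube_bump_translate)
  have \<phi>_eq: "\<phi> \<tau> = (\<lambda>x. \<eta> (x - \<tau> *\<^sub>R b))" for \<tau> by (simp add: fun_eq_iff \<phi>\<eta>)
  have \<phi>c: "continuous_on A (\<phi> \<tau>)" for A \<tau>
    unfolding \<phi>_def using times_cont_diff_continuous[OF times_cont_diff_cube_bump] continuous_on_subset by blast
  have KQ: "K \<tau> \<subseteq> ?Q" if "\<tau> \<in> {0..s}" for \<tau>
  proof -
    have "- r \<le> \<tau> * (b \<bullet> i) - \<epsilon>" "\<tau> * (b \<bullet> i) + \<epsilon> \<le> s * (b \<bullet> i) + r" if "i \<in> Basis" for i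
      using \<open>\<tau> \<in> {0..s}\<close> \<epsilon> b that by (auto simp: inner_Basis)
    then show ?thesis
      unfolding K_def by (intro subset_box_imp) (auto simp: inner_simps)
  qed
  have \<phi>0: "\<phi> \<tau> x = 0" if "x \<notin> K \<tau>" for \<tau> x
  proof -
    have "\<exists>i\<in>Basis. \<epsilon> \<le> \<bar>(x - (z + \<tau> *\<^sub>R b)) \<bullet> i\<bar>"
    proof (rule ccontr)
      assume "\<not> ?thesis"
      then have lt: "\<bar>(x - (z + \<tau> *\<^sub>R b)) \<bullet> i\<bar> < \<epsilon>" if "i \<in> Basis" for i
        using that by (auto simp: not_le)
      have "x \<in> K \<tau>"
        unfolding K_def mem_box
      proof (intro ballI conjI)
        fix i :: 'a assume i: "i \<in> Basis"
        show "(z + \<tau> *\<^sub>R b - \<epsilon> *\<^sub>R One) \<bullet> i \<le> x \<bullet> i" "x \<bullet> i \<le> (z + \<tau> *\<^sub>R b + \<epsilon> *\<^sub>R One) \<bullet> i"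
          using lt[OF i] i by (auto simp: inner_diff_left inner_add_left abs_less_iff)
      qed
      then show False using that by simp
    qed
    then obtain i where "i \<in> Basis" "\<epsilon> \<le> \<bar>(x - (z + \<tau> *\<^sub>R b)) \<bullet> i\<bar>" by blast
    then show ?thesis unfolding \<phi>_def by (rule cube_bump_eq_0)
  qed
  have test: "test_function \<Omega> (\<phi> \<tau>)" if "\<tau> \<in> {0..s}" for \<tau>
    unfolding test_function_def
  proof (intro conjI exI[of _ "K \<tau>"] allI impI)
    show "times_cont_diff k (\<phi> \<tau>)" for k unfolding \<phi>_def by (rule times_cont_diff_cube_bump)
    show "compact (K \<tau>)" by (simp add: K_def compact_cbox)
    show "K \<tau> \<subseteq> \<Omega>" using KQ[OF that] sub by blast
  qed (rule \<phi>0)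
  have pd: "partial_deriv b (\<phi> \<tau>) x = \<psi> (x - \<tau> *\<^sub>R b)" for \<tau> x
  proof (rule partial_deriv_eqI(2))
    show "((\<lambda>s. \<phi> \<tau> (x + s *\<^sub>R b)) has_real_derivative \<psi> (x - \<tau> *\<^sub>R b)) (at 0)"
      using \<eta>d[of "x - \<tau> *\<^sub>R b"] unfolding \<phi>\<eta> by (simp add: algebra_simps)
  qed
  have pd0: "\<psi> (x - \<tau> *\<^sub>R b) = 0" if "x \<notin> K \<tau>" for \<tau> x
  proof -
    have "open {h::real. x + h *\<^sub>R b \<notin> K \<tau>}"
    proof -
      have "closed (K \<tau>)" by (simp add: K_def closed_cbox)
      then have "open ((\<lambda>h::real. x + h *\<^sub>R b) -` (- K \<tau>))"
        by (intro open_vimage) (auto intro!: continuous_intros)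
      then show ?thesis by (simp add: vimage_def)
    qed
    note op = this
    have "((\<lambda>s. \<phi> \<tau> (x + s *\<^sub>R b)) has_real_derivative 0) (at 0)"
    proof (rule has_field_derivative_transform_within_open[where f = "\<lambda>_. 0"])
      show "((\<lambda>_. 0) has_real_derivative 0) (at 0)" by simp
      show "open {h::real. x + h *\<^sub>R b \<notin> K \<tau>}" by (rule op)
      show "0 \<in> {h::real. x + h *\<^sub>R b \<notin> K \<tau>}" using that by simp
      show "0 = \<phi> \<tau> (x + h *\<^sub>R b)" if "h \<in> {h::real. x + h *\<^sub>R b \<notin> K \<tau>}" for h
        using that by (simp add: \<phi>0)
    qed
    then have "partial_deriv b (\<phi> \<tau>) x = 0" by (rule partial_deriv_eqI(2))
    then show ?thesis by (simp add: pd)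
  qed
  define c where "c = integral (K 0) (\<phi> 0)"
  have c: "integrable (lebesgue_on \<Omega>) (\<phi> \<tau>)" "(LINT x|lebesgue_on \<Omega>. \<phi> \<tau> x) = c" "integral ?Q (\<phi> \<tau>) = c"
    if \<tau>: "\<tau> \<in> {0..s}" for \<tau>
  proof -
    have KO: "K \<tau> \<subseteq> \<Omega>" using KQ[OF \<tau>] sub by blast
    have 1: "(LINT x|lebesgue_on \<Omega>. \<phi> \<tau> x) = integral (K \<tau>) (\<phi> \<tau>)"
      using KO \<phi>0 unfolding K_def by (intro lebesgue_on_integral_of_support(2)) (auto simp: \<phi>c \<Omega>m)
    have 2: "(LINT x|lebesgue_on \<Omega>. \<phi> \<tau> x) = integral ?Q (\<phi> \<tau>)"
      using sub KQ[OF \<tau>] \<phi>0 by (intro lebesgue_on_integral_of_support(2)) (auto simp: \<phi>c \<Omega>m)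
    show "integrable (lebesgue_on \<Omega>) (\<phi> \<tau>)"
      using sub KQ[OF \<tau>] \<phi>0 by (intro lebesgue_on_integral_of_support(1)[of "z - r *\<^sub>R One" "z + s *\<^sub>R b + r *\<^sub>R One"]) (auto simp: \<phi>c \<Omega>m)
    have "integral (K \<tau>) (\<phi> \<tau>) = c"
      using integral_shift_cbox[of "z + \<tau> *\<^sub>R b - \<epsilon> *\<^sub>R One" "\<tau> *\<^sub>R b" "z + \<tau> *\<^sub>R b + \<epsilon> *\<^sub>R One" "\<phi> \<tau>"]
      unfolding c_def K_def by (simp add: \<phi>_eq algebra_simps)
    with 1 2 show "(LINT x|lebesgue_on \<Omega>. \<phi> \<tau> x) = c" "integral ?Q (\<phi> \<tau>) = c" by auto
  qed
  have \<phi>nn: "0 \<le> \<phi> \<tau> x" for \<tau> x unfolding \<phi>_def by (rule cube_bump_nonneg)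
  have cpos: "0 < c"
  proof (rule ccontr)
    assume "\<not> 0 < c"
    moreover have "0 \<le> c" unfolding c_def by (intro integral_nonneg integrable_continuous) (auto simp: \<phi>nn \<phi>c K_def intro: integrable_continuous)
    ultimately have "c = 0" by simp
    moreover have "(\<phi> 0 has_integral c) (K 0)"
      unfolding c_def K_def by (intro integrable_integral integrable_continuous \<phi>c)
    ultimately have "(\<phi> 0 has_integral 0) (cbox (z + 0 *\<^sub>R b - \<epsilon> *\<^sub>R One) (z + 0 *\<^sub>R b + \<epsilon> *\<^sub>R One))"
      unfolding K_def by simp
    then have "\<phi> 0 z = 0"
      by (rule has_integral_0_cbox_imp_0[OF \<phi>c \<phi>nn]) (use \<epsilon> in \<open>auto simp: mem_box box_ne_empty inner_simps\<close>)
    then show False using cube_bump_pos[OF \<epsilon>(1), of z] by (simp add: \<phi>_def)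
  qed
  define G where "G \<tau> = integral ?Q (\<lambda>x. E x * \<phi> \<tau> x)" for \<tau>
  have Gd: "(G has_field_derivative integral ?Q (\<lambda>x. E x * - \<psi> (x - \<tau> *\<^sub>R b))) (at \<tau> within {0..s})"
    if \<tau>: "\<tau> \<in> {0..s}" for \<tau>
    unfolding G_def
  proof (rule leibniz_rule_field_derivative[where fx = "\<lambda>\<tau> x. E x * - \<psi> (x - \<tau> *\<^sub>R b)" and U = "{0..s}"])
    fix \<sigma> x assume "\<sigma> \<in> {0..s}" "x \<in> ?Q"
    have "((\<lambda>h. \<eta> ((x - \<sigma> *\<^sub>R b) + h *\<^sub>R b)) has_real_derivative \<psi> (x - \<sigma> *\<^sub>R b)) (at (\<sigma> - \<sigma>))"
      using \<eta>d by simp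
    note 1 = this
    have 2: "((\<lambda>\<sigma>'. \<sigma> - \<sigma>') has_real_derivative -1) (at \<sigma>)"
      by (auto intro!: derivative_eq_intros)
    from DERIV_chain'[OF 2 1]
    have "((\<lambda>\<sigma>'. \<eta> ((x - \<sigma> *\<^sub>R b) + (\<sigma> - \<sigma>') *\<^sub>R b)) has_real_derivative - \<psi> (x - \<sigma> *\<^sub>R b)) (at \<sigma>)"
      by simp
    then have "((\<lambda>\<sigma>'. \<phi> \<sigma>' x) has_real_derivative - \<psi> (x - \<sigma> *\<^sub>R b)) (at \<sigma>)"
      unfolding \<phi>\<eta> by (simp add: algebra_simps)
    then show "((\<lambda>\<sigma>. E x * \<phi> \<sigma> x) has_real_derivative E x * - \<psi> (x - \<sigma> *\<^sub>R b)) (at \<sigma> within {0..s})"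
      by (intro DERIV_cmult) (rule has_field_derivative_at_within)
  next
    show "(\<lambda>x. E x * \<phi> \<sigma> x) integrable_on ?Q" for \<sigma>
      by (intro integrable_continuous continuous_on_mult cE \<phi>c)
    have "continuous_on ({0..s} \<times> ?Q) (\<lambda>p. E (snd p) * - \<psi> (snd p - fst p *\<^sub>R b))"
      by (intro continuous_intros continuous_on_compose2[OF cE] continuous_on_compose2[OF \<psi>c]) auto
    then show "continuous_on ({0..s} \<times> ?Q) (\<lambda>(\<tau>, x). E x * - \<psi> (x - \<tau> *\<^sub>R b))"
      by (simp add: case_prod_beta)
  qed (use \<tau> in auto)
  have Gb: "norm (integral ?Q (\<lambda>x. E x * - \<psi> (x - \<tau> *\<^sub>R b))) \<le> m * c" if \<tau>: "\<tau> \<in> {0..s}" for \<tau>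
  proof -
    have "integral ?Q (\<lambda>x. E x * - \<psi> (x - \<tau> *\<^sub>R b)) = - integral ?Q (\<lambda>x. E x * partial_deriv b (\<phi> \<tau>) x)"
      by (simp add: pd flip: integral_neg)
    also have "integral ?Q (\<lambda>x. E x * partial_deriv b (\<phi> \<tau>) x) = (LINT x|lebesgue_on \<Omega>. E x * partial_deriv b (\<phi> \<tau>) x)"
    proof (rule lebesgue_on_integral_of_support(2)[symmetric])
      show "continuous_on ?Q (\<lambda>x. E x * partial_deriv b (\<phi> \<tau>) x)"
        unfolding pd by (intro continuous_intros cE continuous_on_compose2[OF \<psi>c]) auto
      show "E x * partial_deriv b (\<phi> \<tau>) x = 0" if "x \<notin> ?Q" for x
        using that KQ[OF \<tau>] pd0 unfolding pd by auto
    qed (use sub \<Omega>m in auto)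
    also have "\<dots> = - (LINT x|lebesgue_on \<Omega>. v x * \<phi> \<tau> x)"
      using weak test[OF \<tau>] unfolding weak_partial_deriv_def by blast
    finally have "norm (integral ?Q (\<lambda>x. E x * - \<psi> (x - \<tau> *\<^sub>R b))) = \<bar>LINT x|lebesgue_on \<Omega>. v x * \<phi> \<tau> x\<bar>" by simp
    also have "\<dots> \<le> (LINT x|lebesgue_on \<Omega>. m * \<phi> \<tau> x)"
    proof (cases "integrable (lebesgue_on \<Omega>) (\<lambda>x. v x * \<phi> \<tau> x)")
      case True
      have "\<bar>LINT x|lebesgue_on \<Omega>. v x * \<phi> \<tau> x\<bar> \<le> (LINT x|lebesgue_on \<Omega>. \<bar>v x * \<phi> \<tau> x\<bar>)"
        by (rule integral_abs_bound)
      also have "\<dots> \<le> (LINT x|lebesgue_on \<Omega>. m * \<phi> \<tau> x)"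
      proof (rule integral_mono_AE)
        show "AE x in lebesgue_on \<Omega>. \<bar>v x * \<phi> \<tau> x\<bar> \<le> m * \<phi> \<tau> x"
          using v by eventually_elim (simp add: abs_mult \<phi>nn mult_right_mono)
      qed (use True c(1)[OF \<tau>] in auto)
      finally show ?thesis .
    next
      case False
      have "AE x in lebesgue_on \<Omega>. 0 \<le> m * \<phi> \<tau> x"
        using v by eventually_elim (smt (verit) \<phi>nn mult_nonneg_nonneg)
      from integral_nonneg_AE[OF this] show ?thesis
        using False by (simp add: not_integrable_integral_eq)
    qed
    also have "\<dots> = m * c" using c(2)[OF \<tau>] by simp
    finally show ?thesis .
  qed
  have "norm (G s - G 0) \<le> m * c * norm (s - 0)"
    by (rule field_differentiable_bound[OF _ Gd Gb]) (use s in auto)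
  then have 1: "\<bar>G s - G 0\<bar> \<le> m * c * s" using s by simp
  have 2: "\<bar>G \<tau> - E y * c\<bar> \<le> e * c" if \<tau>: "\<tau> \<in> {0..s}" and y: "\<And>x. x \<in> K \<tau> \<Longrightarrow> \<bar>E x - E y\<bar> \<le> e" for \<tau> y
  proof -
    have "G \<tau> - E y * c = integral ?Q (\<lambda>x. E x * \<phi> \<tau> x - E y * \<phi> \<tau> x)"
      unfolding G_def using c(3)[OF \<tau>]
      by (subst Henstock_Kurzweil_Integration.integral_diff) (auto intro!: integrable_continuous continuous_on_mult cE \<phi>c)
    also have "norm \<dots> \<le> integral ?Q (\<lambda>x. e * \<phi> \<tau> x)"
    proof (rule integral_norm_bound_integral)
      fix x assume "x \<in> ?Q"
      show "norm (E x * \<phi> \<tau> x - E y * \<phi> \<tau> x) \<le> e * \<phi> \<tau> x"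
      proof (cases "x \<in> K \<tau>")
        case True
        then show ?thesis using y[OF True] mult_right_mono[OF y[OF True] \<phi>nn[of \<tau> x]]
          by (simp add: abs_mult \<phi>nn flip: left_diff_distrib)
      qed (simp add: \<phi>0)
    qed (auto intro!: integrable_continuous continuous_on_mult continuous_on_diff cE \<phi>c)
    also have "\<dots> = e * c" using c(3)[OF \<tau>] by simp
    finally show ?thesis by simp
  qed
  have Kd: "\<bar>(x - (z + \<tau> *\<^sub>R b)) \<bullet> i\<bar> \<le> \<epsilon>" if "x \<in> K \<tau>" "i \<in> Basis" for x \<tau> i
  proof -
    have "(z + \<tau> *\<^sub>R b - \<epsilon> *\<^sub>R One) \<bullet> i \<le> x \<bullet> i" "x \<bullet> i \<le> (z + \<tau> *\<^sub>R b + \<epsilon> *\<^sub>R One) \<bullet> i"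
      using that by (auto simp: K_def mem_box)
    then show ?thesis using that(2) by (simp add: inner_diff_left inner_add_left)
  qed
  have "\<bar>G 0 - E z * c\<bar> \<le> e * c"
    using s Kd[of _ 0] \<epsilon> by (intro 2 d1) (auto intro: order_trans)
  moreover have "\<bar>G s - E (z + s *\<^sub>R b) * c\<bar> \<le> e * c"
    using s Kd[of _ s] \<epsilon> by (intro 2 d2) (auto intro: order_trans)
  ultimately have "\<bar>E (z + s *\<^sub>R b) * c - E z * c\<bar> \<le> m * c * s + 2 * (e * c)"
    using 1 by linarith
  moreover have "E (z + s *\<^sub>R b) * c - E z * c = (E (z + s *\<^sub>R b) - E z) * c"
    by (simp add: left_diff_distrib)
  ultimately have "\<bar>E (z + s *\<^sub>R b) - E z\<bar> * c \<le> m * c * s + 2 * (e * c)"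
    using cpos by (simp add: abs_mult)
  also have "\<dots> = (m * s + e') * c" by (simp add: e_def algebra_simps)
  finally have "\<bar>E (z + s *\<^sub>R b) - E z\<bar> * c \<le> (m * s + e') * c" .
  then show "\<bar>E (z + s *\<^sub>R b) - E z\<bar> \<le> m * s + e'" using cpos by simp
qed

text \<open>A nonempty open set has positive measure; on a null set the essential supremum would be
  \<open>- \<infinity>\<close>.\<close>

lemma esssup_abs_nonneg:
  fixes v :: "'a::euclidean_space \<Rightarrow> real"
  assumes "open \<Omega>" "\<Omega> \<noteq> {}"
  shows "0 \<le> esssup (lebesgue_on \<Omega>) (\<lambda>x. ereal \<bar>v x\<bar>)"
proof (cases "(\<lambda>x. ereal \<bar>v x\<bar>) \<in> borel_measurable (lebesgue_on \<Omega>)")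
  case True
  have "\<not> negligible \<Omega>" using assms open_not_negligible by blast
  then have "emeasure (lebesgue_on \<Omega>) (space (lebesgue_on \<Omega>)) \<noteq> 0"
    using assms(1) by (auto simp: negligible_iff_null_sets null_sets_def emeasure_restrict_space)
  then have "0 = esssup (lebesgue_on \<Omega>) (\<lambda>x. 0 :: ereal)" by (rule esssup_const[symmetric])
  also have "\<dots> \<le> esssup (lebesgue_on \<Omega>) (\<lambda>x. ereal \<bar>v x\<bar>)" by (rule esssup_mono) auto
  finally show ?thesis .
qed (simp add: esssup_non_measurable top_ereal_def)

text \<open>By continuity the set where the bound fails is open, and an open null set is empty.\<close>

lemma abs_le_esssup:
  fixes E :: "'a::euclidean_space \<Rightarrow> real"
  assumes \<Omega>: "open \<Omega>" and E: "continuous_on \<Omega> E" and z: "z \<in> \<Omega>"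
  shows "ereal \<bar>E z\<bar> \<le> esssup (lebesgue_on \<Omega>) (\<lambda>x. ereal \<bar>E x\<bar>)" (is "_ \<le> ?m")
proof (rule ccontr)
  assume "\<not> ?thesis"
  then have less: "?m < ereal \<bar>E z\<bar>" by simp
  moreover have "0 \<le> ?m" using \<Omega> z by (intro esssup_abs_nonneg) auto
  ultimately obtain m where m: "?m = ereal m" by (cases ?m) auto
  define A where "A = {x \<in> \<Omega>. m < \<bar>E x\<bar>}"
  have "open A"
  proof -
    have "continuous_on \<Omega> (\<lambda>x. \<bar>E x\<bar>)" by (intro continuous_intros E)
    then have "open (\<Omega> \<inter> (\<lambda>x. \<bar>E x\<bar>) -` {m<..})"
      using \<Omega> continuous_open_preimage open_greaterThan by blast
    moreover have "\<Omega> \<inter> (\<lambda>x. \<bar>E x\<bar>) -` {m<..} = A" by (auto simp: A_def)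
    ultimately show ?thesis by simp
  qed
  have "AE x in lebesgue_on \<Omega>. ereal \<bar>E x\<bar> \<le> ?m" by (rule esssup_AE)
  then have "AE x in lebesgue. x \<in> \<Omega> \<longrightarrow> ereal \<bar>E x\<bar> \<le> ?m"
    using \<Omega> by (subst (asm) AE_restrict_space_iff) auto
  then obtain N where N: "N \<in> null_sets lebesgue" "{x. \<not> (x \<in> \<Omega> \<longrightarrow> ereal \<bar>E x\<bar> \<le> ?m)} \<subseteq> N"
    by (auto simp: eventually_ae_filter)
  have "A \<subseteq> N"
  proof
    fix x assume "x \<in> A"
    then have "x \<in> {x. \<not> (x \<in> \<Omega> \<longrightarrow> ereal \<bar>E x\<bar> \<le> ?m)}" by (simp add: A_def m)
    then show "x \<in> N" using N(2) by blast
  qed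
  then have "negligible A" using N(1) by (metis negligible_iff_null_sets negligible_subset)
  moreover have "z \<in> A" using less z by (simp add: A_def m)
  ultimately show False using open_not_negligible[OF \<open>open A\<close>] by blast
qed

text \<open>The contribution of the direction \<open>b\<close> to the Sobolev norm.\<close>

definition weak_deriv_norm :: "'a::euclidean_space set \<Rightarrow> ('a \<Rightarrow> real) \<Rightarrow> 'a \<Rightarrow> ereal" where
  "weak_deriv_norm \<Omega> w b = (INF v\<in>{v. weak_partial_deriv \<Omega> b w v}. esssup (lebesgue_on \<Omega>) (\<lambda>x. ereal \<bar>v x\<bar>))"

lemma weak_deriv_norm_nonneg:
  "open \<Omega> \<Longrightarrow> \<Omega> \<noteq> {} \<Longrightarrow> 0 \<le> weak_deriv_norm \<Omega> w b"
  unfolding weak_deriv_norm_def by (intro INF_greatest esssup_abs_nonneg)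

text \<open>The infimum over all weak derivatives need not be attained, so the estimate is first shown for every
  \<open>m' > m\<close>.\<close>

lemma coordinate_Lipschitz:
  fixes E :: "'a::euclidean_space \<Rightarrow> real"
  assumes b: "b \<in> Basis" and r: "0 < r"
    and cube: "\<And>x. (\<And>i. i \<in> Basis \<Longrightarrow> \<bar>(x - a) \<bullet> i\<bar> \<le> 2 * r) \<Longrightarrow> x \<in> \<Omega>"
    and \<Omega>: "open \<Omega>" and E: "continuous_on \<Omega> E" and m: "weak_deriv_norm \<Omega> E b = ereal m"
    and z: "\<And>i. i \<in> Basis \<Longrightarrow> \<bar>(z - a) \<bullet> i\<bar> \<le> r"
    and zs: "\<And>i. i \<in> Basis \<Longrightarrow> \<bar>(z + s *\<^sub>R b - a) \<bullet> i\<bar> \<le> r"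
  shows "\<bar>E (z + s *\<^sub>R b) - E z\<bar> \<le> m * \<bar>s\<bar>"
proof -
  have main: "\<bar>E (z + s *\<^sub>R b) - E z\<bar> \<le> m' * s"
    if m': "m < m'" and s: "0 \<le> s" and z: "\<And>i. i \<in> Basis \<Longrightarrow> \<bar>(z - a) \<bullet> i\<bar> \<le> r"
      and zs: "\<And>i. i \<in> Basis \<Longrightarrow> \<bar>(z + s *\<^sub>R b - a) \<bullet> i\<bar> \<le> r" for z s m'
  proof -
    have "weak_deriv_norm \<Omega> E b < ereal m'" using m m' by simp
    then obtain v where v: "weak_partial_deriv \<Omega> b E v" and v': "esssup (lebesgue_on \<Omega>) (\<lambda>x. ereal \<bar>v x\<bar>) < ereal m'"
      unfolding weak_deriv_norm_def by (auto simp: INF_less_iff)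
    have "AE x in lebesgue_on \<Omega>. ereal \<bar>v x\<bar> \<le> esssup (lebesgue_on \<Omega>) (\<lambda>x. ereal \<bar>v x\<bar>)"
      by (rule esssup_AE)
    then have ae: "AE x in lebesgue_on \<Omega>. \<bar>v x\<bar> \<le> m'"
    proof eventually_elim
      case (elim x)
      then have "ereal \<bar>v x\<bar> < ereal m'" using v' by (rule order_le_less_trans)
      then show ?case by simp
    qed
    have "cbox (z - r *\<^sub>R One) (z + s *\<^sub>R b + r *\<^sub>R One) \<subseteq> \<Omega>"
    proof
      fix x assume x: "x \<in> cbox (z - r *\<^sub>R One) (z + s *\<^sub>R b + r *\<^sub>R One)"
      show "x \<in> \<Omega>"
      proof (rule cube)
        fix i :: 'a assume i: "i \<in> Basis"
        have "(z - r *\<^sub>R One) \<bullet> i \<le> x \<bullet> i" "x \<bullet> i \<le> (z + s *\<^sub>R b + r *\<^sub>R One) \<bullet> i"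
          using x i by (auto simp: mem_box)
        then have "z \<bullet> i - r \<le> x \<bullet> i" "x \<bullet> i \<le> (z + s *\<^sub>R b) \<bullet> i + r"
          using i by (auto simp: inner_diff_left inner_add_left)
        moreover have "\<bar>z \<bullet> i - a \<bullet> i\<bar> \<le> r" "\<bar>(z + s *\<^sub>R b) \<bullet> i - a \<bullet> i\<bar> \<le> r"
          using z[OF i] zs[OF i] by (auto simp: inner_diff_left)
        ultimately show "\<bar>(x - a) \<bullet> i\<bar> \<le> 2 * r" unfolding inner_diff_left by linarith
      qed
    qed
    from weak_partial_deriv_le_imp_Lipschitz[OF b s r this \<Omega> E v ae] show ?thesis .
  qed
  have step: "\<bar>E (z + s *\<^sub>R b) - E z\<bar> \<le> m' * \<bar>s\<bar>" if m': "m < m'" for m'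
  proof (cases "0 \<le> s")
    case True
    then show ?thesis using main[OF m' True z zs] by simp
  next
    case False
    have "\<bar>E ((z + s *\<^sub>R b) + (- s) *\<^sub>R b) - E (z + s *\<^sub>R b)\<bar> \<le> m' * (- s)"
      by (rule main[OF m']) (use False z zs in auto)
    then show ?thesis using False by (simp add: abs_minus_commute)
  qed
  show ?thesis
  proof (rule field_le_epsilon)
    fix e :: real assume e: "0 < e"
    have "\<bar>E (z + s *\<^sub>R b) - E z\<bar> \<le> (m + e / (1 + \<bar>s\<bar>)) * \<bar>s\<bar>"
      using e by (intro step) (simp add: add_pos_nonneg)
    also have "\<dots> = m * \<bar>s\<bar> + e * (\<bar>s\<bar> / (1 + \<bar>s\<bar>))" by (simp add: algebra_simps)
    also have "\<dots> \<le> m * \<bar>s\<bar> + e * 1"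
      using e by (intro add_left_mono mult_left_mono) auto
    finally show "\<bar>E (z + s *\<^sub>R b) - E z\<bar> \<le> m * \<bar>s\<bar> + e" by simp
  qed
qed

text \<open>Change the coordinates one at a time. The intermediate points stay in the same cube, which is why
  cubes are used here: inside a ball, moving parallel to the axes may leave the domain.\<close>

lemma local_Lipschitz:
  fixes E :: "'a::euclidean_space \<Rightarrow> real"
  assumes r: "0 < r"
    and cube: "\<And>x. (\<And>i. i \<in> Basis \<Longrightarrow> \<bar>(x - a) \<bullet> i\<bar> \<le> 2 * r) \<Longrightarrow> x \<in> \<Omega>"
    and \<Omega>: "open \<Omega>" and E: "continuous_on \<Omega> E"
    and m: "\<And>b. b \<in> Basis \<Longrightarrow> weak_deriv_norm \<Omega> E b = ereal (m b)"
    and y: "\<And>i. i \<in> Basis \<Longrightarrow> \<bar>(y - a) \<bullet> i\<bar> \<le> r"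
    and z: "\<And>i. i \<in> Basis \<Longrightarrow> \<bar>(z - a) \<bullet> i\<bar> \<le> r"
  shows "\<bar>E y - E z\<bar> \<le> (\<Sum>b\<in>Basis. m b * \<bar>(y - z) \<bullet> b\<bar>)"
proof -
  \<comment> \<open>the point with the coordinates of \<open>y\<close> for the directions in \<open>B\<close> and those of \<open>z\<close> otherwise\<close>
  define w where "w B = z + (\<Sum>b\<in>B. ((y - z) \<bullet> b) *\<^sub>R b)" for B
  have w_inner: "w B \<bullet> i = (if i \<in> B then y \<bullet> i else z \<bullet> i)" if "B \<subseteq> Basis" "i \<in> Basis" for B i
  proof -
    have fB: "finite B" using that(1) finite_Basis finite_subset by blast
    have "(\<Sum>b\<in>B. ((y - z) \<bullet> b) *\<^sub>R b) \<bullet> i = (\<Sum>b\<in>B. if b = i then (y - z) \<bullet> i else 0)"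
      unfolding inner_sum_left using that by (intro sum.cong) (auto simp: inner_Basis subset_iff)
    also have "\<dots> = (if i \<in> B then (y - z) \<bullet> i else 0)" using fB by simp
    finally show ?thesis by (simp add: w_def inner_add_left inner_diff_left)
  qed
  have near: "\<bar>(w B - a) \<bullet> i\<bar> \<le> r" if "B \<subseteq> Basis" "i \<in> Basis" for B i
    using y[OF that(2)] z[OF that(2)] by (simp add: inner_diff_left w_inner[OF that])
  have "\<bar>E (w B) - E z\<bar> \<le> (\<Sum>b\<in>B. m b * \<bar>(y - z) \<bullet> b\<bar>)" if "B \<subseteq> Basis" for B
    using finite_subset[OF that finite_Basis] that
  proof (induction B rule: finite_induct)
    case (insert b B)
    have B: "b \<in> Basis" "B \<subseteq> Basis" "insert b B \<subseteq> Basis" using insert.prems by auto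
    have wb: "w (insert b B) = w B + ((y - z) \<bullet> b) *\<^sub>R b"
      using insert.hyps by (simp add: w_def algebra_simps)
    have "\<bar>E (w B + ((y - z) \<bullet> b) *\<^sub>R b) - E (w B)\<bar> \<le> m b * \<bar>(y - z) \<bullet> b\<bar>"
    proof (rule coordinate_Lipschitz[OF B(1) r cube \<Omega> E m[OF B(1)]])
      show "\<bar>(w B - a) \<bullet> i\<bar> \<le> r" if "i \<in> Basis" for i using near[OF B(2) that] .
      show "\<bar>(w B + ((y - z) \<bullet> b) *\<^sub>R b - a) \<bullet> i\<bar> \<le> r" if "i \<in> Basis" for i
        using near[OF B(3) that] by (simp add: wb)
    qed
    with insert.IH[OF B(2)] show ?case
      using insert.hyps by (simp add: wb)
  qed (simp add: w_def)
  from this[of Basis] have "\<bar>E (w Basis) - E z\<bar> \<le> (\<Sum>b\<in>Basis. m b * \<bar>(y - z) \<bullet> b\<bar>)" by simp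
  moreover have "w Basis = y" by (rule euclidean_eqI) (simp add: w_inner)
  ultimately show ?thesis by simp
qed

section \<open>Support directions of the Clarke gradient\<close>

text \<open>A finite-dimensional Hahn--Banach theorem up to \<open>e\<close>: separate the point \<open>(w, j w - e)\<close>
  from the epigraph of \<open>j\<close>, a closed convex cone. A separating hyperplane of a cone may be
  taken through the origin, and it is not vertical; its slope is the required linear functional.\<close>

lemma sublinear_support:
  fixes j :: "'a::euclidean_space \<Rightarrow> real"
  assumes add: "\<And>v w. j (v + w) \<le> j v + j w" and scale: "\<And>k v. 0 \<le> k \<Longrightarrow> j (k *\<^sub>R v) = k * j v"
    and cont: "continuous_on UNIV j" and e: "0 < e"
  shows "\<exists>p. (\<forall>v. p \<bullet> v \<le> j v) \<and> j w - e \<le> p \<bullet> w"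
proof -
  define S where "S = {(v, r). j v \<le> r}"
  have "closed {x. j (fst x) \<le> snd x}"
    by (intro closed_Collect_le continuous_intros continuous_on_compose2[OF cont]) auto
  moreover have "S = {x. j (fst x) \<le> snd x}" by (auto simp: S_def)
  ultimately have "closed S" by simp
  moreover have "convex S"
  proof (rule convexI)
    fix x y :: "'a \<times> real" and k l :: real
    assume *: "x \<in> S" "y \<in> S" "0 \<le> k" "0 \<le> l" "k + l = 1"
    obtain v r v' r' where [simp]: "x = (v, r)" "y = (v', r')" by (cases x; cases y)
    have "j (k *\<^sub>R v + l *\<^sub>R v') \<le> k * j v + l * j v'"
      using add[of "k *\<^sub>R v" "l *\<^sub>R v'"] scale[OF *(3)] scale[OF *(4)] by simp
    also have "\<dots> \<le> k * r + l * r'" using * by (intro add_mono mult_left_mono) (auto simp: S_def)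
    finally show "k *\<^sub>R x + l *\<^sub>R y \<in> S" by (simp add: S_def)
  qed
  moreover have "(w, j w - e) \<notin> S" using e by (simp add: S_def)
  ultimately obtain a b where ab: "a \<bullet> (w, j w - e) < b" "\<And>x. x \<in> S \<Longrightarrow> b < a \<bullet> x"
    using separating_hyperplane_closed_point[of S "(w, j w - e)"] by blast
  obtain a1 a2 where [simp]: "a = (a1, a2)" by (cases a)
  have S_cone: "k *\<^sub>R x \<in> S" if "x \<in> S" "0 \<le> k" for x k
    using that by (auto simp: S_def scale mult_left_mono)
  have nonneg: "0 \<le> a \<bullet> x" if x: "x \<in> S" for x
  proof (rule ccontr)
    assume neg: "\<not> 0 \<le> a \<bullet> x"
    define k where "k = (\<bar>b\<bar> + 1) / (- (a \<bullet> x))"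
    have "0 \<le> k" unfolding k_def by (rule divide_nonneg_nonneg) (use neg in auto)
    then have "b < a \<bullet> (k *\<^sub>R x)" by (intro ab(2) S_cone x)
    also have "a \<bullet> (k *\<^sub>R x) = - (\<bar>b\<bar> + 1)" using neg by (simp add: k_def field_simps)
    finally show False by simp
  qed
  have j0: "j 0 = 0" using scale[of 0 0] by simp
  have "b < 0" using ab(2)[of "(0, 0)"] j0 by (simp add: S_def)
  have a2: "0 \<le> a2" using nonneg[of "(0, 1)"] j0 by (simp add: S_def)
  have supp: "0 \<le> a1 \<bullet> v + a2 * j v" for v using nonneg[of "(v, j v)"] by (simp add: S_def)
  have "a2 \<noteq> 0"
  proof
    assume "a2 = 0"
    with supp[of w] ab(1) \<open>b < 0\<close> show False by simp
  qed
  with a2 have a2: "0 < a2" by simp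
  show ?thesis
  proof (intro exI[of _ "(- 1 / a2) *\<^sub>R a1"] conjI allI)
    fix v show "((- 1 / a2) *\<^sub>R a1) \<bullet> v \<le> j v" using supp[of v] a2 by (simp add: field_simps)
    have "a1 \<bullet> w + a2 * (j w - e) < 0" using ab(1) \<open>b < 0\<close> by simp
    then show "j w - e \<le> ((- 1 / a2) *\<^sub>R a1) \<bullet> w" using a2 by (simp add: field_simps)
  qed
qed

lemma eventually_difference_quotient:
  "eventually P (inf (nhds (x::'a::metric_space) \<times>\<^sub>F at_right (0::real)) (principal S)) \<longleftrightarrow>
    (\<exists>d>0. \<forall>y h. dist y x < d \<longrightarrow> 0 < h \<longrightarrow> h < d \<longrightarrow> (y, h) \<in> S \<longrightarrow> P (y, h))"
  unfolding eventually_inf_principal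
proof
  assume "\<forall>\<^sub>F p in nhds x \<times>\<^sub>F at_right 0. p \<in> S \<longrightarrow> P p"
  then obtain A B where AB: "eventually A (nhds x)" "eventually B (at_right (0::real))"
    "\<And>y h. A y \<Longrightarrow> B h \<Longrightarrow> (y, h) \<in> S \<Longrightarrow> P (y, h)"
    unfolding eventually_prod_filter by blast
  obtain d1 where d1: "d1 > 0" "\<And>y. dist y x < d1 \<Longrightarrow> A y"
    using AB(1) unfolding eventually_nhds_metric by blast
  obtain d2 where d2: "d2 > 0" "\<And>h. 0 < h \<Longrightarrow> h < d2 \<Longrightarrow> B h"
    using AB(2) unfolding eventually_at_right_field by blast
  show "\<exists>d>0. \<forall>y h. dist y x < d \<longrightarrow> 0 < h \<longrightarrow> h < d \<longrightarrow> (y, h) \<in> S \<longrightarrow> P (y, h)"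
    using d1 d2 AB(3) by (intro exI[of _ "min d1 d2"]) auto
next
  assume "\<exists>d>0. \<forall>y h. dist y x < d \<longrightarrow> 0 < h \<longrightarrow> h < d \<longrightarrow> (y, h) \<in> S \<longrightarrow> P (y, h)"
  then obtain d where d: "d > 0" "\<And>y h. dist y x < d \<Longrightarrow> 0 < h \<Longrightarrow> h < d \<Longrightarrow> (y, h) \<in> S \<Longrightarrow> P (y, h)"
    by blast
  have "eventually (\<lambda>y. dist y x < d) (nhds x)" "eventually (\<lambda>h. 0 < h \<and> h < d) (at_right (0::real))"
    using d(1) by (auto simp: eventually_nhds_metric eventually_at_right_field)
  then show "\<forall>\<^sub>F p in nhds x \<times>\<^sub>F at_right 0. p \<in> S \<longrightarrow> P p"
    unfolding eventually_prod_filter using d(2)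
    by (intro exI[of _ "\<lambda>y. dist y x < d"] exI[of _ "\<lambda>h. 0 < h \<and> h < d"]) auto
qed

text \<open>The Clarke directional derivative \<open>j\<close> is the support function of the Clarke gradient: it is
  sublinear and bounded by \<open>K * norm v\<close>, and linear functionals below it are the elements of the
  gradient. Difference quotients in direction \<open>w\<close> that are frequently at least \<open>a\<close> force
  \<open>j w \<ge> a\<close>, and \<open>sublinear_support\<close> gives an element that almost attains \<open>j w\<close>.\<close>

lemma clarke_gradient_support:
  fixes J :: "'a::euclidean_space \<Rightarrow> real"
  assumes lip: "K-lipschitz_on \<Omega> J" and z: "z \<in> interior \<Omega>"
    and freq: "\<And>d. 0 < d \<Longrightarrow> \<exists>y h. dist y z < d \<and> 0 < h \<and> h < d \<and> a \<le> (J (y + h *\<^sub>R w) - J y) / h"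
    and e: "0 < e"
  shows "\<exists>p\<in>clarke_gradient \<Omega> J z. a - e \<le> p \<bullet> w"
proof -
  define F where "F v = inf (nhds z \<times>\<^sub>F at_right 0) (principal {(y, h). y \<in> \<Omega> \<and> y + h *\<^sub>R v \<in> \<Omega>})" for v
  define q where "q v = (\<lambda>(y, h). (J (y + h *\<^sub>R v) - J y) / h)" for v :: 'a
  define L where "L v = Limsup (F v) (\<lambda>p. ereal (q v p))" for v
  define j where "j v = real_of_ereal (L v)" for v
  obtain \<rho> where \<rho>: "\<rho> > 0" "ball z \<rho> \<subseteq> \<Omega>" using z by (auto simp: mem_interior)
  have in\<Omega>: "y \<in> \<Omega> \<and> y + h *\<^sub>R v \<in> \<Omega>"
    if "dist y z < d" "0 < h" "h < d" "d * (1 + norm v) \<le> \<rho>" for y h v d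
  proof -
    have d0: "0 < d" using that by linarith
    have "d \<le> d * (1 + norm v)" using d0 by (simp add: algebra_simps)
    then have "dist y z < \<rho>" using that by linarith
    then have "y \<in> ball z \<rho>" by (simp add: dist_commute)
    moreover have "dist (y + h *\<^sub>R v) z \<le> dist y z + h * norm v"
      using norm_triangle_ineq[of "y - z" "h *\<^sub>R v"] that by (simp add: dist_norm algebra_simps)
    then have "dist (y + h *\<^sub>R v) z < d * (1 + norm v)"
      using that mult_right_mono[of h d "norm v"] by (simp add: algebra_simps)
    then have "y + h *\<^sub>R v \<in> ball z \<rho>" using that by (simp add: dist_commute)
    ultimately show ?thesis using \<rho> by blast
  qed
  have pos: "0 < \<rho> / (1 + norm v)" for v :: 'a
    using \<rho> by (intro divide_pos_pos add_pos_nonneg) auto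
  have scal: "d * (1 + norm v) \<le> \<rho>" if "d \<le> \<rho> / (1 + norm v)" for d and v :: 'a
    using that by (subst (asm) pos_le_divide_eq) (auto intro: add_pos_nonneg)
  have ev: "eventually P (F v) \<longleftrightarrow> (\<exists>d>0. \<forall>y h. dist y z < d \<longrightarrow> 0 < h \<longrightarrow> h < d \<longrightarrow> P (y, h))" for P v
    unfolding F_def eventually_difference_quotient
  proof
    assume "\<exists>d>0. \<forall>y h. dist y z < d \<longrightarrow> 0 < h \<longrightarrow> h < d \<longrightarrow>
      (y, h) \<in> {(y, h). y \<in> \<Omega> \<and> y + h *\<^sub>R v \<in> \<Omega>} \<longrightarrow> P (y, h)"
    then obtain d where d: "d > 0" "\<And>y h. dist y z < d \<Longrightarrow> 0 < h \<Longrightarrow> h < d \<Longrightarrow>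
      y \<in> \<Omega> \<and> y + h *\<^sub>R v \<in> \<Omega> \<Longrightarrow> P (y, h)" by auto
    show "\<exists>d>0. \<forall>y h. dist y z < d \<longrightarrow> 0 < h \<longrightarrow> h < d \<longrightarrow> P (y, h)"
    proof (intro exI[of _ "min d (\<rho> / (1 + norm v))"] conjI allI impI)
      show "0 < min d (\<rho> / (1 + norm v))" using d(1) pos by simp
      fix y h assume *: "dist y z < min d (\<rho> / (1 + norm v))" "0 < h" "h < min d (\<rho> / (1 + norm v))"
      have "y \<in> \<Omega> \<and> y + h *\<^sub>R v \<in> \<Omega>"
        using * by (intro in\<Omega>[of y "\<rho> / (1 + norm v)" h v] scal) auto
      then show "P (y, h)" using * by (intro d(2)) auto
    qed
  qed blast
  have q_bound: "\<bar>q v (y, h)\<bar> \<le> K * norm v" if "y \<in> \<Omega> \<and> y + h *\<^sub>R v \<in> \<Omega>" "0 < h" for v y h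
  proof -
    have "\<bar>J (y + h *\<^sub>R v) - J y\<bar> \<le> K * (h * norm v)"
      using lipschitz_onD[OF lip, of "y + h *\<^sub>R v" y] that by (simp add: dist_norm)
    then show ?thesis using that by (simp add: q_def field_simps)
  qed
  have ev_bound: "\<forall>\<^sub>F p in F v. \<bar>q v p\<bar> \<le> K * norm v" for v
    unfolding ev
  proof (intro exI[of _ "\<rho> / (1 + norm v)"] conjI allI impI pos)
    fix y h assume "dist y z < \<rho> / (1 + norm v)" "0 < h" "h < \<rho> / (1 + norm v)"
    then show "\<bar>q v (y, h)\<bar> \<le> K * norm v"
      by (intro q_bound in\<Omega>[of y "\<rho> / (1 + norm v)"] scal) auto
  qed
  have nt: "F v \<noteq> bot" for v
  proof
    assume "F v = bot"
    then have "eventually (\<lambda>_. False) (F v)" by simp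
    then obtain d where d: "d > 0" "\<And>y h. dist y z < d \<Longrightarrow> 0 < h \<Longrightarrow> h < d \<Longrightarrow> False"
      unfolding ev by blast
    from d(2)[of z "d / 2"] d(1) show False by simp
  qed
  have L_le: "L v \<le> ereal r" if "\<forall>\<^sub>F p in F v. q v p \<le> r" for v r
    unfolding L_def by (rule Limsup_bounded) (use that in simp)
  have L_ge: "ereal (- (K * norm v)) \<le> L v" for v
  proof -
    have "ereal (- (K * norm v)) \<le> Liminf (F v) (\<lambda>p. ereal (q v p))"
      by (rule Liminf_bounded) (use ev_bound[of v] in \<open>auto elim!: eventually_mono\<close>)
    also have "\<dots> \<le> L v" unfolding L_def by (rule Liminf_le_Limsup[OF nt])
    finally show ?thesis .
  qed
  have L_le_K: "L v \<le> ereal (K * norm v)" for v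
    by (rule L_le) (use ev_bound[of v] in \<open>auto elim!: eventually_mono\<close>)
  have Lj: "L v = ereal (j v)" for v
    unfolding j_def using L_ge[of v] L_le_K[of v] by (cases "L v") auto
  have j_le: "j v \<le> r" if "\<forall>\<^sub>F p in F v. q v p \<le> r" for v r
    using L_le[OF that] by (simp add: Lj)
  have j_bound: "j v \<le> K * norm v" for v using L_le_K[of v] by (simp add: Lj)
  have j_ev: "\<exists>d>0. \<forall>y h. dist y z < d \<longrightarrow> 0 < h \<longrightarrow> h < d \<longrightarrow> J (y + h *\<^sub>R v) - J y \<le> h * (j v + \<epsilon>)"
    if "0 < \<epsilon>" for v \<epsilon>
  proof -
    have "Limsup (F v) (\<lambda>p. ereal (q v p)) < ereal (j v + \<epsilon>)"
      using that Lj[of v] by (simp add: L_def)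
    then have "\<forall>\<^sub>F p in F v. ereal (q v p) < ereal (j v + \<epsilon>)" by (rule Limsup_lessD)
    then obtain d where d: "d > 0" "\<And>y h. dist y z < d \<Longrightarrow> 0 < h \<Longrightarrow> h < d \<Longrightarrow> q v (y, h) < j v + \<epsilon>"
      unfolding ev by auto
    have "J (y + h *\<^sub>R v) - J y \<le> h * (j v + \<epsilon>)" if "dist y z < d" "0 < h" "h < d" for y h
      using d(2)[OF that] that(2) by (simp add: q_def field_simps)
    then show ?thesis using d(1) by blast
  qed
  have j_leI: "j v \<le> r"
    if "0 < d" "\<And>y h. dist y z < d \<Longrightarrow> 0 < h \<Longrightarrow> h < d \<Longrightarrow> J (y + h *\<^sub>R v) - J y \<le> h * r" for v r d
  proof (rule j_le)
    show "\<forall>\<^sub>F p in F v. q v p \<le> r"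
      unfolding ev using that by (intro exI[of _ d]) (auto simp: q_def field_simps)
  qed
  have j_add: "j (v + w) \<le> j v + j w" for v w
  proof (rule field_le_epsilon)
    fix \<epsilon> :: real assume "0 < \<epsilon>"
    then have e2: "0 < \<epsilon> / 2" by simp
    obtain d1 where d1: "d1 > 0" "\<And>y h. dist y z < d1 \<Longrightarrow> 0 < h \<Longrightarrow> h < d1 \<Longrightarrow> J (y + h *\<^sub>R v) - J y \<le> h * (j v + \<epsilon> / 2)"
      using j_ev[OF e2, of v] by blast
    obtain d2 where d2: "d2 > 0" "\<And>y h. dist y z < d2 \<Longrightarrow> 0 < h \<Longrightarrow> h < d2 \<Longrightarrow> J (y + h *\<^sub>R w) - J y \<le> h * (j w + \<epsilon> / 2)"
      using j_ev[OF e2, of w] by blast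
    define d where "d = min d1 (d2 / (1 + norm v))"
    have nv: "0 < 1 + norm v" by (simp add: add_pos_nonneg)
    have "0 < d2 / (1 + norm v)" using d2(1) nv by (rule divide_pos_pos)
    then have d: "0 < d" "d \<le> d1" using d1(1) by (auto simp: d_def)
    have "d \<le> d2 / (1 + norm v)" by (simp add: d_def)
    then have d3: "d * (1 + norm v) \<le> d2" using pos_le_divide_eq[OF nv] by blast
    show "j (v + w) \<le> j v + j w + \<epsilon>"
    proof (rule j_leI[OF d(1)])
      fix y h assume y: "dist y z < d" and h: "0 < h" "h < d"
      have "dist (y + h *\<^sub>R v) z \<le> dist y z + h * norm v"
        using norm_triangle_ineq[of "y - z" "h *\<^sub>R v"] h by (simp add: dist_norm algebra_simps)
      also have "\<dots> < d * (1 + norm v)"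
        using y h mult_right_mono[of h d "norm v"] by (simp add: algebra_simps)
      finally have "dist (y + h *\<^sub>R v) z < d2" using d3 by simp
      moreover have "d * 1 \<le> d * (1 + norm v)" using d(1) by (intro mult_left_mono) auto
      then have "h < d2" using h d3 by linarith
      ultimately have "J ((y + h *\<^sub>R v) + h *\<^sub>R w) - J (y + h *\<^sub>R v) \<le> h * (j w + \<epsilon> / 2)"
        using h by (intro d2(2)) auto
      moreover have "J (y + h *\<^sub>R v) - J y \<le> h * (j v + \<epsilon> / 2)"
        using y h d by (intro d1(2)) auto
      ultimately show "J (y + h *\<^sub>R (v + w)) - J y \<le> h * (j v + j w + \<epsilon>)"
        by (simp add: algebra_simps)
    qed
  qed
  have j_scale_le: "j (k *\<^sub>R v) \<le> k * j v" if k: "0 < k" for k v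
  proof (rule field_le_epsilon)
    fix \<epsilon> :: real assume "0 < \<epsilon>"
    then have "0 < \<epsilon> / k" using k by simp
    from j_ev[OF this, of v] obtain d where d: "d > 0" "\<And>y h. dist y z < d \<Longrightarrow> 0 < h \<Longrightarrow> h < d \<Longrightarrow> J (y + h *\<^sub>R v) - J y \<le> h * (j v + \<epsilon> / k)"
      by blast
    show "j (k *\<^sub>R v) \<le> k * j v + \<epsilon>"
    proof (rule j_leI[of "min d (d / k)"])
      show "0 < min d (d / k)" using d(1) k by simp
      fix y h assume y: "dist y z < min d (d / k)" and h: "0 < h" "h < min d (d / k)"
      have "h * k < d" using h k by (simp add: pos_less_divide_eq)
      then have "J (y + (h * k) *\<^sub>R v) - J y \<le> (h * k) * (j v + \<epsilon> / k)"
        using y h k by (intro d(2)) auto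
      also have "\<dots> = h * (k * j v + \<epsilon>)" using k by (simp add: algebra_simps)
      finally show "J (y + h *\<^sub>R k *\<^sub>R v) - J y \<le> h * (k * j v + \<epsilon>)" by simp
    qed
  qed
  have j0: "j 0 = 0"
    using j_bound[of 0] L_ge[of 0] by (simp add: Lj)
  have j_scale: "j (k *\<^sub>R v) = k * j v" if "0 \<le> k" for k v
  proof (cases "k = 0")
    case False
    then have k: "0 < k" using that by simp
    have "j v \<le> inverse k * j (k *\<^sub>R v)" using j_scale_le[of "inverse k" "k *\<^sub>R v"] k by simp
    then have "k * j v \<le> k * (inverse k * j (k *\<^sub>R v))" using k by (intro mult_left_mono) auto
    then have "k * j v \<le> j (k *\<^sub>R v)" using k by (simp flip: mult.assoc)
    with j_scale_le[OF k] show ?thesis by (intro antisym)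
  qed (simp add: j0)
  have j_cont: "continuous_on UNIV j"
  proof (rule lipschitz_on_continuous_on[where L = K], rule lipschitz_onI)
    show "0 \<le> K" using lip by (rule lipschitz_on_nonneg)
    fix v w
    have "j v \<le> j w + K * norm (v - w)" using j_add[of w "v - w"] j_bound[of "v - w"] by simp
    moreover have "j w \<le> j v + K * norm (v - w)"
      using j_add[of v "w - v"] j_bound[of "w - v"] by (simp add: norm_minus_commute)
    ultimately show "dist (j v) (j w) \<le> K * dist v w" by (simp add: dist_norm)
  qed
  obtain p where p: "\<And>v. p \<bullet> v \<le> j v" "j w - e / 2 \<le> p \<bullet> w"
    using sublinear_support[of j "e / 2" w] j_add j_scale j_cont e by auto
  have "p \<in> clarke_gradient \<Omega> J z"
    unfolding clarke_gradient_def
  proof (intro CollectI allI)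
    fix v
    have "ereal (p \<bullet> v) \<le> L v" using p(1)[of v] by (simp add: Lj)
    then show "ereal (p \<bullet> v) \<le> Limsup (inf (nhds z \<times>\<^sub>F at_right 0) (principal {(y, h). y \<in> \<Omega> \<and> y + h *\<^sub>R v \<in> \<Omega>}))
        (\<lambda>(y, h). ereal ((J (y + h *\<^sub>R v) - J y) / h))"
      by (simp add: L_def F_def q_def case_prod_beta')
  qed
  moreover have "a - e / 2 \<le> j w"
  proof -
    have "0 < e / 2" using e by simp
    from j_ev[OF this, of w] obtain d where d: "d > 0"
      "\<And>y h. dist y z < d \<Longrightarrow> 0 < h \<Longrightarrow> h < d \<Longrightarrow> J (y + h *\<^sub>R w) - J y \<le> h * (j w + e / 2)" by blast
    obtain y h where yh: "dist y z < d" "0 < h" "h < d" "a \<le> (J (y + h *\<^sub>R w) - J y) / h"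
      using freq[OF d(1)] by blast
    have "(J (y + h *\<^sub>R w) - J y) / h \<le> j w + e / 2"
      using d(2)[OF yh(1-3)] yh(2) by (simp add: field_simps)
    with yh(4) show ?thesis by simp
  qed
  ultimately show ?thesis using p(2) by (intro bexI[of _ p]) auto
qed

section \<open>Trajectories of the control system\<close>

text \<open>Continuity in time and input for each fixed state and a Lipschitz bound in the state that is uniform
  in the other variables imply joint continuity.\<close>

lemma continuous_on_joint:
  fixes h :: "real \<Rightarrow> 'x::real_normed_vector \<Rightarrow> 'u::metric_space \<Rightarrow> 'z::real_normed_vector"
  assumes lip: "\<And>x y t u. t \<in> I \<Longrightarrow> u \<in> U \<Longrightarrow> norm (h t x u - h t y u) \<le> L * norm (x - y)"
    and cont: "\<And>x. continuous_on (I \<times> U) (\<lambda>(t, u). h t x u)"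
  shows "continuous_on (I \<times> UNIV \<times> U) (\<lambda>(t, x, u). h t x u)"
  unfolding continuous_on_iff
proof (intro ballI allI impI)
  fix p :: "real \<times> 'x \<times> 'u" and e :: real
  assume p: "p \<in> I \<times> UNIV \<times> U" and e: "0 < e"
  obtain t x u where [simp]: "p = (t, x, u)" by (cases p)
  have tu: "t \<in> I" "u \<in> U" using p by auto
  have "(t, u) \<in> I \<times> U" "0 < e / 2" using tu e by auto
  from cont[of x, unfolded continuous_on_iff, THEN bspec, OF this(1), THEN spec, THEN mp, OF this(2)]
  obtain d where d0: "d > 0" and d': "\<forall>q\<in>I \<times> U. dist q (t, u) < d \<longrightarrow>
      dist (case q of (t, u) \<Rightarrow> h t x u) (case (t, u) of (t, u) \<Rightarrow> h t x u) < e / 2" by blast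
  have d: "dist (h t' x u') (h t x u) < e / 2"
    if "t' \<in> I" "u' \<in> U" "dist (t', u') (t, u) < d" for t' u'
    using bspec[OF d', of "(t', u')"] that by simp
  define M where "M = \<bar>L\<bar> + 1"
  have M: "M > 0" "L \<le> M" by (auto simp: M_def)
  show "\<exists>d>0. \<forall>p'\<in>I \<times> UNIV \<times> U. dist p' p < d \<longrightarrow>
      dist (case p' of (t, x, u) \<Rightarrow> h t x u) (case p of (t, x, u) \<Rightarrow> h t x u) < e"
  proof (intro exI[of _ "min d (e / (2 * M))"] conjI ballI impI)
    show "0 < min d (e / (2 * M))" using d0 e M by simp
    fix p' assume p': "p' \<in> I \<times> UNIV \<times> U" "dist p' p < min d (e / (2 * M))"
    obtain t' x' u' where [simp]: "p' = (t', x', u')" by (cases p')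
    have tu': "t' \<in> I" "u' \<in> U" using p' by auto
    have 1: "dist (t', u') (t, u) \<le> dist p' p"
      by (simp add: dist_Pair_Pair)
    have 2: "norm (x' - x) \<le> dist p' p"
      using order_trans[OF dist_fst_le[of "snd p'" "snd p"] dist_snd_le[of p' p]] by (simp add: dist_norm)
    have "norm (h t' x' u' - h t' x u') \<le> L * norm (x' - x)" by (rule lip[OF tu'])
    also have "\<dots> \<le> M * norm (x' - x)" using M by (intro mult_right_mono) auto
    also have "\<dots> < M * (e / (2 * M))" using 2 p'(2) M by (intro mult_strict_left_mono) auto
    also have "\<dots> = e / 2" using M by simp
    finally have "dist (h t' x' u') (h t' x u') < e / 2" by (simp add: dist_norm)
    moreover have "dist (h t' x u') (h t x u) < e / 2" using d[OF tu'] 1 p'(2) by simp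
    ultimately have "dist (h t' x' u') (h t x u) < e"
      using dist_triangle[of "h t' x' u'" "h t x u" "h t' x u'"] by simp
    then show "dist (case p' of (t, x, u) \<Rightarrow> h t x u) (case p of (t, x, u) \<Rightarrow> h t x u) < e" by simp
  qed
qed

text \<open>Joint continuity makes the composition with a measurable input and a continuous state measurable.\<close>

lemma integrable_along_trajectory:
  fixes h :: "real \<Rightarrow> 'x::euclidean_space \<Rightarrow> 'u::euclidean_space \<Rightarrow> 'z::euclidean_space"
  assumes h: "continuous_on (I \<times> UNIV \<times> U) (\<lambda>(t, x, u). h t x u)" and I: "{a..b} \<subseteq> I"
    and u: "u \<in> borel_measurable (lebesgue_on {a..b})" "\<And>t. t \<in> {a..b} \<Longrightarrow> u t \<in> U"
    and x: "continuous_on {a..b} x"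
    and bound: "\<And>t. t \<in> {a..b} \<Longrightarrow> norm (h t (x t) (u t)) \<le> M"
  shows "integrable (lebesgue_on {a..b}) (\<lambda>t. h t (x t) (u t))"
    and "(\<lambda>t. h t (x t) (u t)) integrable_on {a..b}"
    and "(LINT t|lebesgue_on {a..b}. h t (x t) (u t)) = integral {a..b} (\<lambda>t. h t (x t) (u t))"
proof -
  have x': "x \<in> borel_measurable (lebesgue_on {a..b})"
    by (rule continuous_imp_measurable_on_sets_lebesgue[OF x]) simp
  have t: "(\<lambda>t. t) \<in> borel_measurable (lebesgue_on {a..b})"
    by (rule continuous_imp_measurable_on_sets_lebesgue) (auto intro: continuous_intros)
  have "(\<lambda>t. (t, x t, u t)) \<in> borel_measurable (lebesgue_on {a..b})"
    by (intro borel_measurable_Pair t x' u(1))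
  then have "(\<lambda>t. (t, x t, u t)) \<in> lebesgue_on {a..b} \<rightarrow>\<^sub>M restrict_space borel (I \<times> UNIV \<times> U)"
    by (rule measurable_restrict_space2[rotated]) (use I u(2) in auto)
  from measurable_compose[OF this borel_measurable_continuous_on_restrict[OF h]]
  have m: "(\<lambda>t. h t (x t) (u t)) \<in> borel_measurable (lebesgue_on {a..b})" by simp
  interpret finite_measure "lebesgue_on {a..b}" by (rule finite_measure_lebesgue_on) simp
  show i: "integrable (lebesgue_on {a..b}) (\<lambda>t. h t (x t) (u t))"
    by (rule integrable_const_bound[OF _ m, of M]) (use bound in auto)
  show "(\<lambda>t. h t (x t) (u t)) integrable_on {a..b}"
    by (rule integrable_on_lebesgue_on[OF i]) simp
  show "(LINT t|lebesgue_on {a..b}. h t (x t) (u t)) = integral {a..b} (\<lambda>t. h t (x t) (u t))"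
    by (rule lebesgue_integral_eq_integral[OF i]) simp
qed

lemma Gronwall:
  fixes w :: "real \<Rightarrow> real"
  assumes ab: "a \<le> b" and w: "continuous_on {a..b} w" and L: "0 \<le> L"
    and le: "\<And>t. t \<in> {a..b} \<Longrightarrow> w t \<le> A + L * integral {a..t} w"
  shows "w b \<le> A * exp (L * (b - a))"
proof -
  define W where "W t = A + L * integral {a..t} w" for t
  have W: "(W has_real_derivative L * w t) (at t within {a..b})" if "t \<in> {a..b}" for t
    unfolding W_def using integral_has_real_derivative[OF w that]
    by (auto intro!: derivative_eq_intros)
  have "exp (- L * (b - a)) * W b \<le> exp (- L * (a - a)) * W a"
  proof (rule DERIV_nonpos_imp_decreasing_open[OF ab])
    have "continuous_on {a..b} W"
      unfolding continuous_on_eq_continuous_within using DERIV_continuous[OF W] by blast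
    then show "continuous_on {a..b} (\<lambda>t. exp (- L * (t - a)) * W t)"
      by (intro continuous_intros)
    fix t assume t: "a < t" "t < b"
    then have "(W has_real_derivative L * w t) (at t)"
      using W[of t] at_within_interior[of t "{a..b}"] by auto
    then have "((\<lambda>t. exp (- L * (t - a)) * W t) has_real_derivative
        exp (- L * (t - a)) * (L * (w t - W t))) (at t)"
      by (auto intro!: derivative_eq_intros simp: algebra_simps)
    moreover have "exp (- L * (t - a)) * (L * (w t - W t)) \<le> 0"
      using le[of t] t L by (intro mult_nonneg_nonpos) (auto simp: W_def)
    ultimately show "\<exists>y. ((\<lambda>t. exp (- L * (t - a)) * W t) has_real_derivative y) (at t) \<and> y \<le> 0" by blast
  qed
  then have "exp (- L * (b - a)) * W b \<le> A" by (simp add: W_def)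
  moreover have "exp (- L * (b - a)) = inverse (exp (L * (b - a)))" by (simp add: exp_minus)
  ultimately have "inverse (exp (L * (b - a))) * W b \<le> A" by simp
  then have "W b / exp (L * (b - a)) \<le> A" by (simp add: divide_inverse mult.commute)
  then have "W b \<le> A * exp (L * (b - a))" by (simp add: pos_divide_le_eq)
  moreover have "w b \<le> W b" using le[of b] ab by (simp add: W_def)
  ultimately show ?thesis by linarith
qed

locale control =
  fixes f :: "real \<Rightarrow> real^'n \<Rightarrow> real^'m \<Rightarrow> real^'n" and U :: "(real^'m) set" and T \<beta>f \<alpha>f :: real
  assumes T: "0 < T" and \<alpha>f: "0 < \<alpha>f" and \<beta>f: "0 < \<beta>f"
    and f_lip: "\<And>x y t u. t \<in> {0..T} \<Longrightarrow> u \<in> U \<Longrightarrow> norm (f t x u - f t y u) \<le> \<alpha>f * norm (x - y)"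
    and f_growth: "\<And>x t u. t \<in> {0..T} \<Longrightarrow> u \<in> U \<Longrightarrow> norm (f t x u) \<le> \<beta>f * (1 + norm x)"
    and f_unif: "\<And>x. uniformly_continuous_on ({0..T} \<times> U) (\<lambda>(t, u). f t x u)"
begin

lemma f_cont: "continuous_on ({0..T} \<times> UNIV \<times> U) (\<lambda>(t, x, u). f t x u)"
proof (rule continuous_on_joint[where h = f and L = \<alpha>f and I = "{0..T}" and U = U])
  show "norm (f t x u - f t y u) \<le> \<alpha>f * norm (x - y)" if "t \<in> {0..T}" "u \<in> U" for x y t u
    using that by (rule f_lip)
  show "continuous_on ({0..T} \<times> U) (\<lambda>(t, u). f t x u)" for x
    by (rule uniformly_continuous_imp_continuous[OF f_unif])
qed

lemma velocity_bounded:
  assumes "continuous_on {a..b} x" "{a..b} \<subseteq> {0..T}" "\<And>t. t \<in> {a..b} \<Longrightarrow> u t \<in> U"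
  shows "\<exists>M\<ge>0. \<forall>t\<in>{a..b}. norm (f t (x t) (u t)) \<le> M"
proof -
  have "bounded (x ` {a..b})"
    by (intro compact_imp_bounded compact_continuous_image assms(1)) simp
  then obtain B where "0 < B" and B': "\<forall>y\<in>x ` {a..b}. norm y \<le> B"
    unfolding bounded_pos by blast
  then have B: "\<And>t. t \<in> {a..b} \<Longrightarrow> norm (x t) \<le> B" "0 \<le> B" by auto
  show ?thesis
  proof (intro exI[of _ "\<beta>f * (1 + B)"] conjI ballI)
    show "0 \<le> \<beta>f * (1 + B)" using \<beta>f B by simp
    fix t assume t: "t \<in> {a..b}"
    have "norm (f t (x t) (u t)) \<le> \<beta>f * (1 + norm (x t))" using assms t by (intro f_growth) auto
    also have "\<dots> \<le> \<beta>f * (1 + B)" using B(1)[OF t] \<beta>f by simp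
    finally show "norm (f t (x t) (u t)) \<le> \<beta>f * (1 + B)" .
  qed
qed

lemma velocity_integrable:
  assumes x: "continuous_on {a..b} x" and ab: "{a..b} \<subseteq> {0..T}"
    and u: "u \<in> borel_measurable (lebesgue_on {a..b})" "\<And>t. t \<in> {a..b} \<Longrightarrow> u t \<in> U"
  shows "(\<lambda>t. f t (x t) (u t)) integrable_on {a..b}"
proof -
  obtain M where M: "\<And>t. t \<in> {a..b} \<Longrightarrow> norm (f t (x t) (u t)) \<le> M"
    using velocity_bounded[where u = u, OF x ab u(2)] by blast
  show ?thesis by (rule integrable_along_trajectory(2)[where h = f and M = M, OF f_cont ab u x M])
qed

lemma admissible_input_subinterval:
  assumes "admissible_input U T s u" "s \<le> a" "b \<le> T"
  shows "u \<in> borel_measurable (lebesgue_on {a..b})" "\<And>t. t \<in> {a..b} \<Longrightarrow> u t \<in> U"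
proof -
  have "u \<in> borel_measurable (lebesgue_on {s..T})" using assms unfolding admissible_input_def by auto
  then show "u \<in> borel_measurable (lebesgue_on {a..b})"
    by (rule measurable_restrict_mono) (use assms in simp)
  show "u t \<in> U" if "t \<in> {a..b}" for t
    using assms that unfolding admissible_input_def by simp
qed

lemma solution_integral:
  assumes adm: "admissible_input U T s u" and sol: "ode_solution (\<lambda>t y. f t y (u t)) s T y x"
    and ab: "0 \<le> s" "s \<le> a" "a \<le> b" "b \<le> T"
  shows "x b - x a = integral {a..b} (\<lambda>t. f t (x t) (u t))"
proof -
  have ac: "abs_cont_on a b x"
    using sol ab unfolding ode_solution_def by (blast intro: abs_cont_on_subinterval)
  have sub: "{a..b} \<subseteq> {0..T}" using ab by auto
  have u: "u \<in> borel_measurable (lebesgue_on {a..b})" "\<And>t. t \<in> {a..b} \<Longrightarrow> u t \<in> U"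
    using admissible_input_subinterval[OF adm ab(2) ab(4)] by auto
  note xc = abs_cont_on_imp_continuous_on[OF ac]
  obtain M where M: "\<And>t. t \<in> {a..b} \<Longrightarrow> norm (f t (x t) (u t)) \<le> M"
    using velocity_bounded[where u = u, OF xc sub u(2)] by blast
  obtain N where N: "negligible N"
    "\<And>t. t \<in> {s..T} - N \<Longrightarrow> (x has_vector_derivative f t (x t) (u t)) (at t within {s..T})"
    using sol unfolding ode_solution_def AE_lebesgue_on_interval_iff by blast
  have "AE t in lebesgue_on {a..b}. (x has_vector_derivative f t (x t) (u t)) (at t within {a..b})"
    unfolding AE_lebesgue_on_interval_iff
  proof (intro exI conjI ballI)
    fix t assume "t \<in> {a..b} - N"
    then have "(x has_vector_derivative f t (x t) (u t)) (at t within {s..T})" using ab by (intro N(2)) auto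
    then show "(x has_vector_derivative f t (x t) (u t)) (at t within {a..b})"
      by (rule has_vector_derivative_within_subset) (use ab in auto)
  qed (rule N(1))
  note der = this
  have int: "(\<lambda>t. f t (x t) (u t)) integrable_on {a..b}"
    by (rule velocity_integrable[where u = u, OF xc sub u])
  show ?thesis
  proof (rule abs_cont_FTC[where \<phi> = "\<lambda>t. f t (x t) (u t)" and M = M])
    show "norm (f t (x t) (u t)) \<le> M" if "t \<in> {a..b}" for t using that by (rule M)
  qed (rule ab(3) ac int der)+
qed

lemma solution_continuous:
  "ode_solution F s T y x \<Longrightarrow> continuous_on {s..T} x"
  unfolding ode_solution_def by (blast intro: abs_cont_on_imp_continuous_on)

lemma solution_growth:
  assumes adm: "admissible_input U T s u" and sol: "ode_solution (\<lambda>t y. f t y (u t)) s T y x"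
    and t: "0 \<le> s" "s \<le> t" "t \<le> T"
  shows "1 + norm (x t) \<le> (1 + norm y) * exp (\<beta>f * (t - s))"
proof -
  have c: "continuous_on {s..t} x" using solution_continuous[OF sol] t by (auto intro: continuous_on_subset)
  show ?thesis
  proof (rule Gronwall[where w = "\<lambda>t. 1 + norm (x t)"])
    show "continuous_on {s..t} (\<lambda>t. 1 + norm (x t))" by (intro continuous_intros c)
    fix r assume r: "r \<in> {s..t}"
    have cr: "continuous_on {s..r} x" using c r by (auto intro: continuous_on_subset)
    have sub: "{s..r} \<subseteq> {0..T}" using r t by auto
    have u: "u \<in> borel_measurable (lebesgue_on {s..r})" "\<And>t. t \<in> {s..r} \<Longrightarrow> u t \<in> U"
      using admissible_input_subinterval[OF adm, of s r] r t by auto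
    have "x r - x s = integral {s..r} (\<lambda>t. f t (x t) (u t))"
      using r t by (intro solution_integral[OF adm sol]) auto
    moreover have "x s = y" using sol by (simp add: ode_solution_def)
    ultimately have "x r = y + integral {s..r} (\<lambda>t. f t (x t) (u t))" by (simp add: algebra_simps)
    then have "norm (x r) \<le> norm y + norm (integral {s..r} (\<lambda>t. f t (x t) (u t)))"
      by (simp add: norm_triangle_ineq)
    also have "norm (integral {s..r} (\<lambda>t. f t (x t) (u t))) \<le> integral {s..r} (\<lambda>t. \<beta>f * (1 + norm (x t)))"
    proof (rule integral_norm_bound_integral)
      show "(\<lambda>t. f t (x t) (u t)) integrable_on {s..r}" by (rule velocity_integrable[where u = u, OF cr sub u])
      show "(\<lambda>t. \<beta>f * (1 + norm (x t))) integrable_on {s..r}"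
        by (intro integrable_continuous_interval continuous_intros cr)
      show "norm (f t (x t) (u t)) \<le> \<beta>f * (1 + norm (x t))" if "t \<in> {s..r}" for t
        using sub u(2)[OF that] that by (intro f_growth) auto
    qed
    finally show "1 + norm (x r) \<le> (1 + norm y) + \<beta>f * integral {s..r} (\<lambda>t. 1 + norm (x t))"
      by simp
  qed (use t \<beta>f in auto)
qed

lemma solution_stability:
  assumes x: "continuous_on {a..b} x" "\<And>t. t \<in> {a..b} \<Longrightarrow> x t - x a = integral {a..t} (\<lambda>t. f t (x t) (u t))"
    and y: "continuous_on {a..b} y" "\<And>t. t \<in> {a..b} \<Longrightarrow> y t - y a = integral {a..t} (\<lambda>t. f t (y t) (u t))"
    and u: "u \<in> borel_measurable (lebesgue_on {a..b})" "\<And>t. t \<in> {a..b} \<Longrightarrow> u t \<in> U"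
    and ab: "0 \<le> a" "a \<le> b" "b \<le> T"
  shows "norm (x b - y b) \<le> norm (x a - y a) * exp (\<alpha>f * (b - a))"
proof (rule Gronwall[where w = "\<lambda>t. norm (x t - y t)"])
  show "continuous_on {a..b} (\<lambda>t. norm (x t - y t))" by (intro continuous_intros x y)
  fix r assume r: "r \<in> {a..b}"
  have cr: "continuous_on {a..r} x" "continuous_on {a..r} y"
    using x(1) y(1) r by (auto intro: continuous_on_subset)
  have sub: "{a..r} \<subseteq> {0..T}" using r ab by auto
  have ur: "u \<in> borel_measurable (lebesgue_on {a..r})"
    by (rule measurable_restrict_mono[OF u(1)]) (use r in simp)
  have ur2: "u t \<in> U" if "t \<in> {a..r}" for t using u(2)[of t] that r by simp
  have ix: "(\<lambda>t. f t (x t) (u t)) integrable_on {a..r}"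
    by (rule velocity_integrable[where u = u, OF cr(1) sub ur ur2])
  have iy: "(\<lambda>t. f t (y t) (u t)) integrable_on {a..r}"
    by (rule velocity_integrable[where u = u, OF cr(2) sub ur ur2])
  have "integral {a..r} (\<lambda>t. f t (x t) (u t) - f t (y t) (u t)) =
      integral {a..r} (\<lambda>t. f t (x t) (u t)) - integral {a..r} (\<lambda>t. f t (y t) (u t))"
    by (rule Henstock_Kurzweil_Integration.integral_diff[OF ix iy])
  then have "x r - y r = (x a - y a) + integral {a..r} (\<lambda>t. f t (x t) (u t) - f t (y t) (u t))"
    using x(2)[OF r] y(2)[OF r] by (simp add: algebra_simps)
  then have "norm (x r - y r) \<le> norm (x a - y a) + norm (integral {a..r} (\<lambda>t. f t (x t) (u t) - f t (y t) (u t)))"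
    by (simp add: norm_triangle_ineq)
  also have "norm (integral {a..r} (\<lambda>t. f t (x t) (u t) - f t (y t) (u t))) \<le> integral {a..r} (\<lambda>t. \<alpha>f * norm (x t - y t))"
  proof (rule integral_norm_bound_integral)
    show "(\<lambda>t. f t (x t) (u t) - f t (y t) (u t)) integrable_on {a..r}" by (intro integrable_diff ix iy)
    show "(\<lambda>t. \<alpha>f * norm (x t - y t)) integrable_on {a..r}"
      by (intro integrable_continuous_interval continuous_intros cr)
    show "norm (f t (x t) (u t) - f t (y t) (u t)) \<le> \<alpha>f * norm (x t - y t)" if "t \<in> {a..r}" for t
      using sub ur2[OF that] that by (intro f_lip) auto
  qed
  finally show "norm (x r - y r) \<le> norm (x a - y a) + \<alpha>f * integral {a..r} (\<lambda>t. norm (x t - y t))"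
    by simp
qed (use ab \<alpha>f in auto)

text \<open>Existence in the sense of Caratheodory for a measurable input. For the unknown \<open>z t = x t / e t\<close> with
  \<open>e t = exp (2 * \<alpha>f * (t - s))\<close>, the integral equation becomes a fixed-point equation on bounded
  continuous functions whose operator \<open>\<Phi>\<close> contracts by the factor \<open>1 / 2\<close>, on the whole interval at once.
  The operator is defined on the real line by freezing its values outside \<open>{s..T}\<close>.\<close>

lemma solution_exists:
  assumes adm: "admissible_input U T s u" and s: "0 \<le> s" "s \<le> T"
  shows "\<exists>x. ode_solution (\<lambda>t y. f t y (u t)) s T y x"
proof -
  have u: "u \<in> borel_measurable (lebesgue_on {s..T})" "\<And>t. t \<in> {s..T} \<Longrightarrow> u t \<in> U"
    using admissible_input_subinterval[OF adm, of s T] by auto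
  have sub: "{s..T} \<subseteq> {0..T}" using s by auto
  define cl where "cl t = max s (min T t)" for t
  have cl: "cl t \<in> {s..T}" for t using s by (auto simp: cl_def)
  have cl_id: "cl t = t" if "t \<in> {s..T}" for t using that by (auto simp: cl_def)
  have cl_cont: "continuous_on A cl" for A unfolding cl_def[abs_def] by (intro continuous_intros)
  define e where "e t = exp (2 * \<alpha>f * (t - s))" for t
  have epos: "0 < e t" for t by (simp add: e_def)
  have econt: "continuous_on A e" for A unfolding e_def[abs_def] by (intro continuous_intros)
  define v where "v z = (\<lambda>t. f t (e t *\<^sub>R apply_bcontfun z t) (u t))" for z :: "real \<Rightarrow>\<^sub>C (real^'n)"
  define \<Phi> where "\<Phi> z t = (1 / e (cl t)) *\<^sub>R (y + integral {s..cl t} (v z))" for z t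
  have zc: "continuous_on A (\<lambda>t. e t *\<^sub>R apply_bcontfun z t)" for z :: "real \<Rightarrow>\<^sub>C (real^'n)" and A
    by (intro continuous_on_scaleR econt continuous_on_apply_bcontfun)
  have vint: "v z integrable_on {s..T}" for z
    unfolding v_def by (rule velocity_integrable[where u = u, OF zc sub u])
  have icont: "continuous_on {s..T} (\<lambda>t. integral {s..t} (v z))" for z
    by (rule indefinite_integral_continuous_1[OF vint])
  have gcont: "continuous_on {s..T} (\<lambda>t. (1 / e t) *\<^sub>R (y + integral {s..t} (v z)))" for z
    by (intro continuous_intros icont econt) (use epos in \<open>auto simp: less_imp_neq[THEN not_sym]\<close>)
  have \<Phi>b: "\<Phi> z \<in> bcontfun" for z
    unfolding bcontfun_def
  proof (intro CollectI conjI)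
    show "continuous_on UNIV (\<Phi> z)"
      unfolding \<Phi>_def[abs_def] by (rule continuous_on_compose2[OF gcont cl_cont]) (use cl in auto)
    have "bounded ((\<lambda>t. (1 / e t) *\<^sub>R (y + integral {s..t} (v z))) ` {s..T})"
      by (intro compact_imp_bounded compact_continuous_image gcont) simp
    then show "bounded (range (\<Phi> z))"
      by (rule bounded_subset) (use cl in \<open>auto simp: \<Phi>_def\<close>)
  qed
  have contr: "dist (Bcontfun (\<Phi> z)) (Bcontfun (\<Phi> z')) \<le> 1 / 2 * dist z z'" for z z'
  proof (rule dist_bound)
    fix t
    define r where "r = cl t"
    have r: "r \<in> {s..T}" unfolding r_def by (rule cl)
    have iz: "v z integrable_on {s..r}" for z
      by (rule integrable_subinterval_real[OF vint]) (use r in auto)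
    have eint: "(e has_integral (e r - e s) / (2 * \<alpha>f)) {s..r}"
    proof -
      have "(e has_integral e r / (2 * \<alpha>f) - e s / (2 * \<alpha>f)) {s..r}"
      proof (rule fundamental_theorem_of_calculus)
        fix q
        have "((\<lambda>t. e t / (2 * \<alpha>f)) has_real_derivative e q) (at q within {s..r})"
          unfolding e_def using \<alpha>f by (auto intro!: derivative_eq_intros)
        then show "((\<lambda>t. e t / (2 * \<alpha>f)) has_vector_derivative e q) (at q within {s..r})"
          by (simp add: has_real_derivative_iff_has_vector_derivative)
      qed (use r in auto)
      then show ?thesis by (simp add: diff_divide_distrib)
    qed
    have "\<Phi> z t - \<Phi> z' t = (1 / e r) *\<^sub>R (integral {s..r} (v z) - integral {s..r} (v z'))"
      by (simp add: \<Phi>_def r_def[symmetric] flip: scaleR_diff_right)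
    also have "integral {s..r} (v z) - integral {s..r} (v z') = integral {s..r} (\<lambda>q. v z q - v z' q)"
      by (rule Henstock_Kurzweil_Integration.integral_diff[OF iz iz, symmetric])
    finally have 1: "dist (\<Phi> z t) (\<Phi> z' t) = (1 / e r) * norm (integral {s..r} (\<lambda>q. v z q - v z' q))"
      using epos[of r] by (simp add: dist_norm)
    have "norm (integral {s..r} (\<lambda>q. v z q - v z' q)) \<le> integral {s..r} (\<lambda>q. \<alpha>f * dist z z' * e q)"
    proof (rule integral_norm_bound_integral)
      show "(\<lambda>q. v z q - v z' q) integrable_on {s..r}" by (intro integrable_diff iz)
      show "(\<lambda>q. \<alpha>f * dist z z' * e q) integrable_on {s..r}"
        by (intro integrable_continuous_interval continuous_intros econt)
      fix q assume q: "q \<in> {s..r}"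
      have "norm (v z q - v z' q) \<le> \<alpha>f * norm (e q *\<^sub>R apply_bcontfun z q - e q *\<^sub>R apply_bcontfun z' q)"
        unfolding v_def using q r sub u(2) by (intro f_lip) auto
      also have "\<dots> = \<alpha>f * e q * dist (apply_bcontfun z q) (apply_bcontfun z' q)"
        using epos[of q] by (simp add: dist_norm flip: scaleR_diff_right)
      also have "\<dots> \<le> \<alpha>f * e q * dist z z'"
        using epos[of q] \<alpha>f dist_bounded[of z q z'] by (intro mult_left_mono) auto
      finally show "norm (v z q - v z' q) \<le> \<alpha>f * dist z z' * e q" by (simp add: mult_ac)
    qed
    also have "integral {s..r} (\<lambda>q. \<alpha>f * dist z z' * e q) = \<alpha>f * dist z z' * ((e r - e s) / (2 * \<alpha>f))"
      using integral_unique[OF eint] by simp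
    also have "\<dots> = dist z z' * (e r - 1) / 2" using \<alpha>f by (simp add: e_def)
    finally have "(1 / e r) * norm (integral {s..r} (\<lambda>q. v z q - v z' q)) \<le> (1 / e r) * (dist z z' * (e r - 1) / 2)"
      using epos[of r] by (intro mult_left_mono) auto
    also have "\<dots> = 1 / 2 * dist z z' * ((e r - 1) / e r)" by simp
    also have "\<dots> \<le> 1 / 2 * dist z z' * 1"
      using epos[of r] by (intro mult_left_mono) auto
    finally have "dist (\<Phi> z t) (\<Phi> z' t) \<le> 1 / 2 * dist z z'" using 1 by simp
    then show "dist (apply_bcontfun (Bcontfun (\<Phi> z)) t) (apply_bcontfun (Bcontfun (\<Phi> z')) t) \<le> 1 / 2 * dist z z'"
      by (simp add: Bcontfun_inverse[OF \<Phi>b])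
  qed
  have "\<exists>!z. Bcontfun (\<Phi> z) = z"
    by (rule banach_fix_type[where c = "1 / 2"]) (use contr in auto)
  then obtain z where "Bcontfun (\<Phi> z) = z" by blast
  then have z: "apply_bcontfun z t = \<Phi> z t" for t
    using Bcontfun_inverse[OF \<Phi>b] by metis
  define x where "x t = e t *\<^sub>R apply_bcontfun z t" for t
  have vx: "v z = (\<lambda>t. f t (x t) (u t))" by (simp add: v_def x_def)
  have x: "x t = y + integral {s..t} (\<lambda>t. f t (x t) (u t))" if "t \<in> {s..T}" for t
    using epos[of t] by (simp add: z \<Phi>_def cl_id[OF that] x_def[of t] flip: vx)
  have xc: "continuous_on {s..T} x" unfolding x_def[abs_def] by (rule zc)
  obtain M where M: "\<And>t. t \<in> {s..T} \<Longrightarrow> norm (f t (x t) (u t)) \<le> M"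
    using velocity_bounded[where u = u, OF xc sub u(2)] by blast
  note int = velocity_integrable[where u = u, OF xc sub u]
  show ?thesis
    unfolding ode_solution_def
  proof (intro exI[of _ x] conjI)
    show "abs_cont_on s T x"
    proof (rule abs_cont_on_lipschitz)
      fix a b assume ab: "s \<le> a" "a \<le> b" "b \<le> T"
      then have "x b - x a = integral {s..b} (\<lambda>t. f t (x t) (u t)) - integral {s..a} (\<lambda>t. f t (x t) (u t))"
        by (subst (1 2) x) auto
      then show "norm (x b - x a) \<le> M * (b - a)"
        using norm_integral_diff_le[where f = "\<lambda>t. f t (x t) (u t)", OF int M ab] by simp
    qed
    show "x s = y" using x[of s] s by simp
    obtain N where N: "negligible N" "\<And>t. t \<in> {s..T} - N \<Longrightarrow>
      ((\<lambda>t. integral {s..t} (\<lambda>t. f t (x t) (u t))) has_vector_derivative f t (x t) (u t)) (at t within {s..T})"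
      using Lebesgue_differentiation_interval[OF int] by metis
    show "AE t in lebesgue_on {s..T}. (x has_vector_derivative f t (x t) (u t)) (at t within {s..T})"
      unfolding AE_lebesgue_on_interval_iff
    proof (intro exI conjI ballI)
      fix t assume t: "t \<in> {s..T} - N"
      have "((\<lambda>t. y + integral {s..t} (\<lambda>t. f t (x t) (u t))) has_vector_derivative 0 + f t (x t) (u t)) (at t within {s..T})"
        by (intro has_vector_derivative_add has_vector_derivative_const N(2)[OF t])
      then have "((\<lambda>t. y + integral {s..t} (\<lambda>t. f t (x t) (u t))) has_vector_derivative f t (x t) (u t)) (at t within {s..T})"
        by simp
      then show "(x has_vector_derivative f t (x t) (u t)) (at t within {s..T})"
        by (rule has_vector_derivative_transform[rotated 2]) (use t x in auto)
    qed (rule N(1))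
  qed
qed

end

section \<open>The value function\<close>

locale optimal_control = control f U T \<beta>f \<alpha>f
  for f :: "real \<Rightarrow> real^'n \<Rightarrow> real^'m \<Rightarrow> real^'n" and U T \<beta>f \<alpha>f +
  fixes c :: "real \<Rightarrow> real^'n \<Rightarrow> real^'m \<Rightarrow> real" and g :: "real^'n \<Rightarrow> real" and \<alpha>c \<alpha>g \<beta>c \<beta>g :: real
  assumes \<alpha>c: "0 < \<alpha>c" and \<alpha>g: "0 < \<alpha>g" and \<beta>c: "0 < \<beta>c" and \<beta>g: "0 < \<beta>g"
    and U_nonempty: "U \<noteq> {}"
    and c_lip: "\<And>x y t u. t \<in> {0..T} \<Longrightarrow> u \<in> U \<Longrightarrow> \<bar>c t x u - c t y u\<bar> \<le> \<alpha>c * norm (x - y)"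
    and g_lip: "\<And>x y. \<bar>g x - g y\<bar> \<le> \<alpha>g * norm (x - y)"
    and c_growth: "\<And>x t u. t \<in> {0..T} \<Longrightarrow> u \<in> U \<Longrightarrow> \<bar>c t x u\<bar> \<le> \<beta>c * (1 + norm x)"
    and g_growth: "\<And>x. \<bar>g x\<bar> \<le> \<beta>g * (1 + norm x)"
    and c_unif: "\<And>x. uniformly_continuous_on ({0..T} \<times> U) (\<lambda>(t, u). c t x u)"
begin

definition trajectory :: "real \<Rightarrow> real^'n \<Rightarrow> (real \<Rightarrow> real^'m) \<Rightarrow> (real \<Rightarrow> real^'n) \<Rightarrow> bool" where
  "trajectory s y u x \<longleftrightarrow> admissible_input U T s u \<and> ode_solution (\<lambda>t y. f t y (u t)) s T y x"

abbreviation V :: "real \<Rightarrow> real^'n \<Rightarrow> real" where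
  "V \<equiv> value_function c g f U T"

text \<open>A bound for \<open>1 + norm (x t)\<close> along every trajectory \<open>x\<close> from \<open>y\<close>, whatever the starting time.\<close>

definition growth_bound :: "real^'n \<Rightarrow> real" where
  "growth_bound y = (1 + norm y) * exp (\<beta>f * T)"

lemma growth_bound_pos: "0 < growth_bound y"
  unfolding growth_bound_def by (intro mult_pos_pos add_pos_nonneg) auto

lemma growth_bound_mono: "norm y \<le> norm y' \<Longrightarrow> growth_bound y \<le> growth_bound y'"
  unfolding growth_bound_def by (intro mult_right_mono) auto

lemma c_cont: "continuous_on ({0..T} \<times> UNIV \<times> U) (\<lambda>(t, x, u). c t x u)"
proof (rule continuous_on_joint[where h = c and L = \<alpha>c and I = "{0..T}" and U = U])
  show "norm (c t x u - c t y u) \<le> \<alpha>c * norm (x - y)" if "t \<in> {0..T}" "u \<in> U" for x y t u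
    using c_lip[OF that] by simp
  show "continuous_on ({0..T} \<times> U) (\<lambda>(t, u). c t x u)" for x
    by (rule uniformly_continuous_imp_continuous[OF c_unif])
qed

lemma trajectory_start: "trajectory s y u x \<Longrightarrow> x s = y"
  by (simp add: trajectory_def ode_solution_def)

lemma trajectory_continuous:
  "trajectory s y u x \<Longrightarrow> s \<le> a \<Longrightarrow> b \<le> T \<Longrightarrow> continuous_on {a..b} x"
  unfolding trajectory_def by (rule continuous_on_subset[OF solution_continuous]) auto

lemma trajectory_input:
  assumes "trajectory s y u x" "s \<le> a" "b \<le> T"
  shows "u \<in> borel_measurable (lebesgue_on {a..b})" "\<And>t. t \<in> {a..b} \<Longrightarrow> u t \<in> U"
  using admissible_input_subinterval[of s u a b] assms by (auto simp: trajectory_def)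

lemma trajectory_bound:
  assumes tr: "trajectory s y u x" and t: "0 \<le> s" "s \<le> t" "t \<le> T"
  shows "1 + norm (x t) \<le> growth_bound y"
proof -
  have "1 + norm (x t) \<le> (1 + norm y) * exp (\<beta>f * (t - s))"
    using tr t unfolding trajectory_def by (intro solution_growth) auto
  also have "\<dots> \<le> growth_bound y"
    unfolding growth_bound_def using t \<beta>f by (intro mult_left_mono) auto
  finally show ?thesis .
qed

lemma trajectory_increment:
  assumes tr: "trajectory s y u x" and ab: "0 \<le> s" "s \<le> a" "a \<le> b" "b \<le> T"
  shows "(\<lambda>t. f t (x t) (u t)) integrable_on {a..b}"
    and "x b - x a = integral {a..b} (\<lambda>t. f t (x t) (u t))"
    and "norm (x b - x a) \<le> \<beta>f * growth_bound y * (b - a)"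
proof -
  have sub: "{a..b} \<subseteq> {0..T}" using ab by auto
  note u = trajectory_input[OF tr ab(2,4)]
  show int: "(\<lambda>t. f t (x t) (u t)) integrable_on {a..b}"
    by (rule velocity_integrable[where u = u, OF trajectory_continuous[OF tr ab(2,4)] sub u])
  show eq: "x b - x a = integral {a..b} (\<lambda>t. f t (x t) (u t))"
    using tr ab unfolding trajectory_def by (intro solution_integral) auto
  have "norm (f t (x t) (u t)) \<le> \<beta>f * growth_bound y" if t: "t \<in> {a..b}" for t
  proof -
    have "norm (f t (x t) (u t)) \<le> \<beta>f * (1 + norm (x t))"
      using sub t u(2)[OF t] by (intro f_growth) auto
    also have "\<dots> \<le> \<beta>f * growth_bound y"
      using \<beta>f trajectory_bound[OF tr, of t] t ab by (intro mult_left_mono) auto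
    finally show ?thesis .
  qed
  then show "norm (x b - x a) \<le> \<beta>f * growth_bound y * (b - a)"
    using norm_integral_diff_le[where f = "\<lambda>t. f t (x t) (u t)" and a = a and b = b and s = a and t = b
      and M = "\<beta>f * growth_bound y", OF int] ab eq by simp
qed

lemma running_cost:
  assumes tr: "trajectory s y u x" and ab: "0 \<le> s" "s \<le> a" "a \<le> b" "b \<le> T"
  shows "(\<lambda>t. c t (x t) (u t)) integrable_on {a..b}"
    and "(LINT t|lebesgue_on {a..b}. c t (x t) (u t)) = integral {a..b} (\<lambda>t. c t (x t) (u t))"
    and "\<And>t. t \<in> {a..b} \<Longrightarrow> \<bar>c t (x t) (u t)\<bar> \<le> \<beta>c * growth_bound y"
    and "\<bar>integral {a..b} (\<lambda>t. c t (x t) (u t))\<bar> \<le> \<beta>c * growth_bound y * (b - a)"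
proof -
  have sub: "{a..b} \<subseteq> {0..T}" using ab by auto
  note u = trajectory_input[OF tr ab(2,4)]
  show bound: "\<bar>c t (x t) (u t)\<bar> \<le> \<beta>c * growth_bound y" if t: "t \<in> {a..b}" for t
  proof -
    have "\<bar>c t (x t) (u t)\<bar> \<le> \<beta>c * (1 + norm (x t))"
      using sub t u(2)[OF t] by (intro c_growth) auto
    also have "\<dots> \<le> \<beta>c * growth_bound y"
      using \<beta>c trajectory_bound[OF tr, of t] t ab by (intro mult_left_mono) auto
    finally show ?thesis .
  qed
  then have bound': "norm (c t (x t) (u t)) \<le> \<beta>c * growth_bound y" if "t \<in> {a..b}" for t
    using that by simp
  show int: "(\<lambda>t. c t (x t) (u t)) integrable_on {a..b}"
    and "(LINT t|lebesgue_on {a..b}. c t (x t) (u t)) = integral {a..b} (\<lambda>t. c t (x t) (u t))"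
    using integrable_along_trajectory(2,3)[where h = c and u = u and x = x,
      OF c_cont sub u trajectory_continuous[OF tr ab(2,4)] bound'] by auto
  show "\<bar>integral {a..b} (\<lambda>t. c t (x t) (u t))\<bar> \<le> \<beta>c * growth_bound y * (b - a)"
    using norm_integral_diff_le[where f = "\<lambda>t. c t (x t) (u t)" and a = a and b = b and s = a and t = b
      and M = "\<beta>c * growth_bound y", OF int] ab bound' by simp
qed

lemma cost_eq:
  assumes "trajectory s y u x" "0 \<le> s" "s \<le> T"
  shows "cost c g T s u x = integral {s..T} (\<lambda>t. c t (x t) (u t)) + g (x T)"
  using running_cost(2)[OF assms(1,2), of s T] assms by (simp add: cost_def)

lemma trajectory_exists:
  assumes "0 \<le> s" "s \<le> T"
  shows "\<exists>u x. trajectory s y u x"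
proof -
  obtain u0 where u0: "u0 \<in> U" using U_nonempty by blast
  then have "admissible_input U T s (\<lambda>t. u0)" by (simp add: admissible_input_def)
  from solution_exists[OF this assms] this show ?thesis unfolding trajectory_def by blast
qed

lemma value_set_eq:
  "value_function c g f U T s y = Inf {cost c g T s u x | u x. trajectory s y u x}"
  by (simp add: value_function_def trajectory_def)

lemma value_le_cost:
  assumes tr: "trajectory s y u x" and s: "0 \<le> s" "s \<le> T"
  shows "V s y \<le> cost c g T s u x"
  unfolding value_set_eq
proof (rule cInf_lower)
  show "bdd_below {cost c g T s u x | u x. trajectory s y u x}"
  proof (rule bdd_belowI)
    fix r assume "r \<in> {cost c g T s u x | u x. trajectory s y u x}"
    then obtain u x where r: "r = cost c g T s u x" and tr: "trajectory s y u x" by blast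
    have "\<bar>g (x T)\<bar> \<le> \<beta>g * growth_bound y"
      using order_trans[OF g_growth mult_left_mono[OF trajectory_bound[OF tr s(1) s(2) order_refl]]] \<beta>g by simp
    then show "- (\<beta>c * growth_bound y * (T - s)) - \<beta>g * growth_bound y \<le> r"
      using running_cost(4)[OF tr s(1) order_refl s(2) order_refl] by (simp add: r cost_eq[OF tr s])
  qed
qed (use tr in blast)

lemma near_optimal_trajectory:
  assumes s: "0 \<le> s" "s \<le> T" and e: "0 < e"
  shows "\<exists>u x. trajectory s y u x \<and> cost c g T s u x < V s y + e"
proof -
  have "Inf {cost c g T s u x | u x. trajectory s y u x} < V s y + e"
    using e by (simp add: value_set_eq)
  note less = this
  have "{cost c g T s u x | u x. trajectory s y u x} \<noteq> {}"
    using trajectory_exists[OF s] by blast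
  from cInf_lessD[OF this less] show ?thesis by blast
qed

lemma value_at_final_time: "V T y = g y"
proof -
  have "cost c g T T u x = g y" if "trajectory T y u x" for u x
    using cost_eq[OF that] trajectory_start[OF that] T by simp
  moreover obtain u x where "trajectory T y u x" using trajectory_exists[of T y] T by auto
  ultimately have "{cost c g T T u x | u x. trajectory T y u x} = {g y}"
    by (intro set_eqI) (simp, metis)
  then show ?thesis by (simp add: value_set_eq)
qed

lemma trajectory_restrict:
  assumes tr: "trajectory s y u x" and r: "s \<le> r" "r \<le> T"
  shows "trajectory r (x r) u x"
  unfolding trajectory_def admissible_input_def ode_solution_def AE_lebesgue_on_interval_iff
proof (intro conjI)
  show "u \<in> borel_measurable (lebesgue_on {r..T})" "\<forall>t\<in>{r..T}. u t \<in> U"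
    using trajectory_input[OF tr r(1), of T] by auto
  show "abs_cont_on r T x"
    using tr r unfolding trajectory_def ode_solution_def by (blast intro: abs_cont_on_subinterval)
  obtain N where N: "negligible N"
    "\<And>t. t \<in> {s..T} - N \<Longrightarrow> (x has_vector_derivative f t (x t) (u t)) (at t within {s..T})"
    using tr unfolding trajectory_def ode_solution_def AE_lebesgue_on_interval_iff by blast
  show "\<exists>N. negligible N \<and> (\<forall>t\<in>{r..T} - N. (x has_vector_derivative f t (x t) (u t)) (at t within {r..T}))"
  proof (intro exI conjI ballI)
    fix t assume "t \<in> {r..T} - N"
    then have "(x has_vector_derivative f t (x t) (u t)) (at t within {s..T})" using r by (intro N(2)) auto
    then show "(x has_vector_derivative f t (x t) (u t)) (at t within {r..T})"
      by (rule has_vector_derivative_within_subset) (use r in auto)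
  qed (rule N(1))
qed simp

text \<open>The half of the dynamic programming principle that holds by restriction: the tail of a nearly
  optimal trajectory is itself a competitor from its starting point.\<close>

lemma dynamic_programming_ge:
  assumes s: "0 \<le> s" "s \<le> r" "r \<le> T" and e: "0 < e"
  shows "\<exists>u x. trajectory s y u x \<and> integral {s..r} (\<lambda>t. c t (x t) (u t)) + V r (x r) < V s y + e"
proof -
  obtain u x where tr: "trajectory s y u x" and le: "cost c g T s u x < V s y + e"
    using near_optimal_trajectory[of s e y] s e by auto
  have tr': "trajectory r (x r) u x" by (rule trajectory_restrict[OF tr s(2,3)])
  have "integral {s..r} (\<lambda>t. c t (x t) (u t)) + integral {r..T} (\<lambda>t. c t (x t) (u t))
      = integral {s..T} (\<lambda>t. c t (x t) (u t))"
    using s running_cost(1)[OF tr, of s T] by (intro Henstock_Kurzweil_Integration.integral_combine) auto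
  moreover have "V r (x r) \<le> integral {r..T} (\<lambda>t. c t (x t) (u t)) + g (x T)"
    using value_le_cost[OF tr'] cost_eq[OF tr'] s by simp
  moreover have "cost c g T s u x = integral {s..T} (\<lambda>t. c t (x t) (u t)) + g (x T)"
    using cost_eq[OF tr] s by simp
  ultimately show ?thesis using tr le by (intro exI[of _ u] exI[of _ x]) auto
qed

text \<open>Let \<open>u'\<close> be nearly optimal from \<open>(s', y')\<close>. Extend it to earlier times, if \<open>s < s'\<close>, by a constant
  input, and run it from \<open>(s, y)\<close>. The two trajectories are close at the later \<open>m\<close> of the two starting
  times, because speeds are bounded, and remain close afterwards, because they share the input.
  Outside \<open>{m..T}\<close> the running costs are bounded and act for a time \<open>\<bar>s - s'\<bar>\<close> only. The state \<open>v\<close>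
  serves as a common bound for the size of both initial states.\<close>

lemma value_le_value:
  assumes s: "s \<in> {0..T}" and s': "s' \<in> {0..T}" and y: "norm y \<le> norm v" "norm y' \<le> norm v"
  shows "V s y \<le> V s' y' + (\<beta>c * growth_bound v + (\<alpha>c * T + \<alpha>g) * exp (\<alpha>f * T) * (1 + \<beta>f * growth_bound v))
    * (\<bar>s - s'\<bar> + norm (y - y'))"
proof (rule field_le_epsilon)
  fix e :: real assume e: "0 < e"
  define K where "K = growth_bound v"
  have K: "0 < K" "growth_bound y \<le> K" "growth_bound y' \<le> K"
    using growth_bound_mono[OF y(1)] growth_bound_mono[OF y(2)] growth_bound_pos[of v] by (auto simp: K_def)
  obtain u' x' where tr': "trajectory s' y' u' x'" and le: "cost c g T s' u' x' < V s' y' + e"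
    using near_optimal_trajectory[of s' e y'] s' e by auto
  obtain u0 where u0: "u0 \<in> U" using U_nonempty by blast
  define u where "u t = (if t \<in> {s'..T} then u' t else u0)" for t
  have "(\<lambda>t. if t \<in> {s'..T} then u' t else 0) \<in> borel_measurable lebesgue"
    using trajectory_input(1)[OF tr' order_refl order_refl] by (rule borel_measurable_if_I) simp
  from measurable_If_set[OF this, of "\<lambda>_. u0" "{s'..T}"]
  have "(\<lambda>t. if t \<in> {s'..T} then if t \<in> {s'..T} then u' t else 0 else u0) \<in> borel_measurable lebesgue" by simp
  moreover have "(\<lambda>t. if t \<in> {s'..T} then if t \<in> {s'..T} then u' t else 0 else u0) = u"
    by (simp add: u_def fun_eq_iff)
  ultimately have "u \<in> borel_measurable (lebesgue_on {s..T})"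
    by (simp add: measurable_restrict_space1)
  moreover have "u t \<in> U" for t
    using u0 trajectory_input(2)[OF tr' order_refl order_refl, of t] by (simp add: u_def)
  ultimately have adm: "admissible_input U T s u" by (simp add: admissible_input_def)
  obtain x where "ode_solution (\<lambda>t y. f t y (u t)) s T y x"
    using solution_exists[OF adm] s by auto
  with adm have tr: "trajectory s y u x" by (simp add: trajectory_def)
  define m where "m = max s s'"
  have m: "s \<le> m" "s' \<le> m" "m \<le> T" "0 \<le> m" "(m - s) + (m - s') = \<bar>s - s'\<bar>" "0 \<le> s" "0 \<le> s'"
    using s s' by (auto simp: m_def)
  have uu': "u t = u' t" if "t \<in> {m..T}" for t using that m by (simp add: u_def)
  define \<delta> where "\<delta> = \<bar>s - s'\<bar> + norm (y - y')"
  have \<delta>: "0 \<le> \<delta>" "\<bar>s - s'\<bar> \<le> \<delta>" "norm (y - y') \<le> \<delta>" by (auto simp: \<delta>_def)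
  define D where "D = (1 + \<beta>f * K) * \<delta>"
  have xm: "norm (x m - x' m) \<le> D"
  proof -
    have "\<beta>f * growth_bound y * (m - s) \<le> \<beta>f * K * (m - s)"
      using m K \<beta>f by (intro mult_right_mono mult_left_mono) auto
    then have 1: "norm (x m - y) \<le> \<beta>f * K * (m - s)"
      using trajectory_increment(3)[OF tr, of s m] trajectory_start[OF tr] m by simp
    have "\<beta>f * growth_bound y' * (m - s') \<le> \<beta>f * K * (m - s')"
      using m K \<beta>f by (intro mult_right_mono mult_left_mono) auto
    then have 2: "norm (x' m - y') \<le> \<beta>f * K * (m - s')"
      using trajectory_increment(3)[OF tr', of s' m] trajectory_start[OF tr'] m by simp
    have "x m - x' m = (x m - y) + (y - y') - (x' m - y')" by simp
    then have "norm (x m - x' m) = norm ((x m - y) + (y - y') - (x' m - y'))" by (rule arg_cong)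
    also have "\<dots> \<le> norm ((x m - y) + (y - y')) + norm (x' m - y')" by (rule norm_triangle_ineq4)
    also have "\<dots> \<le> norm (x m - y) + norm (y - y') + norm (x' m - y')"
      by (intro add_right_mono norm_triangle_ineq)
    also have "\<dots> \<le> norm (y - y') + \<beta>f * K * ((m - s) + (m - s'))"
      using 1 2 by (simp add: algebra_simps)
    also have "\<dots> \<le> \<delta> + \<beta>f * K * \<delta>"
      unfolding m(5) using \<delta> \<beta>f K by (intro add_mono mult_left_mono) auto
    finally show ?thesis by (simp add: D_def algebra_simps)
  qed
  have D: "0 \<le> D" using \<delta> K \<beta>f by (simp add: D_def)
  define G where "G = exp (\<alpha>f * T)"
  have G: "0 < G" by (simp add: G_def)
  have close: "norm (x t - x' t) \<le> D * G" if t: "t \<in> {m..T}" for t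
  proof -
    have "norm (x t - x' t) \<le> norm (x m - x' m) * exp (\<alpha>f * (t - m))"
    proof (rule solution_stability[where u = u])
      show "continuous_on {m..t} x" "continuous_on {m..t} x'"
        using trajectory_continuous[OF tr m(1)] trajectory_continuous[OF tr' m(2)] t by auto
      fix r assume r: "r \<in> {m..t}"
      show "x r - x m = integral {m..r} (\<lambda>t. f t (x t) (u t))"
        using r t m by (intro trajectory_increment(2)[OF tr]) auto
      have "x' r - x' m = integral {m..r} (\<lambda>t. f t (x' t) (u' t))"
        using r t m by (intro trajectory_increment(2)[OF tr']) auto
      also have "\<dots> = integral {m..r} (\<lambda>t. f t (x' t) (u t))"
        using uu' r t by (intro Henstock_Kurzweil_Integration.integral_cong) auto
      finally show "x' r - x' m = integral {m..r} (\<lambda>t. f t (x' t) (u t))" .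
      show "u r \<in> U" using trajectory_input(2)[OF tr m(1), of t r] r t by simp
    next
      show "u \<in> borel_measurable (lebesgue_on {m..t})"
        using trajectory_input(1)[OF tr m(1), of t] t by simp
    qed (use m t in auto)
    also have "\<dots> \<le> D * G"
      unfolding G_def using xm D m t \<alpha>f by (intro mult_mono) auto
    finally show ?thesis .
  qed
  have mT: "m \<in> {m..T}" "T \<in> {m..T}" using m by auto
  have split: "integral {s..T} (\<lambda>t. c t (x t) (u t)) =
      integral {s..m} (\<lambda>t. c t (x t) (u t)) + integral {m..T} (\<lambda>t. c t (x t) (u t))"
    using m running_cost(1)[OF tr, of s T] by (intro Henstock_Kurzweil_Integration.integral_combine[symmetric]) auto
  have split': "integral {s'..T} (\<lambda>t. c t (x' t) (u' t)) =
      integral {s'..m} (\<lambda>t. c t (x' t) (u' t)) + integral {m..T} (\<lambda>t. c t (x' t) (u' t))"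
    using m running_cost(1)[OF tr', of s' T] by (intro Henstock_Kurzweil_Integration.integral_combine[symmetric]) auto
  have "\<beta>c * growth_bound y * (m - s) \<le> \<beta>c * K * (m - s)"
    using m K \<beta>c by (intro mult_right_mono mult_left_mono) auto
  then have 1: "\<bar>integral {s..m} (\<lambda>t. c t (x t) (u t))\<bar> \<le> \<beta>c * K * (m - s)"
    using running_cost(4)[OF tr, of s m] m by simp
  have "\<beta>c * growth_bound y' * (m - s') \<le> \<beta>c * K * (m - s')"
    using m K \<beta>c by (intro mult_right_mono mult_left_mono) auto
  then have 2: "\<bar>integral {s'..m} (\<lambda>t. c t (x' t) (u' t))\<bar> \<le> \<beta>c * K * (m - s')"
    using running_cost(4)[OF tr', of s' m] m by simp
  have i: "(\<lambda>t. c t (x t) (u t)) integrable_on {m..T}" "(\<lambda>t. c t (x' t) (u' t)) integrable_on {m..T}"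
    using running_cost(1)[OF tr, of m T] running_cost(1)[OF tr', of m T] m by auto
  have 3: "integral {m..T} (\<lambda>t. c t (x t) (u t)) - integral {m..T} (\<lambda>t. c t (x' t) (u' t)) \<le> \<alpha>c * T * (D * G)"
  proof -
    have "integral {m..T} (\<lambda>t. c t (x t) (u t)) - integral {m..T} (\<lambda>t. c t (x' t) (u' t))
        = integral {m..T} (\<lambda>t. c t (x t) (u t) - c t (x' t) (u' t))"
      by (rule Henstock_Kurzweil_Integration.integral_diff[OF i, symmetric])
    also have "\<dots> \<le> integral {m..T} (\<lambda>t. \<alpha>c * (D * G))"
    proof (rule integral_le)
      fix t assume t: "t \<in> {m..T}"
      have "u' t \<in> U" using trajectory_input(2)[OF tr' m(2) order_refl t] .
      then have "\<bar>c t (x t) (u' t) - c t (x' t) (u' t)\<bar> \<le> \<alpha>c * norm (x t - x' t)"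
        using t m by (intro c_lip) auto
      also have "\<dots> \<le> \<alpha>c * (D * G)" using close[OF t] \<alpha>c by simp
      finally show "c t (x t) (u t) - c t (x' t) (u' t) \<le> \<alpha>c * (D * G)" using uu'[OF t] by simp
    qed (use i in \<open>auto intro: integrable_diff\<close>)
    also have "\<dots> = \<alpha>c * (D * G) * (T - m)" using m by simp
    also have "\<dots> \<le> \<alpha>c * (D * G) * T" using m \<alpha>c D G by (intro mult_left_mono) auto
    finally show ?thesis by (simp add: mult_ac)
  qed
  have 4: "g (x T) - g (x' T) \<le> \<alpha>g * (D * G)"
  proof -
    have "g (x T) - g (x' T) \<le> \<alpha>g * norm (x T - x' T)" using g_lip[of "x T" "x' T"] by simp
    also have "\<dots> \<le> \<alpha>g * (D * G)" using close[OF mT(2)] \<alpha>g by simp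
    finally show ?thesis .
  qed
  have "V s y \<le> cost c g T s u x" using value_le_cost[OF tr] s by simp
  also have "\<dots> \<le> cost c g T s' u' x' + \<beta>c * K * ((m - s) + (m - s')) + (\<alpha>c * T + \<alpha>g) * (D * G)"
    using 1 2 3 4 split split' cost_eq[OF tr] cost_eq[OF tr'] s s' by (simp add: algebra_simps)
  also have "\<dots> \<le> (V s' y' + e) + \<beta>c * K * \<delta> + (\<alpha>c * T + \<alpha>g) * (D * G)"
  proof -
    have "\<beta>c * K * ((m - s) + (m - s')) \<le> \<beta>c * K * \<delta>"
      unfolding m(5) using \<delta> \<beta>c K by (intro mult_left_mono) auto
    then show ?thesis using le by linarith
  qed
  also have "\<dots> = V s' y' + (\<beta>c * K + (\<alpha>c * T + \<alpha>g) * G * (1 + \<beta>f * K)) * \<delta> + e"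
    by (simp add: D_def algebra_simps)
  finally show "V s y \<le> V s' y' + (\<beta>c * growth_bound v + (\<alpha>c * T + \<alpha>g) * exp (\<alpha>f * T) * (1 + \<beta>f * growth_bound v))
    * (\<bar>s - s'\<bar> + norm (y - y')) + e"
    by (simp add: K_def G_def \<delta>_def)
qed

lemma value_continuous: "continuous_on ({0..T} \<times> UNIV) (\<lambda>(t, x). V t x)"
  unfolding continuous_on_iff
proof (intro ballI allI impI)
  fix p :: "real \<times> (real^'n)" and e :: real
  assume p: "p \<in> {0..T} \<times> UNIV" and e: "0 < e"
  obtain s y where [simp]: "p = (s, y)" by (cases p)
  obtain v :: "real^'n" where v: "norm v = norm y + 1" using vector_choose_size[of "norm y + 1"] by auto
  define L where "L = \<beta>c * growth_bound v + (\<alpha>c * T + \<alpha>g) * exp (\<alpha>f * T) * (1 + \<beta>f * growth_bound v)"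
  have L: "0 < L"
    unfolding L_def using \<beta>c \<alpha>c \<alpha>g T \<beta>f growth_bound_pos[of v]
    by (intro add_pos_pos mult_pos_pos) auto
  show "\<exists>d>0. \<forall>q\<in>{0..T} \<times> UNIV. dist q p < d \<longrightarrow>
      dist (case q of (t, x) \<Rightarrow> V t x) (case p of (t, x) \<Rightarrow> V t x) < e"
  proof (intro exI[of _ "min 1 (e / (2 * L))"] conjI ballI impI)
    show "0 < min 1 (e / (2 * L))" using L e by simp
    fix q assume q: "q \<in> {0..T} \<times> (UNIV :: (real^'n) set)" "dist q p < min 1 (e / (2 * L))"
    obtain s' y' where [simp]: "q = (s', y')" by (cases q)
    have d: "\<bar>s' - s\<bar> \<le> dist q p" "norm (y' - y) \<le> dist q p"
      using dist_fst_le[of q p] dist_snd_le[of q p] by (auto simp: dist_norm)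
    have nv: "norm y \<le> norm v" "norm y' \<le> norm v"
      using d(2) q(2) v norm_triangle_sub[of y' y] by auto
    have st: "s \<in> {0..T}" "s' \<in> {0..T}" using p q(1) by auto
    have "V s y \<le> V s' y' + L * (\<bar>s - s'\<bar> + norm (y - y'))"
      unfolding L_def by (rule value_le_value[OF st nv])
    moreover have "V s' y' \<le> V s y + L * (\<bar>s' - s\<bar> + norm (y' - y))"
      unfolding L_def by (rule value_le_value[OF st(2,1) nv(2,1)])
    ultimately have "\<bar>V s' y' - V s y\<bar> \<le> L * (\<bar>s' - s\<bar> + norm (y' - y))"
      by (simp add: norm_minus_commute abs_minus_commute)
    also have "\<dots> \<le> L * (dist q p + dist q p)" using L d by (intro mult_left_mono add_mono) auto
    also have "\<dots> < L * (e / (2 * L) + e / (2 * L))" using L q(2) by (intro mult_strict_left_mono add_strict_mono) auto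
    also have "\<dots> = e" using L by simp
    finally show "dist (case q of (t, x) \<Rightarrow> V t x) (case p of (t, x) \<Rightarrow> V t x) < e"
      by (simp add: dist_real_def)
  qed
qed

end

section \<open>The optimality gap of the closed loop\<close>

lemma superdiffD:
  assumes "p \<in> superdiff \<Omega> u x" "0 < \<epsilon>"
  shows "\<exists>\<rho>>0. \<forall>y\<in>\<Omega>. dist y x < \<rho> \<longrightarrow> u y - u x - p \<bullet> (y - x) \<le> \<epsilon> * norm (y - x)"
proof -
  have "Limsup (at x within \<Omega>) (\<lambda>y. ereal ((u y - u x - p \<bullet> (y - x)) / norm (y - x))) < ereal \<epsilon>"
    using assms by (auto simp: superdiff_def intro: le_less_trans)
  then have "\<forall>\<^sub>F y in at x within \<Omega>. ereal ((u y - u x - p \<bullet> (y - x)) / norm (y - x)) < ereal \<epsilon>"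
    by (rule Limsup_lessD)
  then obtain \<rho> where \<rho>: "\<rho> > 0"
    "\<And>y. y \<in> \<Omega> \<Longrightarrow> y \<noteq> x \<Longrightarrow> dist y x < \<rho> \<Longrightarrow> (u y - u x - p \<bullet> (y - x)) / norm (y - x) < \<epsilon>"
    unfolding eventually_at by auto
  show ?thesis
  proof (intro exI[of _ \<rho>] conjI ballI impI \<rho>(1))
    fix y assume "y \<in> \<Omega>" "dist y x < \<rho>"
    then show "u y - u x - p \<bullet> (y - x) \<le> \<epsilon> * norm (y - x)"
      using \<rho>(2)[of y] by (cases "y = x") (auto simp: pos_divide_less_eq)
  qed
qed

lemma subdiffD:
  assumes "p \<in> subdiff \<Omega> u x" "0 < \<epsilon>"
  shows "\<exists>\<rho>>0. \<forall>y\<in>\<Omega>. dist y x < \<rho> \<longrightarrow> - (\<epsilon> * norm (y - x)) \<le> u y - u x - p \<bullet> (y - x)"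
proof -
  have "ereal (- \<epsilon>) < Liminf (at x within \<Omega>) (\<lambda>y. ereal ((u y - u x - p \<bullet> (y - x)) / norm (y - x)))"
  proof (rule less_le_trans)
    show "ereal (- \<epsilon>) < 0" using assms(2) by simp
  qed (use assms(1) in \<open>simp add: subdiff_def\<close>)
  then have "\<forall>\<^sub>F y in at x within \<Omega>. ereal (- \<epsilon>) < ereal ((u y - u x - p \<bullet> (y - x)) / norm (y - x))"
    by (rule less_LiminfD)
  then obtain \<rho> where \<rho>: "\<rho> > 0"
    "\<And>y. y \<in> \<Omega> \<Longrightarrow> y \<noteq> x \<Longrightarrow> dist y x < \<rho> \<Longrightarrow> - \<epsilon> < (u y - u x - p \<bullet> (y - x)) / norm (y - x)"
    unfolding eventually_at by auto
  show ?thesis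
  proof (intro exI[of _ \<rho>] conjI ballI impI \<rho>(1))
    fix y assume "y \<in> \<Omega>" "dist y x < \<rho>"
    then show "- (\<epsilon> * norm (y - x)) \<le> u y - u x - p \<bullet> (y - x)"
      using \<rho>(2)[of y] by (cases "y = x") (auto simp: pos_less_divide_eq)
  qed
qed

context optimal_control begin

text \<open>Uniform continuity in the input makes \<open>d\<close> independent of \<open>u\<close>. This is needed because the inputs of the
  nearly optimal trajectories considered below need not converge.\<close>

lemma data_near_point:
  assumes t: "t \<in> {0..T}" and e: "0 < e"
  shows "\<exists>d>0. \<forall>s y u. s \<in> {0..T} \<longrightarrow> u \<in> U \<longrightarrow> \<bar>s - t\<bar> < d \<longrightarrow> norm (y - x) < d \<longrightarrow>
    norm (f s y u - f t x u) \<le> e \<and> \<bar>c s y u - c t x u\<bar> \<le> e"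
proof -
  have e2: "0 < e / 2" using e by simp
  obtain d1 where d1: "d1 > 0" "\<And>s u s' u'. s \<in> {0..T} \<Longrightarrow> u \<in> U \<Longrightarrow> s' \<in> {0..T} \<Longrightarrow> u' \<in> U \<Longrightarrow>
      dist (s, u) (s', u') < d1 \<Longrightarrow> dist (f s x u) (f s' x u') < e / 2"
    using f_unif[of x, unfolded uniformly_continuous_on_def, THEN spec, THEN mp, OF e2]
    by clarsimp
  obtain d2 where d2: "d2 > 0" "\<And>s u s' u'. s \<in> {0..T} \<Longrightarrow> u \<in> U \<Longrightarrow> s' \<in> {0..T} \<Longrightarrow> u' \<in> U \<Longrightarrow>
      dist (s, u) (s', u') < d2 \<Longrightarrow> dist (c s x u) (c s' x u') < e / 2"
    using c_unif[of x, unfolded uniformly_continuous_on_def, THEN spec, THEN mp, OF e2]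
    by clarsimp
  define d where "d = min (min d1 d2) (min (e / (2 * \<alpha>f)) (e / (2 * \<alpha>c)))"
  have d: "0 < d" using d1 d2 e \<alpha>f \<alpha>c by (simp add: d_def)
  show ?thesis
  proof (intro exI[of _ d] conjI allI impI d)
    fix s y u assume *: "s \<in> {0..T}" "u \<in> U" "\<bar>s - t\<bar> < d" "norm (y - x) < d"
    have ds: "dist (s, u) (t, u) = \<bar>s - t\<bar>" by (simp add: dist_Pair_Pair dist_real_def)
    have "norm (f s y u - f s x u) \<le> \<alpha>f * norm (y - x)" by (rule f_lip[OF *(1,2)])
    also have "\<dots> \<le> \<alpha>f * (e / (2 * \<alpha>f))" using * \<alpha>f by (intro mult_left_mono) (auto simp: d_def)
    also have "\<dots> = e / 2" using \<alpha>f by simp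
    finally have 1: "norm (f s y u - f s x u) \<le> e / 2" .
    have "dist (f s x u) (f t x u) < e / 2" using * t ds by (intro d1(2)) (auto simp: d_def)
    then have 2: "norm (f s x u - f t x u) \<le> e / 2" by (simp add: dist_norm)
    have "f s y u - f t x u = (f s y u - f s x u) + (f s x u - f t x u)" by simp
    then have "norm (f s y u - f t x u) \<le> norm (f s y u - f s x u) + norm (f s x u - f t x u)"
      by (metis norm_triangle_ineq)
    then show "norm (f s y u - f t x u) \<le> e" using 1 2 by linarith
    have "\<bar>c s y u - c s x u\<bar> \<le> \<alpha>c * norm (y - x)" by (rule c_lip[OF *(1,2)])
    also have "\<dots> \<le> \<alpha>c * (e / (2 * \<alpha>c))" using * \<alpha>c by (intro mult_left_mono) (auto simp: d_def)
    also have "\<dots> = e / 2" using \<alpha>c by simp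
    finally have 3: "\<bar>c s y u - c s x u\<bar> \<le> e / 2" .
    have "dist (c s x u) (c t x u) < e / 2" using * t ds by (intro d2(2)) (auto simp: d_def)
    then have "\<bar>c s x u - c t x u\<bar> < e / 2" by (simp add: dist_real_def)
    then show "\<bar>c s y u - c t x u\<bar> \<le> e" using 3 by linarith
  qed
qed

text \<open>Suppose that \<open>E = J - V\<close> grows at most at rate \<open>m\<close> along arcs that leave \<open>(t, x)\<close> with speed at most
  \<open>\<beta>f * (1 + R)\<close>. For step sizes \<open>h n\<close> tending to zero take trajectories \<open>y n\<close> from \<open>(t, x)\<close> that are optimal up to
  \<open>(h n)\<^sup>2\<close> on \<open>{t..t + h n}\<close>, with mean velocity \<open>w n\<close> and mean running cost \<open>C n\<close>.
  Dynamic programming gives \<open>J (t + h n, x + h n *\<^sub>R w n) - J (t, x) \<le> h n * (m - C n + h n)\<close>. Pass to a limit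
  \<open>(w', C')\<close> of a subsequence. Reading the inequality backwards from \<open>(t + h n, x + h n *\<^sub>R w')\<close> bounds
  difference quotients of \<open>J\<close> in direction \<open>(- 1, - w')\<close> from below, whence an element \<open>(p, q)\<close> of the
  Clarke gradient with \<open>p + q \<bullet> w' + C' \<le> m + e\<close>. On the other hand \<open>p + q \<bullet> w' + C'\<close> is a limit of averages of
  \<open>p + c t x v + q \<bullet> f t x v\<close> over input values \<open>v\<close>, so it is at least \<open>\<mu>\<close>. Averaging inputs is harmless here because
  this expression is affine in the velocity and the cost.\<close>

lemma hamiltonian_le_of_error_growth:
  fixes J :: "real \<times> (real^'n) \<Rightarrow> real"
  assumes lip: "K-lipschitz_on ({0..T} \<times> UNIV) J" and t: "t \<in> {0<..<T}" and x: "norm x < R"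
    and min: "\<And>p q u. (p, q) \<in> clarke_gradient ({0..T} \<times> UNIV) J (t, x) \<Longrightarrow> u \<in> U \<Longrightarrow>
      \<mu> \<le> p + c t x u + q \<bullet> f t x u"
    and error: "\<exists>\<delta>>0. \<forall>h y. 0 < h \<longrightarrow> h < \<delta> \<longrightarrow> norm (y - x) \<le> \<beta>f * (1 + R) * h \<longrightarrow>
      (J (t + h, y) - V (t + h) y) - (J (t, x) - V t x) \<le> m * h"
  shows "\<mu> \<le> m"
proof -
  define B where "B = \<beta>f * (1 + R)"
  have R: "0 < R" using x norm_ge_zero[of x] by linarith
  have B: "0 < B" using R \<beta>f by (simp add: B_def)
  obtain \<delta> where \<delta>: "\<delta> > 0" and err: "\<And>h y. 0 < h \<Longrightarrow> h < \<delta> \<Longrightarrow> norm (y - x) \<le> B * h \<Longrightarrow>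
      (J (t + h, y) - V (t + h) y) - (J (t, x) - V t x) \<le> m * h"
    using error unfolding B_def by blast
  \<comment> \<open>For a short time every trajectory from \<open>x\<close> stays in the ball of radius \<open>R\<close>, so its speed is at most \<open>B\<close>.\<close>
  have "\<exists>h>0. h < \<delta> \<and> t + h < T \<and> (1 + norm x) * exp (\<beta>f * h) \<le> 1 + R"
  proof -
    have "((\<lambda>h. (1 + norm x) * exp (\<beta>f * h)) \<longlongrightarrow> (1 + norm x) * exp (\<beta>f * 0)) (at_right 0)"
      by (intro tendsto_intros)
    then have "\<forall>\<^sub>F h in at_right 0. (1 + norm x) * exp (\<beta>f * h) < 1 + R"
      by (rule order_tendstoD) (use x in simp)
    moreover have "\<forall>\<^sub>F h in at_right 0. h < min \<delta> (T - t)"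
      using \<delta> t by (intro eventually_at_rightI[of 0 "min \<delta> (T - t)"]) auto
    moreover have "\<forall>\<^sub>F h in at_right (0::real). 0 < h" by (simp add: eventually_at_right_less)
    ultimately have "\<forall>\<^sub>F h in at_right 0. 0 < h \<and> h < \<delta> \<and> t + h < T \<and> (1 + norm x) * exp (\<beta>f * h) \<le> 1 + R"
      by eventually_elim auto
    then show ?thesis using eventually_happens[of _ "at_right (0::real)"] trivial_limit_at_right_real by blast
  qed
  then obtain h0 where h0: "0 < h0" "h0 < \<delta>" "t + h0 < T" "(1 + norm x) * exp (\<beta>f * h0) \<le> 1 + R" by blast
  define h where "h n = h0 / real (Suc n)" for n
  have h: "0 < h n" "h n \<le> h0" for n
    using h0 by (auto simp: h_def divide_le_eq)
  have h_lim: "h \<longlonglongrightarrow> 0"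
    unfolding h_def by (rule LIMSEQ_Suc[where f = "\<lambda>n. h0 / real n"]) (rule lim_const_over_n)
  have t0: "0 \<le> t" "t \<le> T" using t by auto
  have "\<exists>u x'. trajectory t x u x' \<and> integral {t..t + h n} (\<lambda>s. c s (x' s) (u s)) + V (t + h n) (x' (t + h n))
      < V t x + (h n)\<^sup>2" for n
    using h[of n] h0 t0 by (intro dynamic_programming_ge) auto
  then obtain u y where tr: "\<And>n. trajectory t x (u n) (y n)"
    and dp: "\<And>n. integral {t..t + h n} (\<lambda>s. c s (y n s) (u n s)) + V (t + h n) (y n (t + h n)) < V t x + (h n)\<^sup>2"
    by metis
  have hT: "t \<le> t + h n" "t + h n \<le> T" for n using h[of n] h0 by auto
  have speed: "norm (y n s - x) \<le> B * (s - t)" if s: "s \<in> {t..t + h n}" for n s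
  proof -
    have sT: "t \<le> s" "s \<le> T" using s hT[of n] by auto
    note int = trajectory_increment(1)[OF tr t0(1) order_refl sT, of n]
    have "norm (f r (y n r) (u n r)) \<le> B" if r: "r \<in> {t..s}" for r
    proof -
      have "1 + norm (y n r) \<le> (1 + norm x) * exp (\<beta>f * (r - t))"
        using tr[of n] r sT t0 unfolding trajectory_def by (intro solution_growth) auto
      also have "\<dots> \<le> (1 + norm x) * exp (\<beta>f * h0)"
        using r s h[of n] \<beta>f by (intro mult_left_mono) auto
      finally have *: "1 + norm (y n r) \<le> 1 + R" using h0(4) by linarith
      have "norm (f r (y n r) (u n r)) \<le> \<beta>f * (1 + norm (y n r))"
        using r sT t0 trajectory_input(2)[OF tr order_refl order_refl, of r n] by (intro f_growth) auto
      also have "\<dots> \<le> B" unfolding B_def using * \<beta>f by (intro mult_left_mono) auto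
      finally show ?thesis .
    qed
    from norm_integral_diff_le[where f = "\<lambda>r. f r (y n r) (u n r)", OF int this order_refl sT(1) order_refl]
    have "norm (integral {t..s} (\<lambda>r. f r (y n r) (u n r))) \<le> B * (s - t)" by simp
    then show ?thesis
      using trajectory_increment(2)[OF tr t0(1) order_refl sT, of n] trajectory_start[OF tr, of n] by simp
  qed
  define w where "w n = (1 / h n) *\<^sub>R (y n (t + h n) - x)" for n
  define C where "C n = (1 / h n) * integral {t..t + h n} (\<lambda>s. c s (y n s) (u n s))" for n
  have yw: "y n (t + h n) = x + h n *\<^sub>R w n" for n using h[of n] by (simp add: w_def)
  have hC: "integral {t..t + h n} (\<lambda>s. c s (y n s) (u n s)) = h n * C n" for n using h[of n] by (simp add: C_def)
  have w_bound: "norm (w n) \<le> B" for n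
  proof -
    have "norm (h n *\<^sub>R w n) \<le> B * h n" using speed[of "t + h n" n] h[of n] by (simp add: yw)
    then show ?thesis using h[of n] by simp
  qed
  have C_bound: "\<bar>C n\<bar> \<le> \<beta>c * growth_bound x" for n
  proof -
    have "\<bar>h n * C n\<bar> \<le> \<beta>c * growth_bound x * h n"
      using running_cost(4)[OF tr t0(1) order_refl hT, of n n] by (simp add: hC)
    then show ?thesis using h[of n] by (simp add: abs_mult)
  qed
  have descent: "J (t + h n, x + h n *\<^sub>R w n) - J (t, x) + h n * C n \<le> m * h n + (h n)\<^sup>2" for n
    using dp[of n] err[of "h n" "y n (t + h n)"] speed[of "t + h n" n] h[of n] h0
    unfolding hC yw by simp
  have "bounded (range (\<lambda>n. (w n, C n)))"
    unfolding bounded_iff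
  proof (intro exI ballI)
    fix z assume "z \<in> range (\<lambda>n. (w n, C n))"
    then obtain n where "z = (w n, C n)" by blast
    then show "norm z \<le> B + \<beta>c * growth_bound x"
      using norm_Pair_le[of "w n" "C n"] w_bound[of n] C_bound[of n] by simp
  qed
  then obtain l r where r: "strict_mono (r :: nat \<Rightarrow> nat)" and l: "((\<lambda>n. (w n, C n)) \<circ> r) \<longlonglongrightarrow> l"
    using bounded_imp_convergent_subsequence by blast
  obtain w' C' where [simp]: "l = (w', C')" by (cases l)
  have wl: "(\<lambda>n. w (r n)) \<longlonglongrightarrow> w'" using tendsto_fst[OF l] by (simp add: o_def)
  have Cl: "(\<lambda>n. C (r n)) \<longlonglongrightarrow> C'" using tendsto_snd[OF l] by (simp add: o_def)
  have hl: "(\<lambda>n. h (r n)) \<longlonglongrightarrow> 0" using LIMSEQ_subseq_LIMSEQ[OF h_lim r] by (simp add: o_def)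
  have lower: "\<mu> \<le> p + q \<bullet> w' + C'" if pq: "(p, q) \<in> clarke_gradient ({0..T} \<times> UNIV) J (t, x)" for p q
  proof (rule field_le_epsilon)
    fix e :: real assume e: "0 < e"
    define e' where "e' = e / (1 + norm q)"
    have nq: "0 < 1 + norm q" by (simp add: add_pos_nonneg)
    have e': "0 < e'" using e nq by (simp add: e'_def)
    have tT: "t \<in> {0..T}" using t0 by simp
    obtain d where d: "d > 0" and near: "\<And>s y u. s \<in> {0..T} \<Longrightarrow> u \<in> U \<Longrightarrow> \<bar>s - t\<bar> < d \<Longrightarrow> norm (y - x) < d \<Longrightarrow>
        norm (f s y u - f t x u) \<le> e' \<and> \<bar>c s y u - c t x u\<bar> \<le> e'"
      using data_near_point[OF tT e', of x] by blast
    have "0 < min d (d / B)" using d B by simp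
    then have "\<forall>\<^sub>F n in sequentially. h (r n) < min d (d / B)"
      by (rule order_tendstoD(2)[OF hl])
    then have "\<forall>\<^sub>F n in sequentially. \<mu> \<le> p + q \<bullet> w (r n) + C (r n) + e"
    proof eventually_elim
      case (elim n)
      define k where "k = r n"
      have hk: "0 < h k" "h k < d" "B * h k < d"
        using h[of k] elim B by (auto simp: k_def pos_less_divide_eq mult.commute)
      have pw: "\<mu> \<le> p + c s (y k s) (u k s) + q \<bullet> f s (y k s) (u k s) + e" if s: "s \<in> {t..t + h k}" for s
      proof -
        have us: "u k s \<in> U" using s hT[of k] by (intro trajectory_input(2)[OF tr order_refl order_refl]) auto
        have "norm (y k s - x) < d"
        proof -
          have "B * (s - t) \<le> B * h k" using s B by (intro mult_left_mono) auto
          then show ?thesis using speed[OF s] hk by linarith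
        qed
        then have n: "norm (f s (y k s) (u k s) - f t x (u k s)) \<le> e'" "\<bar>c s (y k s) (u k s) - c t x (u k s)\<bar> \<le> e'"
          using near[of s "u k s" "y k s"] s hk t0 hT[of k] us by auto
        have "\<bar>q \<bullet> (f s (y k s) (u k s) - f t x (u k s))\<bar> \<le> norm q * norm (f s (y k s) (u k s) - f t x (u k s))"
          by (rule Cauchy_Schwarz_ineq2)
        also have "\<dots> \<le> norm q * e'" using n(1) by (intro mult_left_mono) auto
        finally have "\<bar>q \<bullet> f s (y k s) (u k s) - q \<bullet> f t x (u k s)\<bar> \<le> norm q * e'" by (simp add: inner_diff_right)
        moreover have "e' + norm q * e' = e"
        proof -
          have "e' + norm q * e' = (1 + norm q) * e'" by (simp add: algebra_simps)
          then show ?thesis using nq by (simp add: e'_def)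
        qed
        ultimately show ?thesis using min[OF pq us] n(2) by linarith
      qed
      have i1: "(\<lambda>s. c s (y k s) (u k s)) integrable_on {t..t + h k}"
        by (rule running_cost(1)[OF tr t0(1) order_refl hT])
      have i2: "(\<lambda>s. f s (y k s) (u k s)) integrable_on {t..t + h k}"
        by (rule trajectory_increment(1)[OF tr t0(1) order_refl hT])
      have "((\<lambda>s. (p + e) + c s (y k s) (u k s) + q \<bullet> f s (y k s) (u k s)) has_integral
          (h k * (p + e) + h k * C k + q \<bullet> (h k *\<^sub>R w k))) {t..t + h k}"
      proof (intro has_integral_add)
        show "((\<lambda>s. p + e) has_integral h k * (p + e)) {t..t + h k}"
          using has_integral_const_real[of "p + e" t "t + h k"] h[of k] by simp
        show "((\<lambda>s. c s (y k s) (u k s)) has_integral h k * C k) {t..t + h k}"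
          using integrable_integral[OF i1] by (simp add: hC)
        have "integral {t..t + h k} (\<lambda>s. f s (y k s) (u k s)) = h k *\<^sub>R w k"
          using trajectory_increment(2)[OF tr t0(1) order_refl hT, of k k] trajectory_start[OF tr, of k] by (simp add: yw)
        then show "((\<lambda>s. q \<bullet> f s (y k s) (u k s)) has_integral q \<bullet> (h k *\<^sub>R w k)) {t..t + h k}"
          using has_integral_linear[OF integrable_integral[OF i2] bounded_linear_inner_right[of q]] by (simp add: o_def)
      qed
      note upper = this
      have const: "((\<lambda>s. \<mu>) has_integral h k * \<mu>) {t..t + h k}"
        using has_integral_const_real[of \<mu> t "t + h k"] h[of k] by simp
      have "h k * \<mu> \<le> h k * (p + e) + h k * C k + q \<bullet> (h k *\<^sub>R w k)"
      proof (rule has_integral_le[OF const upper])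
        fix s assume "s \<in> {t..t + h k}"
        from pw[OF this] show "\<mu> \<le> (p + e) + c s (y k s) (u k s) + q \<bullet> f s (y k s) (u k s)" by linarith
      qed
      then have "h k * \<mu> \<le> h k * (p + q \<bullet> w k + C k + e)" by (simp add: algebra_simps)
      then show "\<mu> \<le> p + q \<bullet> w (r n) + C (r n) + e" using h[of k] by (simp add: k_def)
    qed
    moreover have "(\<lambda>n. p + q \<bullet> w (r n) + C (r n) + e) \<longlonglongrightarrow> p + q \<bullet> w' + C' + e"
      by (intro tendsto_intros wl Cl)
    ultimately show "\<mu> \<le> p + q \<bullet> w' + C' + e"
      by (intro tendsto_lowerbound[of _ _ sequentially]) auto
  qed
  show ?thesis
  proof (rule field_le_epsilon)
    fix e :: real assume e: "0 < e"
    have K: "0 \<le> K" using lip by (rule lipschitz_on_nonneg)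
    have "(t, x) \<in> interior ({0..T} \<times> UNIV)" using t by (simp add: interior_Times)
    moreover have "\<exists>z k. dist z (t, x) < d \<and> 0 < k \<and> k < d \<and>
        - m + C' - e / 2 \<le> (J (z + k *\<^sub>R (- 1, - w')) - J z) / k" if d: "0 < d" for d
    proof -
      have "(\<lambda>n. h (r n) * norm (1::real, w')) \<longlonglongrightarrow> 0 * norm (1::real, w')" by (intro tendsto_intros hl)
      then have ev1: "\<forall>\<^sub>F n in sequentially. h (r n) * norm (1::real, w') < d" using order_tendstoD(2) d by fastforce
      have ev2: "\<forall>\<^sub>F n in sequentially. h (r n) < d" using order_tendstoD(2)[OF hl d] .
      have "(\<lambda>n. - m - h (r n) + C (r n) - K * norm (w (r n) - w')) \<longlonglongrightarrow> - m - 0 + C' - K * norm (w' - w')"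
        by (intro tendsto_intros hl Cl wl)
      then have ev3: "\<forall>\<^sub>F n in sequentially. - m + C' - e / 2 < - m - h (r n) + C (r n) - K * norm (w (r n) - w')"
        by (rule order_tendstoD) (use e in simp)
      obtain n where n: "h (r n) * norm (1::real, w') < d" "h (r n) < d"
        "- m + C' - e / 2 < - m - h (r n) + C (r n) - K * norm (w (r n) - w')"
        using eventually_happens[OF eventually_conj[OF ev1 eventually_conj[OF ev2 ev3]]] by auto
      define k where "k = r n"
      have hk: "0 < h k" using h by simp
      \<comment> \<open>the base point of the difference quotient in direction \<open>(- 1, - w')\<close>, which leads back to \<open>(t, x)\<close>\<close>
      define z where "z = (t + h k, x + h k *\<^sub>R w')"
      have "z - (t, x) = h k *\<^sub>R (1, w')" by (simp add: z_def)
      then have "dist z (t, x) = \<bar>h k\<bar> * norm (1::real, w')" by (simp only: dist_norm norm_scaleR)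
      then have "dist z (t, x) = h k * norm (1::real, w')" using hk by simp
      then have 1: "dist z (t, x) < d" using n(1) by (simp add: k_def)
      have zz: "z + h k *\<^sub>R (- 1, - w') = (t, x)" by (simp add: z_def)
      have "J z - J (t + h k, x + h k *\<^sub>R w k) \<le> K * dist z (t + h k, x + h k *\<^sub>R w k)"
        using lipschitz_onD[OF lip, of z "(t + h k, x + h k *\<^sub>R w k)"] hT[of k] t0
        by (simp add: z_def dist_real_def)
      also have "dist z (t + h k, x + h k *\<^sub>R w k) = h k * norm (w k - w')"
        using hk by (simp add: z_def dist_Pair_Pair dist_norm norm_minus_commute flip: scaleR_diff_right)
      finally have "h k * (- m - h k + C k - K * norm (w k - w')) \<le> J (t, x) - J z"
        using descent[of k] by (simp add: algebra_simps power2_eq_square)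
      then have "- m - h k + C k - K * norm (w k - w') \<le> (J (t, x) - J z) / h k"
        using hk by (simp add: pos_le_divide_eq mult.commute)
      then have "- m + C' - e / 2 \<le> (J (z + h k *\<^sub>R (- 1, - w')) - J z) / h k"
        unfolding zz using n(3) by (simp add: k_def)
      then show ?thesis using 1 hk n(2) by (intro exI[of _ z] exI[of _ "h k"]) (auto simp: k_def)
    qed
    moreover have "0 < e / 2" using e by simp
    ultimately obtain P where P: "P \<in> clarke_gradient ({0..T} \<times> UNIV) J (t, x)" "- m + C' - e / 2 - e / 2 \<le> P \<bullet> (- 1, - w')"
      using clarke_gradient_support[OF lip, of "(t, x)" "- m + C' - e / 2" "(- 1, - w')" "e / 2"] by blast
    obtain p q where [simp]: "P = (p, q)" by (cases P)
    have "\<mu> \<le> p + q \<bullet> w' + C'" using P(1) by (intro lower) simp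
    then show "\<mu> \<le> m + e" using P(2) by simp
  qed
qed

text \<open>Let \<open>\<Psi> t\<close> be \<open>J (t, x t)\<close> plus the running cost up to time \<open>t\<close> minus \<open>m * t\<close>. At almost every \<open>t\<close> the
  trajectory and the running cost are differentiable; an element of the superdifferential then bounds
  the increase of \<open>\<Psi>\<close> on short intervals that start at \<open>t\<close>, one of the subdifferential on short
  intervals that end there. In both cases the slope is at most \<open>p + c + q \<bullet> f - m \<le> 0\<close> up to an
  arbitrarily small error, so \<open>\<Psi>\<close> decreases.\<close>

lemma cost_gap_bound:
  fixes J :: "real \<times> (real^'n) \<Rightarrow> real"
  assumes lip: "K-lipschitz_on ({0..T} \<times> UNIV) J" and tr: "trajectory 0 x0 u x"
    and P: "\<And>t. t \<in> {0<..<T} \<Longrightarrow> \<exists>p q. (p, q) \<in> semidiff ({0..T} \<times> UNIV) J (t, x t) \<and>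
      p + c t (x t) (u t) + q \<bullet> f t (x t) (u t) \<le> m"
  shows "J (T, x T) - J (0, x0) + integral {0..T} (\<lambda>t. c t (x t) (u t)) \<le> m * T"
proof -
  have T0: "0 \<le> T" using T by simp
  have K: "0 \<le> K" using lip by (rule lipschitz_on_nonneg)
  define I where "I t = integral {0..t} (\<lambda>t. c t (x t) (u t))" for t
  define \<Psi> where "\<Psi> t = J (t, x t) + I t - m * t" for t
  note int = running_cost(1)[OF tr order_refl order_refl T0 order_refl]
  obtain N1 where N1: "negligible N1"
    "\<And>t. t \<in> {0..T} - N1 \<Longrightarrow> (x has_vector_derivative f t (x t) (u t)) (at t within {0..T})"
    using tr unfolding trajectory_def ode_solution_def AE_lebesgue_on_interval_iff by blast
  obtain N2 where N2: "negligible N2"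
    "\<And>t. t \<in> {0..T} - N2 \<Longrightarrow> (I has_vector_derivative c t (x t) (u t)) (at t within {0..T})"
    using Lebesgue_differentiation_interval[OF int] unfolding I_def by metis
  define S where "S = {0<..<T} - (N1 \<union> N2)"
  have neg: "negligible ({0..T} - S)"
    by (rule negligible_subset[of "{0, T} \<union> (N1 \<union> N2)"]) (auto simp: S_def N1 N2)
  have acx: "abs_cont_on 0 T x" using tr unfolding trajectory_def ode_solution_def by blast
  have ac: "abs_cont_on 0 T \<Psi>"
  proof (rule abs_cont_on_dominated[OF acx])
    fix s t assume st: "0 \<le> s" "s \<le> t" "t \<le> T"
    have "\<bar>J (t, x t) - J (s, x s)\<bar> \<le> K * dist (t, x t) (s, x s)"
      using lipschitz_onD[OF lip, of "(t, x t)" "(s, x s)"] st by (simp add: dist_real_def)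
    also have "dist (t, x t) (s, x s) \<le> (t - s) + norm (x t - x s)"
      using norm_Pair_le[of "t - s" "x t - x s"] st by (simp add: dist_norm)
    then have "K * dist (t, x t) (s, x s) \<le> K * ((t - s) + norm (x t - x s))"
      using K by (intro mult_left_mono) auto
    finally have 1: "\<bar>J (t, x t) - J (s, x s)\<bar> \<le> K * ((t - s) + norm (x t - x s))" .
    have "norm (c t (x t) (u t)) \<le> \<beta>c * growth_bound x0" if "t \<in> {0..T}" for t
      using running_cost(3)[OF tr order_refl order_refl T0 order_refl that] by simp
    from norm_integral_diff_le[where f = "\<lambda>t. c t (x t) (u t)", OF int this st]
    have 2: "\<bar>I t - I s\<bar> \<le> \<beta>c * growth_bound x0 * (t - s)" by (simp add: I_def)
    have 3: "\<bar>m * t - m * s\<bar> = \<bar>m\<bar> * (t - s)" using st by (simp add: abs_mult flip: right_diff_distrib)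
    have "\<bar>\<Psi> t - \<Psi> s\<bar> \<le> \<bar>J (t, x t) - J (s, x s)\<bar> + \<bar>I t - I s\<bar> + \<bar>m * t - m * s\<bar>"
      unfolding \<Psi>_def by linarith
    also have "\<dots> \<le> K * norm (x t - x s) + (K + \<beta>c * growth_bound x0 + \<bar>m\<bar>) * (t - s)"
      using 1 2 3 by (simp add: algebra_simps)
    finally show "norm (\<Psi> t - \<Psi> s) \<le> K * norm (x t - x s) + (K + \<beta>c * growth_bound x0 + \<bar>m\<bar>) * (t - s)"
      by simp
  qed
  have "\<Psi> T \<le> \<Psi> 0"
  proof (rule abs_cont_on_Dini_decreasing[OF T0 ac neg])
    fix t e d :: real assume tS: "t \<in> S" and e: "0 < e" and d: "0 < d"
    have t: "0 < t" "t < T" "t \<in> {0..T} - N1" "t \<in> {0..T} - N2" using tS by (auto simp: S_def)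
    define v where "v = f t (x t) (u t)"
    define \<sigma> where "\<sigma> = c t (x t) (u t)"
    define z where "z s = (s, x s)" for s
    obtain p q where pq: "(p, q) \<in> semidiff ({0..T} \<times> UNIV) J (t, x t)" and le: "p + \<sigma> + q \<bullet> v \<le> m"
      using P[of t] t unfolding v_def \<sigma>_def by auto
    define P where "P = (p, q)"
    \<comment> \<open>\<open>\<epsilon>\<close> will bound the relative errors of \<open>x\<close>, of the running cost and of the semidifferential; together they
      change the slope of \<open>\<Psi>\<close> by at most \<open>\<epsilon> * M\<close>.\<close>
    define M where "M = norm P + norm (1::real, v) + 2"
    have M: "0 < M" by (simp add: M_def add_nonneg_pos)
    define \<epsilon> where "\<epsilon> = min 1 (e / M)"
    have \<epsilon>: "0 < \<epsilon>" "\<epsilon> \<le> 1" "\<epsilon> * M \<le> e" using e M by (auto simp: \<epsilon>_def min_def field_simps)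
    have "(x has_vector_derivative v) (at t within {0..T})" using N1(2)[OF t(3)] by (simp add: v_def)
    then obtain d1 where d1: "d1 > 0" "\<And>s. s \<in> {0..T} \<Longrightarrow> norm (s - t) < d1 \<Longrightarrow>
        norm (x s - x t - (s - t) *\<^sub>R v) \<le> \<epsilon> * norm (s - t)"
      using \<epsilon>(1) unfolding has_vector_derivative_def has_derivative_within_alt by metis
    have "(I has_vector_derivative \<sigma>) (at t within {0..T})" using N2(2)[OF t(4)] by (simp add: \<sigma>_def)
    then obtain d2 where d2: "d2 > 0" "\<And>s. s \<in> {0..T} \<Longrightarrow> norm (s - t) < d2 \<Longrightarrow>
        norm (I s - I t - (s - t) *\<^sub>R \<sigma>) \<le> \<epsilon> * norm (s - t)"
      using \<epsilon>(1) unfolding has_vector_derivative_def has_derivative_within_alt by metis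
    define Z where "Z = norm (1::real, v) + 1"
    have Z: "0 < Z" by (simp add: Z_def add_nonneg_pos)
    have zdiff: "norm (z s - z t - (s - t) *\<^sub>R (1, v)) \<le> \<epsilon> * \<bar>s - t\<bar>" if "s \<in> {0..T}" "\<bar>s - t\<bar> < d1" for s
      using d1(2)[of s] that by (simp add: z_def norm_Pair)
    have znorm: "norm (z s - z t) \<le> Z * \<bar>s - t\<bar>" if "s \<in> {0..T}" "\<bar>s - t\<bar> < d1" for s
    proof -
      have "z s - z t = (z s - z t - (s - t) *\<^sub>R (1, v)) + (s - t) *\<^sub>R (1, v)" by simp
      then have "norm (z s - z t) \<le> norm (z s - z t - (s - t) *\<^sub>R (1, v)) + norm ((s - t) *\<^sub>R (1::real, v))"
        by (metis norm_triangle_ineq)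
      also have "\<dots> \<le> \<epsilon> * \<bar>s - t\<bar> + \<bar>s - t\<bar> * norm (1::real, v)"
        using zdiff[OF that] unfolding norm_scaleR real_norm_def by simp
      also have "\<dots> \<le> 1 * \<bar>s - t\<bar> + \<bar>s - t\<bar> * norm (1::real, v)"
        using \<epsilon> by (intro add_right_mono mult_right_mono) auto
      finally show ?thesis by (simp add: Z_def algebra_simps)
    qed
    have Pz: "\<bar>P \<bullet> (z s - z t) - (s - t) * (p + q \<bullet> v)\<bar> \<le> norm P * (\<epsilon> * \<bar>s - t\<bar>)"
      if "s \<in> {0..T}" "\<bar>s - t\<bar> < d1" for s
    proof -
      have "P \<bullet> (z s - z t) - (s - t) * (p + q \<bullet> v) = P \<bullet> (z s - z t - (s - t) *\<^sub>R (1, v))"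
        by (simp add: P_def inner_diff_right algebra_simps)
      also have "\<bar>\<dots>\<bar> \<le> norm P * norm (z s - z t - (s - t) *\<^sub>R (1, v))" by (rule Cauchy_Schwarz_ineq2)
      also have "\<dots> \<le> norm P * (\<epsilon> * \<bar>s - t\<bar>)" using zdiff[OF that] by (intro mult_left_mono) auto
      finally show ?thesis .
    qed
    have z\<Omega>: "z s \<in> {0..T} \<times> UNIV" if "s \<in> {0..T}" for s using that by (simp add: z_def)
    from pq consider (super) "P \<in> superdiff ({0..T} \<times> UNIV) J (z t)" | (sub) "P \<in> subdiff ({0..T} \<times> UNIV) J (z t)"
      unfolding semidiff_def P_def z_def by blast
    then show "\<exists>l r. l < r \<and> t \<in> {l..r} \<and> {l..r} \<subseteq> {0..T} \<and> r - l < d \<and> \<Psi> r - \<Psi> l \<le> e * (r - l)"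
    proof cases
      case super
      obtain \<rho> where \<rho>: "\<rho> > 0" "\<And>y. y \<in> {0..T} \<times> UNIV \<Longrightarrow> dist y (z t) < \<rho> \<Longrightarrow>
          J y - J (z t) - P \<bullet> (y - z t) \<le> \<epsilon> * norm (y - z t)"
        using superdiffD[OF super \<epsilon>(1)] by blast
      define h where "h = Min {d / 2, d1 / 2, d2 / 2, T - t, \<rho> / (2 * Z)}"
      have h: "0 < h" "h < d" "h < d1" "h < d2" "h \<le> T - t" "h \<le> \<rho> / (2 * Z)"
        using d d1 d2 t \<rho> Z by (auto simp: h_def min_def)
      have s: "t + h \<in> {0..T}" "\<bar>t + h - t\<bar> < d1" "norm (t + h - t) < d2" using h t by auto
      have "Z * h \<le> Z * (\<rho> / (2 * Z))" using h Z by (intro mult_left_mono) auto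
      also have "\<dots> < \<rho>" using \<rho>(1) Z by simp
      finally have "dist (z (t + h)) (z t) < \<rho>" using znorm[OF s(1,2)] h by (simp add: dist_norm)
      then have 1: "J (z (t + h)) - J (z t) - P \<bullet> (z (t + h) - z t) \<le> \<epsilon> * norm (z (t + h) - z t)"
        by (intro \<rho>(2) z\<Omega> s(1))
      have 2: "\<epsilon> * norm (z (t + h) - z t) \<le> \<epsilon> * (Z * h)"
        using znorm[OF s(1,2)] \<epsilon> h by (intro mult_left_mono) auto
      have 3: "P \<bullet> (z (t + h) - z t) \<le> h * (p + q \<bullet> v) + norm P * (\<epsilon> * h)"
        using Pz[OF s(1,2)] h by (simp add: abs_le_iff)
      have 4: "I (t + h) - I t \<le> h * \<sigma> + \<epsilon> * h"
        using d2(2)[OF s(1,3)] h by (simp add: abs_le_iff)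
      have "h * (p + \<sigma> + q \<bullet> v) \<le> h * m" using le h by (intro mult_left_mono) auto
      then have "\<Psi> (t + h) - \<Psi> t \<le> \<epsilon> * (Z * h) + norm P * (\<epsilon> * h) + \<epsilon> * h"
        using 1 2 3 4 unfolding \<Psi>_def z_def by (simp add: algebra_simps)
      also have "\<dots> = (\<epsilon> * M) * h" by (simp add: M_def Z_def algebra_simps)
      also have "\<dots> \<le> e * h" using \<epsilon> h by (intro mult_right_mono) auto
      finally show ?thesis using h t by (intro exI[of _ t] exI[of _ "t + h"]) auto
    next
      case sub
      obtain \<rho> where \<rho>: "\<rho> > 0" "\<And>y. y \<in> {0..T} \<times> UNIV \<Longrightarrow> dist y (z t) < \<rho> \<Longrightarrow>
          - (\<epsilon> * norm (y - z t)) \<le> J y - J (z t) - P \<bullet> (y - z t)"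
        using subdiffD[OF sub \<epsilon>(1)] by blast
      define h where "h = Min {d / 2, d1 / 2, d2 / 2, t, \<rho> / (2 * Z)}"
      have h: "0 < h" "h < d" "h < d1" "h < d2" "h \<le> t" "h \<le> \<rho> / (2 * Z)"
        using d d1 d2 t \<rho> Z by (auto simp: h_def min_def)
      have s: "t - h \<in> {0..T}" "\<bar>t - h - t\<bar> < d1" "norm (t - h - t) < d2" using h t by auto
      have "Z * h \<le> Z * (\<rho> / (2 * Z))" using h Z by (intro mult_left_mono) auto
      also have "\<dots> < \<rho>" using \<rho>(1) Z by simp
      finally have "dist (z (t - h)) (z t) < \<rho>" using znorm[OF s(1,2)] h by (simp add: dist_norm)
      then have 1: "- (\<epsilon> * norm (z (t - h) - z t)) \<le> J (z (t - h)) - J (z t) - P \<bullet> (z (t - h) - z t)"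
        by (intro \<rho>(2) z\<Omega> s(1))
      have 2: "\<epsilon> * norm (z (t - h) - z t) \<le> \<epsilon> * (Z * h)"
        using znorm[OF s(1,2)] \<epsilon> h by (intro mult_left_mono) auto
      have 3: "- (P \<bullet> (z (t - h) - z t)) \<le> h * (p + q \<bullet> v) + norm P * (\<epsilon> * h)"
        using Pz[OF s(1,2)] h by (simp add: abs_le_iff algebra_simps)
      have 4: "I t - I (t - h) \<le> h * \<sigma> + \<epsilon> * h"
        using d2(2)[OF s(1,3)] h by (simp add: abs_le_iff)
      have "h * (p + \<sigma> + q \<bullet> v) \<le> h * m" using le h by (intro mult_left_mono) auto
      then have "\<Psi> t - \<Psi> (t - h) \<le> \<epsilon> * (Z * h) + norm P * (\<epsilon> * h) + \<epsilon> * h"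
        using 1 2 3 4 unfolding \<Psi>_def z_def by (simp add: algebra_simps)
      also have "\<dots> = (\<epsilon> * M) * h" by (simp add: M_def Z_def algebra_simps)
      also have "\<dots> \<le> e * h" using \<epsilon> h by (intro mult_right_mono) auto
      finally show ?thesis using h t by (intro exI[of _ "t - h"] exI[of _ t]) auto
    qed
  qed
  then show ?thesis using trajectory_start[OF tr] by (simp add: \<Psi>_def I_def mult.commute)
qed

text \<open>Along an arc of speed at most \<open>B\<close>, during a time \<open>h\<close>, the time coordinate moves by \<open>h\<close> and each space
  coordinate by at most \<open>B * h\<close>; the Lipschitz estimate for \<open>E\<close> coordinate by coordinate gives the claim.\<close>

lemma error_growth_bound:
  fixes J :: "real \<times> (real^'n) \<Rightarrow> real"
  assumes \<Omega>: "open \<Omega>" "(t, x) \<in> \<Omega>" and B: "0 \<le> B"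
    and E: "continuous_on \<Omega> (\<lambda>(t, x). J (t, x) - V t x)"
    and m: "\<And>b. b \<in> Basis \<Longrightarrow> weak_deriv_norm \<Omega> (\<lambda>(t, x). J (t, x) - V t x) b = ereal (m b)"
  shows "\<exists>\<delta>>0. \<forall>h y. 0 < h \<longrightarrow> h < \<delta> \<longrightarrow> norm (y - x) \<le> B * h \<longrightarrow>
      (J (t + h, y) - V (t + h) y) - (J (t, x) - V t x) \<le> ((\<Sum>b\<in>Basis. m b) * max 1 B) * h"
proof -
  obtain \<rho> where \<rho>: "\<rho> > 0" "ball (t, x) \<rho> \<subseteq> \<Omega>" using \<Omega> by (meson open_contains_ball)
  define D where "D = real (DIM(real \<times> (real^'n)))"
  have D: "0 < D" unfolding D_def by simp
  define r where "r = \<rho> / (4 * D)"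
  have r: "0 < r" using \<rho> D by (simp add: r_def)
  have cube: "z \<in> \<Omega>" if "\<And>i. i \<in> Basis \<Longrightarrow> \<bar>(z - (t, x)) \<bullet> i\<bar> \<le> 2 * r" for z
  proof -
    have "norm (z - (t, x)) \<le> (\<Sum>i\<in>Basis. \<bar>(z - (t, x)) \<bullet> i\<bar>)" by (rule norm_le_l1)
    also have "\<dots> \<le> (\<Sum>i\<in>(Basis :: (real \<times> (real^'n)) set). 2 * r)" using that by (intro sum_mono)
    also have "\<dots> = D * (2 * r)" by (simp add: D_def)
    also have "\<dots> < \<rho>" using \<rho> D by (simp add: r_def)
    finally have "z \<in> ball (t, x) \<rho>" by (simp add: dist_norm norm_minus_commute)
    then show ?thesis using \<rho> by blast
  qed
  have m0: "0 \<le> m b" if "b \<in> Basis" for b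
    using weak_deriv_norm_nonneg[OF \<Omega>(1), of "\<lambda>(t, x). J (t, x) - V t x" b] m[OF that] \<Omega>(2) by auto
  show ?thesis
  proof (intro exI[of _ "r / max 1 B"] conjI allI impI)
    show "0 < r / max 1 B" using r by simp
    fix h y assume h: "0 < h" "h < r / max 1 B" and y: "norm (y - x) \<le> B * h"
    have hr: "max 1 B * h < r" using h by (simp add: pos_less_divide_eq mult.commute)
    have coord: "\<bar>((t + h, y) - (t, x)) \<bullet> b\<bar> \<le> max 1 B * h" if b: "b \<in> Basis" for b
    proof -
      have "1 * h \<le> max 1 B * h" using h by (intro mult_right_mono) auto
      moreover have "B * h \<le> max 1 B * h" using h by (intro mult_right_mono) auto
      then have "\<bar>(y - x) \<bullet> i\<bar> \<le> max 1 B * h" if "i \<in> Basis" for i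
        using Basis_le_norm[OF that, of "y - x"] y by linarith
      ultimately show ?thesis using b h by (auto simp: Basis_prod_def)
    qed
    have "\<bar>(case (t + h, y) of (t, x) \<Rightarrow> J (t, x) - V t x) - (case (t, x) of (t, x) \<Rightarrow> J (t, x) - V t x)\<bar>
        \<le> (\<Sum>b\<in>Basis. m b * \<bar>((t + h, y) - (t, x)) \<bullet> b\<bar>)"
    proof (rule local_Lipschitz[OF r cube \<Omega>(1) E m])
      show "\<bar>((t + h, y) - (t, x)) \<bullet> i\<bar> \<le> r" if "i \<in> Basis" for i
        using coord[OF that] hr by linarith
    qed (use r in auto)
    also have "\<dots> \<le> (\<Sum>b\<in>Basis. m b * (max 1 B * h))"
      using coord m0 by (intro sum_mono mult_left_mono) auto
    also have "\<dots> = ((\<Sum>b\<in>Basis. m b) * max 1 B) * h" by (simp add: sum_distrib_right mult.assoc)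
    finally show "(J (t + h, y) - V (t + h) y) - (J (t, x) - V t x) \<le> ((\<Sum>b\<in>Basis. m b) * max 1 B) * h"
      by simp
  qed
qed

text \<open>The end points of the trajectory lie on the boundary of the cylinder; there the bound follows from
  continuity of \<open>J\<close> and \<open>V\<close>.\<close>

lemma error_at_endpoints:
  fixes J :: "real \<times> (real^'n) \<Rightarrow> real"
  assumes J: "continuous_on ({0..T} \<times> UNIV) J" and x: "continuous_on {0..T} x"
    and le: "\<And>t. t \<in> {0<..<T} \<Longrightarrow> \<bar>J (t, x t) - V t (x t)\<bar> \<le> M"
  shows "\<bar>J (0, x 0) - V 0 (x 0)\<bar> \<le> M" "\<bar>J (T, x T) - V T (x T)\<bar> \<le> M"
proof -
  have px: "continuous_on {0..T} (\<lambda>t. (t, x t))" by (intro continuous_intros x)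
  have "continuous_on {0..T} (\<lambda>t. J (t, x t))"
    by (rule continuous_on_compose2[OF J px]) auto
  moreover have "continuous_on {0..T} (\<lambda>t. V t (x t))"
    using continuous_on_compose2[OF value_continuous px] by (simp add: image_subset_iff)
  ultimately have "continuous_on {0..T} (\<lambda>t. \<bar>J (t, x t) - V t (x t)\<bar>)" by (intro continuous_intros)
  then have c: "continuous_on (closure {0<..<T}) (\<lambda>t. \<bar>J (t, x t) - V t (x t)\<bar>)"
    using T by simp
  have "\<bar>J (s, x s) - V s (x s)\<bar> \<le> M" if "s \<in> {0..T}" for s
    by (rule continuous_le_on_closure[OF c]) (use that T le in auto)
  then show "\<bar>J (0, x 0) - V 0 (x 0)\<bar> \<le> M" "\<bar>J (T, x T) - V T (x T)\<bar> \<le> M" using T by auto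
qed

end

theorem theorem1:
  fixes c :: "real \<Rightarrow> real^'n \<Rightarrow> real^'m \<Rightarrow> real"
    and g :: "real^'n \<Rightarrow> real"
    and f :: "real \<Rightarrow> real^'n \<Rightarrow> real^'m \<Rightarrow> real^'n"
    and U :: "(real^'m) set"
    and T \<beta>f R C :: real
    and J :: "real \<times> (real^'n) \<Rightarrow> real"
    and \<pi>J :: "real \<Rightarrow> real^'n \<Rightarrow> real^'m"
    and x0 :: "real^'n"
  assumes "T > 0"
    and "class_L c g f U T \<beta>f"
    and "candidate_value_function c f U T J"
    and "associated_controller c f U T J \<pi>J"
    and "R = (1 + norm x0) * exp (\<beta>f * T) - 1"
    and "C = 2 * Max {1, T, T * \<beta>f * (1 + R)}"
  shows "ereal (optimality_gap c g f U T (controller_input f T \<pi>J x0) x0)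
    \<le> ereal C * W1inf_norm ({0..T} \<times> ball 0 R) (\<lambda>(t, x). J (t, x) - value_function c g f U T t x)"
proof -
  note L = assms(2)[unfolded class_L_def]
  have "\<exists>\<alpha>f>0. \<forall>x y. \<forall>t\<in>{0..T}. \<forall>u\<in>U. norm (f t x u - f t y u) \<le> \<alpha>f * norm (x - y)" using L by blast
  then obtain \<alpha>f where \<alpha>f: "\<alpha>f > 0" "\<forall>x y. \<forall>t\<in>{0..T}. \<forall>u\<in>U. norm (f t x u - f t y u) \<le> \<alpha>f * norm (x - y)" by blast
  have "\<exists>\<alpha>c>0. \<forall>x y. \<forall>t\<in>{0..T}. \<forall>u\<in>U. \<bar>c t x u - c t y u\<bar> \<le> \<alpha>c * norm (x - y)" using L by blast
  then obtain \<alpha>c where \<alpha>c: "\<alpha>c > 0" "\<forall>x y. \<forall>t\<in>{0..T}. \<forall>u\<in>U. \<bar>c t x u - c t y u\<bar> \<le> \<alpha>c * norm (x - y)" by blast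
  have "\<exists>\<alpha>g>0. \<forall>x y. \<bar>g x - g y\<bar> \<le> \<alpha>g * norm (x - y)" using L by blast
  then obtain \<alpha>g where \<alpha>g: "\<alpha>g > 0" "\<forall>x y. \<bar>g x - g y\<bar> \<le> \<alpha>g * norm (x - y)" by blast
  have "\<exists>\<beta>c>0. \<forall>x. \<forall>t\<in>{0..T}. \<forall>u\<in>U. \<bar>c t x u\<bar> \<le> \<beta>c * (1 + norm x)" using L by blast
  then obtain \<beta>c where \<beta>c: "\<beta>c > 0" "\<forall>x. \<forall>t\<in>{0..T}. \<forall>u\<in>U. \<bar>c t x u\<bar> \<le> \<beta>c * (1 + norm x)" by blast
  have "\<exists>\<beta>g>0. \<forall>x. \<bar>g x\<bar> \<le> \<beta>g * (1 + norm x)" using L by blast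
  then obtain \<beta>g where \<beta>g: "\<beta>g > 0" "\<forall>x. \<bar>g x\<bar> \<le> \<beta>g * (1 + norm x)" by blast
  have \<beta>f: "\<beta>f > 0" "\<forall>x. \<forall>t\<in>{0..T}. \<forall>u\<in>U. norm (f t x u) \<le> \<beta>f * (1 + norm x)" using L by blast+
  have unif: "\<forall>x. uniformly_continuous_on ({0..T} \<times> U) (\<lambda>(t, u). f t x u)"
    "\<forall>x. uniformly_continuous_on ({0..T} \<times> U) (\<lambda>(t, u). c t x u)" using L by blast+
  have adm: "admissible_controller f U T \<pi>J" and \<pi>U: "\<forall>t\<in>{0..T}. \<forall>x. \<pi>J t x \<in> U"
    using assms(4) unfolding associated_controller_def by blast+
  have "U \<noteq> {}" using \<pi>U[THEN bspec, of 0] assms(1) by auto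
  interpret optimal_control f U T \<beta>f \<alpha>f c g \<alpha>c \<alpha>g \<beta>c \<beta>g
    by unfold_locales (use assms(1) \<alpha>f \<alpha>c \<alpha>g \<beta>c \<beta>g \<beta>f unif \<open>U \<noteq> {}\<close> in \<open>simp_all\<close>)
  have T0: "0 \<le> T" using assms(1) by simp
  define X where "X = the_ode_solution (\<lambda>t y. f t y (\<pi>J t y)) 0 T x0"
  define u where "u = controller_input f T \<pi>J x0"
  have u: "u = (\<lambda>t. \<pi>J t (X t))" by (simp add: u_def X_def controller_input_def fun_eq_iff)
  have "0 \<in> {0..T}" using T0 by simp
  from adm[unfolded admissible_controller_def, THEN conjunct2, THEN bspec, OF this, THEN spec, of x0]
  have uniq: "unique_ode_solution (\<lambda>t y. f t y (\<pi>J t y)) 0 T x0"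
    and inp: "\<And>x. ode_solution (\<lambda>t y. f t y (\<pi>J t y)) 0 T x0 x \<Longrightarrow> admissible_input U T 0 (\<lambda>t. \<pi>J t (x t))"
    by blast+
  have solX: "ode_solution (\<lambda>t y. f t y (\<pi>J t y)) 0 T x0 X"
    unfolding X_def the_ode_solution_def by (rule someI_ex[OF uniq[unfolded unique_ode_solution_def, THEN conjunct1]])
  then have solX': "ode_solution (\<lambda>t y. f t y (u t)) 0 T x0 X" by (simp add: ode_solution_def u)
  have trX: "trajectory 0 x0 u X"
    unfolding trajectory_def using inp[OF solX] solX' by (simp add: u)
  define x where "x = the_ode_solution (\<lambda>t y. f t y (u t)) 0 T x0"
  have "ode_solution (\<lambda>t y. f t y (u t)) 0 T x0 x"
    unfolding x_def the_ode_solution_def by (rule someI[where x = X and P = "ode_solution (\<lambda>t y. f t y (u t)) 0 T x0"]) (rule solX')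
  then have trx: "trajectory 0 x0 u x" using trX by (simp add: trajectory_def)
  \<comment> \<open>The open-loop solution for the closed-loop input \<open>u\<close> is the closed-loop solution, by stability.\<close>
  have xX: "x t = X t" if t: "t \<in> {0..T}" for t
  proof -
    have "norm (x t - X t) \<le> norm (x 0 - X 0) * exp (\<alpha>f * (t - 0))"
    proof (rule solution_stability[where u = u])
      show "continuous_on {0..t} x" "continuous_on {0..t} X"
        using trajectory_continuous[OF trx order_refl] trajectory_continuous[OF trX order_refl] t by auto
      show "x r - x 0 = integral {0..r} (\<lambda>t. f t (x t) (u t))" if "r \<in> {0..t}" for r
        using that t by (intro trajectory_increment(2)[OF trx]) auto
      show "X r - X 0 = integral {0..r} (\<lambda>t. f t (X t) (u t))" if "r \<in> {0..t}" for r
        using that t by (intro trajectory_increment(2)[OF trX]) auto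
      show "u \<in> borel_measurable (lebesgue_on {0..t})"
        by (rule trajectory_input(1)[OF trx order_refl]) (use t in simp)
      show "u r \<in> U" if "r \<in> {0..t}" for r
        by (rule trajectory_input(2)[OF trx order_refl _ that]) (use t in simp)
    qed (use t in auto)
    then show ?thesis using trajectory_start[OF trx] trajectory_start[OF trX] by simp
  qed
  have ux: "u t = \<pi>J t (x t)" if "t \<in> {0..T}" for t using xX[OF that] by (simp add: u)
  have gap: "optimality_gap c g f U T u x0 = integral {0..T} (\<lambda>t. c t (x t) (u t)) + V T (x T) - V 0 x0"
    using cost_eq[OF trx order_refl T0] by (simp add: optimality_gap_def x_def value_at_final_time)
  have R: "0 < R"
  proof -
    have "1 * 1 < (1 + norm x0) * exp (\<beta>f * T)"
      using \<beta>f(1) assms(1) by (intro mult_le_less_imp_less) auto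
    then show ?thesis using assms(5) by simp
  qed
  have xR: "norm (x t) < R" if t: "t \<in> {0..<T}" for t
  proof -
    have "1 + norm (x t) \<le> (1 + norm x0) * exp (\<beta>f * (t - 0))"
      using trx t unfolding trajectory_def by (intro solution_growth) auto
    also have "\<dots> < (1 + norm x0) * exp (\<beta>f * T)"
      using t \<beta>f(1) by (intro mult_strict_left_mono) (auto intro: add_pos_nonneg)
    finally show ?thesis using assms(5) by simp
  qed
  obtain K where lip: "K-lipschitz_on ({0..T} \<times> UNIV) J"
    using assms(3) unfolding candidate_value_function_def by blast
  have eqD: "semidiff ({0..T} \<times> UNIV) J (t, x) = clarke_gradient ({0..T} \<times> UNIV) J (t, x)" if "t \<in> {0<..<T}" for t x
    using assms(3) that unfolding candidate_value_function_def by blast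
  obtain pJ qJ where arg: "\<And>t x. t \<in> {0<..<T} \<Longrightarrow>
        is_arg_min (\<lambda>(p, q, u). p + hamiltonian c f t x u q)
          (\<lambda>(p, q, u). (p, q) \<in> semidiff ({0..T} \<times> UNIV) J (t, x) \<and> u \<in> U)
          (pJ (t, x), qJ (t, x), \<pi>J t x)"
    using assms(4) unfolding associated_controller_def by blast
  define E where "E = (\<lambda>(t, x). J (t, x) - V t x)"
  define \<Omega> where "\<Omega> = {0<..<T} \<times> ball (0 :: real^'n) R"
  have int\<Omega>: "interior ({0..T} \<times> ball (0 :: real^'n) R) = \<Omega>"
    by (simp add: \<Omega>_def interior_Times)
  have \<Omega>: "open \<Omega>" "\<Omega> \<noteq> {}" using assms(1) R by (auto simp: \<Omega>_def open_Times)
  have Jc: "continuous_on ({0..T} \<times> UNIV) J" by (rule lipschitz_on_continuous_on[OF lip])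
  have "continuous_on ({0..T} \<times> UNIV) E"
    unfolding E_def using value_continuous Jc by (simp add: case_prod_beta continuous_on_diff)
  then have Ec: "continuous_on \<Omega> E" by (rule continuous_on_subset) (auto simp: \<Omega>_def)
  define n0 where "n0 = esssup (lebesgue_on \<Omega>) (\<lambda>x. ereal \<bar>E x\<bar>)"
  define n where "n b = weak_deriv_norm \<Omega> E b" for b
  have W: "W1inf_norm ({0..T} \<times> ball 0 R) E = n0 + (\<Sum>b\<in>Basis. n b)"
    unfolding W1inf_norm_def int\<Omega> n0_def n_def weak_deriv_norm_def ..
  have n0: "0 \<le> n0" unfolding n0_def by (rule esssup_abs_nonneg[OF \<Omega>])
  have nb: "0 \<le> n b" for b unfolding n_def by (rule weak_deriv_norm_nonneg[OF \<Omega>])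
  have C: "2 \<le> C" "T * max 1 (\<beta>f * (1 + R)) \<le> C"
  proof -
    define A where "A = Max {1, T, T * \<beta>f * (1 + R)}"
    have A: "1 \<le> A" "T \<le> A" "T * \<beta>f * (1 + R) \<le> A" by (simp_all add: A_def)
    have "T * max 1 (\<beta>f * (1 + R)) \<le> A" using A T0 by (simp add: max_def mult.assoc)
    then show "2 \<le> C" "T * max 1 (\<beta>f * (1 + R)) \<le> C"
      using A assms(6) unfolding A_def[symmetric] by auto
  qed
  have "ereal (optimality_gap c g f U T u x0) \<le> ereal C * (n0 + (\<Sum>b\<in>Basis. n b))"
  proof (cases "n0 + (\<Sum>b\<in>Basis. n b) = \<infinity>")
    case True
    show ?thesis unfolding True using C(1) by simp
  next
    case False
    then have "n0 \<noteq> \<infinity>" "(\<Sum>b\<in>Basis. n b) \<noteq> \<infinity>" by auto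
    then obtain m0 where m0: "n0 = ereal m0" using n0 by (cases n0) auto
    define m where "m b = real_of_ereal (n b)" for b
    have m: "n b = ereal (m b)" if "b \<in> Basis" for b
    proof -
      have "n b \<noteq> \<infinity>" using \<open>(\<Sum>b\<in>Basis. n b) \<noteq> \<infinity>\<close> that by (auto simp: sum_Pinfty)
      then show ?thesis using nb[of b] by (cases "n b") (auto simp: m_def)
    qed
    define S where "S = (\<Sum>b\<in>Basis. m b)"
    have S: "(\<Sum>b\<in>Basis. n b) = ereal S" using m by (simp add: S_def)
    then have S0: "0 \<le> S" using sum_nonneg[of Basis n] nb by simp
    have m00: "0 \<le> m0" using n0 m0 by simp
    define B where "B = \<beta>f * (1 + R)"
    have inner: "\<exists>p q. (p, q) \<in> semidiff ({0..T} \<times> UNIV) J (t, x t) \<and>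
      p + c t (x t) (u t) + q \<bullet> f t (x t) (u t) \<le> S * max 1 B" if t: "t \<in> {0<..<T}" for t
    proof (intro exI conjI)
      let ?p = "pJ (t, x t)" and ?q = "qJ (t, x t)"
      note am = arg[OF t, of "x t", unfolded is_arg_min_def hamiltonian_def]
      show "(?p, ?q) \<in> semidiff ({0..T} \<times> UNIV) J (t, x t)" using am by simp
      have ut: "u t = \<pi>J t (x t)" using t by (intro ux) simp
      have xt: "norm (x t) < R" using t by (intro xR) simp
      have in\<Omega>: "(t, x t) \<in> \<Omega>" using t xt by (simp add: \<Omega>_def)
      show "?p + c t (x t) (u t) + ?q \<bullet> f t (x t) (u t) \<le> S * max 1 B"
      proof (rule hamiltonian_le_of_error_growth[OF lip t xt])
        fix p q v assume "(p, q) \<in> clarke_gradient ({0..T} \<times> UNIV) J (t, x t)" "v \<in> U"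
        then have "(p, q) \<in> semidiff ({0..T} \<times> UNIV) J (t, x t) \<and> v \<in> U" using eqD[OF t] by simp
        then show "?p + c t (x t) (u t) + ?q \<bullet> f t (x t) (u t) \<le> p + c t (x t) v + q \<bullet> f t (x t) v"
          using am[THEN conjunct2, unfolded not_ex, THEN spec, of "(p, q, v)"] by (simp add: ut)
      next
        have "0 \<le> B" using \<beta>f(1) R by (simp add: B_def)
        moreover have "weak_deriv_norm \<Omega> (\<lambda>(t, x). J (t, x) - V t x) b = ereal (m b)" if "b \<in> Basis" for b
          using m[OF that] by (simp add: n_def E_def)
        ultimately show "\<exists>\<delta>>0. \<forall>h y. 0 < h \<longrightarrow> h < \<delta> \<longrightarrow> norm (y - x t) \<le> \<beta>f * (1 + R) * h \<longrightarrow>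
            J (t + h, y) - V (t + h) y - (J (t, x t) - V t (x t)) \<le> S * max 1 B * h"
          unfolding S_def B_def[symmetric]
          by (intro error_growth_bound[OF \<Omega>(1) in\<Omega> _ Ec[unfolded E_def]])
      qed
    qed
    have 1: "J (T, x T) - J (0, x0) + integral {0..T} (\<lambda>t. c t (x t) (u t)) \<le> S * max 1 B * T"
      by (rule cost_gap_bound[OF lip trx inner])
    have Em0: "\<bar>J (t, x t) - V t (x t)\<bar> \<le> m0" if t: "t \<in> {0<..<T}" for t
    proof -
      have "(t, x t) \<in> \<Omega>" using t xR[of t] by (simp add: \<Omega>_def)
      from abs_le_esssup[OF \<Omega>(1) Ec this] show ?thesis
        unfolding n0_def[symmetric] m0 by (simp add: E_def)
    qed
    note ends = error_at_endpoints[OF Jc trajectory_continuous[OF trx order_refl order_refl] Em0]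
    have "optimality_gap c g f U T u x0 \<le> S * max 1 B * T + 2 * m0"
      using 1 ends gap trajectory_start[OF trx] by (simp add: abs_le_iff)
    also have "\<dots> \<le> C * S + C * m0"
    proof (rule add_mono)
      show "S * max 1 B * T \<le> C * S"
        using mult_left_mono[OF C(2) S0] by (simp add: B_def mult_ac)
      show "2 * m0 \<le> C * m0" using C(1) m00 by (rule mult_right_mono)
    qed
    finally have "optimality_gap c g f U T u x0 \<le> C * (m0 + S)" by (simp add: algebra_simps)
    then show ?thesis by (simp add: S m0)
  qed
  then show ?thesis unfolding u_def W[symmetric] E_def .
qed

end
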